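(* Let $\varphi$ be a growth function on $\mathbb R^n\times[0,\infty)$ satisfying $np(\varphi)<(n+1)i(\varphi)$. Suppose in addition that either there exists a positive constant $C$ such that $\frac{\|\chi_{B_1}\|_{L^\varphi(\mathbb R^n)}}{|B_1|}\le C\frac{\|\chi_{B_2}\|_{L^\varphi(\mathbb R^n)}}{|B_2|}$ for all balls $B_1\subset B_2$ in $\mathbb R^n$, or $p(\varphi)[r(\varphi)]'\in(1,2)$. Then the spaces $\mathrm{BMO}^\varphi(\mathbb R^n)$ and $\mathrm{BMO}^\varphi_{\Delta}(\mathbb R^n)$ (modulo $\mathcal K_{\Delta}(\mathbb R^n)$) coincide with equivalent norms.
   Context: $\mathbb R^n$ carries the Euclidean metric and Lebesgue measure; $|E|$ is the Lebesgue measure of $E$; balls are Euclidean; $s'$ is the conjugate index of $s$ ($1/s+1/s'=1$). **Growth functions.** $\varphi:\mathbb R^n\times[0,\infty)\to[0,\infty)$ is of uniformly upper type $p$ (resp. uniformly lower type $p$) if $\exists C$ with $\varphi(x,st)\le Cs^p\varphi(x,t)$ for all $x$, $t\ge0$ and $s\ge1$ (resp. $s\in(0,1)$). For $p\in(1,\infty)$, $\varphi\in\mathbb A_p(\mathbb R^n)$ means $\sup_{t>0}\sup_B\frac1{|B|}\int_B\varphi(x,t)dx\{\frac1{|B|}\int_B[\varphi(x,t)]^{-1/(p-1)}dx\}^{p-1}<\infty$; $\varphi\in\mathbb A_1(\mathbb R^n)$ means $\sup_{t>0}\sup_B\frac1{|B|}\int_B\varphi(x,t)dx\{\mathrm{ess\,sup}_{y\in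 B}[\varphi(y,t)]^{-1}\}<\infty$; $\mathbb A_\infty=\bigcup_{p\in[1,\infty)}\mathbb A_p$. For $q\in(1,\infty)$, $\varphi\in\mathbb{RH}_q(\mathbb R^n)$ means $\sup_{t>0}\sup_B\{\frac1{|B|}\int_B[\varphi(x,t)]^qdx\}^{1/q}\{\frac1{|B|}\int_B\varphi(x,t)dx\}^{-1}<\infty$; for $q=\infty$ the first factor is replaced by $\mathrm{ess\,sup}_{y\in B}\varphi(y,t)$. $\varphi$ is a growth function if: for each $x$, $\varphi(x,\cdot)$ is nondecreasing, $\varphi(x,0)=0$, $\varphi(x,t)>0$ for $t>0$, $\lim_{t\to\infty}\varphi(x,t)=\infty$; $\varphi(\cdot,t)$ is measurable for each $t$; $\varphi\in\mathbb A_\infty(\mathbb R^n)$; $\varphi$ is of uniformly upper type $1$ and of uniformly lower type $p$ for some $p\in(0,1]$. $i(\varphi)=\sup\{p>0:\varphi$ of uniformly lower type $p\}$; $p(\varphi)=\inf\{p\in[1,\infty):\varphi\in\mathbb A_p(\mathbb R^n)\}$; $r(\varphi)=\sup\{q\in(1,\infty]:\varphi\in\mathbb{RH}_q(\mathbb R^n)\}$. $\|f\|_{L^\varphi(\mathbb R^n)}=\inf\{\lambda>0:\int_{\mathbb R^n}\varphi(x,|f(x)|/\lambda)dx\le1\}$. **Space $\mathrm{BMO}^\varphi(\mathbb R^n)$.** Locally integrable $f$ with $\|f\|_{\mathrm{BMO}^\varphi(\mathbb R^n)}=\sup_B\frac1{\|\chi_B\|_{L^\varphi(\mathbb R^n)}}\int_B|f(x)-f_B|dx<\infty$,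 $f_B=\frac1{|B|}\int_Bf$. **Heat semigroup.** $\Delta=-\sum_{i=1}^n\partial_{x_i}^2$. For functions $f$ with $\int_{\mathbb R^n}|f(x)|e^{-|x|}dx<\infty$, $H_tf(x)=\int_{\mathbb R^n}\frac1{(4\pi t)^{n/2}}e^{-|x-y|^2/(4t)}f(y)dy$; on $L^p(\mathbb R^n)$, $p\in[1,\infty]$, $H_t=e^{-t\Delta}$. **Space $\mathrm{BMO}^\varphi_\Delta(\mathbb R^n)$.** All $f$ with $\int_{\mathbb R^n}|f(x)|e^{-|x|}dx<\infty$ and $\|f\|_{\mathrm{BMO}^\varphi_\Delta(\mathbb R^n)}=\sup_B\frac1{\|\chi_B\|_{L^\varphi(\mathbb R^n)}}\int_B|f(x)-H_{r_B^2}f(x)|dx<\infty$, the supremum over all balls $B$, $r_B$ the radius of $B$. $\mathcal K_\Delta(\mathbb R^n)$ is the set of $f$ with $\int_{\mathbb R^n}|f(x)|e^{-|x|}dx<\infty$ and $H_tf=f$ a.e. for all $t>0$, on which the seminorm vanishes; "modulo" means that functions differing by an element of this space are identified. *)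

theory Defs
  imports "HOL-Probability.Essential_Supremum"
begin

text \<open>
  Suprema, averages and norms are taken in \<^typ>\<open>ennreal\<close>, and the critical indices in
  \<^typ>\<open>ereal\<close>, so that they make sense without prior finiteness proofs.  A ball is given by its
  centre \<open>x\<close> and radius \<open>r > 0\<close>; balls are open.  A map on \<open>\<real>\<^sup>n \<times> [0,\<infinity>)\<close> is represented by a
  curried function on \<open>\<real>\<^sup>n\<close> and \<open>\<real>\<close> of which only the values at \<open>t \<ge> 0\<close> are used.
\<close>

text \<open>Used only with a positive exponent \<open>p\<close>, whence the value at \<^term>\<open>top\<close>.\<close>
definition ennreal_powr :: "ennreal \<Rightarrow> real \<Rightarrow> ennreal" where
  "ennreal_powr a p = (if a = top then top else ennreal (enn2real a powr p))"

definition ball_avg :: "(real^'n \<Rightarrow> ennreal) \<Rightarrow> real^'n \<Rightarrow> real \<Rightarrow> ennreal" where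
  "ball_avg g x r = (\<integral>\<^sup>+y\<in>ball x r. g y \<partial>lebesgue) / emeasure lebesgue (ball x r)"

subsection \<open>Growth functions\<close>

definition unif_upper_type :: "(real^'n \<Rightarrow> real \<Rightarrow> real) \<Rightarrow> real \<Rightarrow> bool" where
  "unif_upper_type \<phi> p \<longleftrightarrow>
     (\<exists>C. \<forall>x. \<forall>t\<ge>0. \<forall>s\<ge>1. \<phi> x (s * t) \<le> C * s powr p * \<phi> x t)"

definition unif_lower_type :: "(real^'n \<Rightarrow> real \<Rightarrow> real) \<Rightarrow> real \<Rightarrow> bool" where
  "unif_lower_type \<phi> p \<longleftrightarrow>
     (\<exists>C. \<forall>x. \<forall>t\<ge>0. \<forall>s\<in>{0<..<1}. \<phi> x (s * t) \<le> C * s powr p * \<phi> x t)"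

text \<open>The weight classes are only of interest for \<open>\<phi> x t > 0\<close>, so that the conventions
  \<open>0 powr a = 0\<close> and \<open>0 * top = 0\<close> play no role.\<close>
definition muckenhoupt :: "real \<Rightarrow> (real^'n \<Rightarrow> real \<Rightarrow> real) \<Rightarrow> bool" where
  "muckenhoupt p \<phi> \<longleftrightarrow>
     (SUP t\<in>{0<..}. SUP x. SUP r\<in>{0<..}.
        ball_avg (\<lambda>y. ennreal (\<phi> y t)) x r *
        (if p = 1 then esssup (lebesgue_on (ball x r)) (\<lambda>y. inverse (ennreal (\<phi> y t)))
         else ennreal_powr
                (ball_avg (\<lambda>y. ennreal (\<phi> y t powr (- 1 / (p - 1)))) x r) (p - 1))) < top"

definition muckenhoupt_inf :: "(real^'n \<Rightarrow> real \<Rightarrow> real) \<Rightarrow> bool" where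
  "muckenhoupt_inf \<phi> \<longleftrightarrow> (\<exists>p\<ge>1. muckenhoupt p \<phi>)"

definition reverse_hoelder :: "ereal \<Rightarrow> (real^'n \<Rightarrow> real \<Rightarrow> real) \<Rightarrow> bool" where
  "reverse_hoelder q \<phi> \<longleftrightarrow>
     (SUP t\<in>{0<..}. SUP x. SUP r\<in>{0<..}.
        (if q = \<infinity> then esssup (lebesgue_on (ball x r)) (\<lambda>y. ennreal (\<phi> y t))
         else ennreal_powr
                (ball_avg (\<lambda>y. ennreal (\<phi> y t powr real_of_ereal q)) x r) (1 / real_of_ereal q)) *
        inverse (ball_avg (\<lambda>y. ennreal (\<phi> y t)) x r)) < top"

definition growth_function :: "(real^'n \<Rightarrow> real \<Rightarrow> real) \<Rightarrow> bool" where
  "growth_function \<phi> \<longleftrightarrow>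
     (\<forall>x. mono_on {0..} (\<phi> x) \<and> \<phi> x 0 = 0 \<and> (\<forall>t>0. \<phi> x t > 0) \<and>
          filterlim (\<phi> x) at_top at_top) \<and>
     (\<forall>t\<ge>0. (\<lambda>x. \<phi> x t) \<in> borel_measurable lebesgue) \<and>
     muckenhoupt_inf \<phi> \<and>
     unif_upper_type \<phi> 1 \<and>
     (\<exists>p. 0 < p \<and> p \<le> 1 \<and> unif_lower_type \<phi> p)"

definition lower_type_index :: "(real^'n \<Rightarrow> real \<Rightarrow> real) \<Rightarrow> ereal" where
  "lower_type_index \<phi> = (SUP p\<in>{p. 0 < p \<and> unif_lower_type \<phi> p}. ereal p)"

definition weight_index :: "(real^'n \<Rightarrow> real \<Rightarrow> real) \<Rightarrow> ereal" where
  "weight_index \<phi> = (INF p\<in>{p. 1 \<le> p \<and> muckenhoupt p \<phi>}. ereal p)"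

definition reverse_hoelder_index :: "(real^'n \<Rightarrow> real \<Rightarrow> real) \<Rightarrow> ereal" where
  "reverse_hoelder_index \<phi> = Sup {q. 1 < q \<and> reverse_hoelder q \<phi>}"

text \<open>The solution \<open>s'\<close> of \<open>1 / s + 1 / s' = 1\<close> for \<open>1 \<le> s \<le> \<infinity>\<close>; in \<^typ>\<open>ereal\<close>,
  \<open>1 / \<infinity> = 0\<close> and \<open>1 / 0 = \<infinity>\<close>.\<close>
definition conjugate_index :: "ereal \<Rightarrow> ereal" where
  "conjugate_index s = 1 / (1 - 1 / s)"

definition luxemburg_norm ::
    "(real^'n \<Rightarrow> real \<Rightarrow> real) \<Rightarrow> (real^'n \<Rightarrow> 'b::real_normed_vector) \<Rightarrow> ennreal" where
  "luxemburg_norm \<phi> f =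
     (INF c\<in>{c. 0 < c \<and> (\<integral>\<^sup>+x. ennreal (\<phi> x (norm (f x) / c)) \<partial>lebesgue) \<le> 1}. ennreal c)"

abbreviation ball_norm :: "(real^'n \<Rightarrow> real \<Rightarrow> real) \<Rightarrow> real^'n \<Rightarrow> real \<Rightarrow> ennreal" where
  "ball_norm \<phi> x r \<equiv> luxemburg_norm \<phi> (indicator (ball x r) :: real^'n \<Rightarrow> real)"

subsection \<open>The space \<open>BMO\<^sup>\<phi>\<close>\<close>

definition ball_mean :: "(real^'n \<Rightarrow> complex) \<Rightarrow> real^'n \<Rightarrow> real \<Rightarrow> complex" where
  "ball_mean f x r = (LINT y:ball x r|lebesgue. f y) /\<^sub>R measure lebesgue (ball x r)"

definition bmo_norm :: "(real^'n \<Rightarrow> real \<Rightarrow> real) \<Rightarrow> (real^'n \<Rightarrow> complex) \<Rightarrow> ennreal" where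
  "bmo_norm \<phi> f = (SUP x. SUP r\<in>{0<..}.
     (\<integral>\<^sup>+y\<in>ball x r. ennreal (norm (f y - ball_mean f x r)) \<partial>lebesgue) / ball_norm \<phi> x r)"

definition bmo_space :: "(real^'n \<Rightarrow> real \<Rightarrow> real) \<Rightarrow> (real^'n \<Rightarrow> complex) set" where
  "bmo_space \<phi> =
     {f. (\<forall>K. compact K \<longrightarrow> f absolutely_integrable_on K) \<and> bmo_norm \<phi> f < top}"

subsection \<open>The space \<open>BMO\<^sup>\<phi>\<close> associated with the heat semigroup\<close>

definition exp_integrable :: "(real^'n \<Rightarrow> complex) \<Rightarrow> bool" where
  "exp_integrable f \<longleftrightarrow> f \<in> borel_measurable lebesgue \<and>
     (\<integral>\<^sup>+x. ennreal (norm (f x) * exp (- norm x)) \<partial>lebesgue) < top"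

definition heat :: "real \<Rightarrow> (real^'n \<Rightarrow> complex) \<Rightarrow> real^'n \<Rightarrow> complex" where
  "heat t f x = (LINT y|lebesgue.
     (exp (- (norm (x - y))\<^sup>2 / (4 * t)) / (4 * pi * t) powr (real CARD('n) / 2)) *\<^sub>R f y)"

definition heat_bmo_norm :: "(real^'n \<Rightarrow> real \<Rightarrow> real) \<Rightarrow> (real^'n \<Rightarrow> complex) \<Rightarrow> ennreal" where
  "heat_bmo_norm \<phi> f = (SUP x. SUP r\<in>{0<..}.
     (\<integral>\<^sup>+y\<in>ball x r. ennreal (norm (f y - heat (r\<^sup>2) f y)) \<partial>lebesgue) / ball_norm \<phi> x r)"

definition heat_bmo_space :: "(real^'n \<Rightarrow> real \<Rightarrow> real) \<Rightarrow> (real^'n \<Rightarrow> complex) set" where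
  "heat_bmo_space \<phi> = {f. exp_integrable f \<and> heat_bmo_norm \<phi> f < top}"

definition heat_fixed :: "(real^'n \<Rightarrow> complex) set" where
  "heat_fixed = {f. exp_integrable f \<and> (\<forall>t>0. AE x in lebesgue. heat t f x = f x)}"

end

theory Submission
  imports Defs "HOL-Probability.Distributions"
begin

text \<open>
  Write \<open>\<psi> x r\<close> for the norm of the indicator of \<open>ball x r\<close>, \<open>H\<close> for the heat semigroup and \<open>n\<close> for
  the dimension. The weight condition with exponent \<open>q\<close> and the lower type \<open>p\<close> give
  \<open>\<psi> x R \<le> K (R / r) powr a * \<psi> x r\<close> with \<open>a = n q / p\<close>, and the hypothesis on the indices allows
  \<open>a < n + 1\<close>. If \<open>f\<close> has finite heat norm then
  \<open>H s f - H s' f = H s (f - H (s' - s) f)\<close> for \<open>2 s \<le> s' \<le> 4 s\<close> has Lipschitz constant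
  \<open>O(\<psi> x (sqrt s) / sqrt s ^ (n + 1))\<close>. As \<open>a < n + 1\<close>, these bounds sum along \<open>s, 2 s, 4 s, \<dots>\<close>,
  so \<open>H s f\<close> converges modulo constants, as \<open>s\<close> tends to infinity, to some \<open>h\<close> fixed by the heat
  semigroup, and on a ball of radius \<open>r\<close> the function \<open>f - h\<close> differs by a constant from
  \<open>f - H (r\<^sup>2) f\<close> up to \<open>O(\<psi> x r / r ^ n)\<close>. For \<open>f\<close> of bounded mean oscillation the same decay
  forces \<open>h\<close> to be constant.
\<close>

section \<open>The heat kernel\<close>

text \<open>The exponent n + 1 is where the index hypothesis meets the heat kernel. A function with
  mass about \<psi> x r on balls of radius r has a heat extension of size \<psi> x r / r ^ n at time
  r ^ 2, and only differences of its values gain the further factor norm (x - y) / r. Since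
  \<open>a\<close> may exceed n, decay is available for differences only. Hence everything takes
  place modulo constants, and \<open>heat t h = h\<close> is obtained at first only up to a constant
  depending on \<open>t\<close>, which has to be excluded separately. A second obstacle is that the
  kernel sees all of space, whereas the heat norm controls \<open>f - heat (r^2) f\<close> only on
  balls of the one radius r. The bridge is \<open>ball_growth\<close>: integrals over concentric
  balls growing polynomially in the radius, which the kernel beats because it decays to every
  polynomial order. The growth function enters only through \<psi>, so the analysis is done for an
  abstract gauge in \<open>ball_gauge\<close>. Finally, functions differing by a heat fixed function
  have equal heat norms, which reduces the comparison of norms to a single function of bounded mean
  oscillation, where h = 0 is admissible.\<close>

definition heat_kernel :: "real \<Rightarrow> real^'n \<Rightarrow> real" where
  "heat_kernel t x = exp (- (norm x)\<^sup>2 / (4 * t)) / (4 * pi * t) powr (real CARD('n) / 2)"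

lemma heat_kernel_nonneg [simp]: "0 \<le> heat_kernel t x"
  by (simp add: heat_kernel_def)

lemma heat_kernel_minus [simp]: "heat_kernel t (- x) = heat_kernel t x"
  by (simp add: heat_kernel_def)

lemma heat_kernel_measurable [measurable]: "heat_kernel t \<in> borel_measurable borel"
  unfolding heat_kernel_def by measurable

lemma heat_eq: "heat t f x = (LINT y|lebesgue. heat_kernel t (x - y) *\<^sub>R f y)"
  by (simp add: heat_def heat_kernel_def)

lemma powr_half_nat: "0 < c \<Longrightarrow> c powr (real n / 2) = sqrt c ^ n"
  by (metis mult.commute mult_1 powr_half_sqrt powr_powr powr_realpow real_sqrt_gt_0_iff
      times_divide_eq_left order_less_imp_le)

text \<open>The squared norm is a sum over coordinates, so the kernel splits into normal densities
  of variance \<open>2 * t\<close>. Total mass and the semigroup law thereby reduce to one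
  dimension.\<close>

lemma heat_kernel_prod:
  fixes x :: "real^'n"
  assumes "0 < t"
  shows "heat_kernel t x = (\<Prod>b\<in>Basis. normal_density 0 (sqrt (2 * t)) (x \<bullet> b))"
proof -
  have "(\<Prod>b\<in>(Basis :: (real^'n) set). normal_density 0 (sqrt (2 * t)) (x \<bullet> b))
      = (\<Prod>b\<in>(Basis :: (real^'n) set). 1 / sqrt (4 * pi * t)) * (\<Prod>b\<in>Basis. exp (- (x \<bullet> b)\<^sup>2 / (4 * t)))"
    using assms by (simp add: normal_density_def prod_dividef power_one_over mult_ac)
  also have "(\<Prod>b\<in>(Basis :: (real^'n) set). 1 / sqrt (4 * pi * t)) = 1 / (4 * pi * t) powr (real CARD('n) / 2)"
    using assms by (subst powr_half_nat) (auto simp: power_one_over)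
  also have "(\<Prod>b\<in>Basis. exp (- (x \<bullet> b)\<^sup>2 / (4 * t))) = exp (- (norm x)\<^sup>2 / (4 * t))"
  proof -
    have "(norm x)\<^sup>2 = (\<Sum>b\<in>Basis. (x \<bullet> b)\<^sup>2)"
      unfolding power2_norm_eq_inner by (subst euclidean_inner) (simp add: power2_eq_square)
    then show ?thesis
      by (simp add: exp_sum[symmetric] sum_negf sum_divide_distrib)
  qed
  finally show ?thesis
    by (simp add: heat_kernel_def)
qed

lemma nn_integral_heat_kernel:
  assumes "0 < t"
  shows "(\<integral>\<^sup>+y. ennreal (heat_kernel t (y :: real^'n)) \<partial>lborel) = 1"
proof -
  have 1: "(\<integral>\<^sup>+u. ennreal (normal_density 0 (sqrt (2 * t)) u) \<partial>lborel) = 1"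
    using assms by (subst nn_integral_eq_integral) auto
  have "(\<integral>\<^sup>+y. ennreal (heat_kernel t (y :: real^'n)) \<partial>lborel)
     = (\<integral>\<^sup>+y. (\<Prod>b\<in>(Basis :: (real^'n) set). ennreal (normal_density 0 (sqrt (2 * t)) (y \<bullet> b))) \<partial>lborel)"
    using assms by (simp add: heat_kernel_prod prod_ennreal)
  also have "\<dots> = 1"
    by (subst nn_integral_lborel_prod) (auto simp: 1)
  finally show ?thesis .
qed

text \<open>In each coordinate the variances \<open>2 * s\<close> and \<open>2 * t\<close> add under
  convolution. Translation by \<open>z\<close> turns the integral into a convolution evaluated at
  \<open>x - z\<close>.\<close>

lemma nn_integral_heat_kernel_convolution:
  fixes x :: "real^'n"
  assumes "0 < s" "0 < t"
  shows "(\<integral>\<^sup>+y. ennreal (heat_kernel s (x - y) * heat_kernel t (y - z)) \<partial>lebesgue)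
       = ennreal (heat_kernel (s + t) (x - z))"
proof -
  have 1: "(\<integral>\<^sup>+u. ennreal (normal_density 0 (sqrt (2 * s)) (v - u) * normal_density 0 (sqrt (2 * t)) u) \<partial>lborel)
      = ennreal (normal_density 0 (sqrt (2 * (s + t))) v)" for v
    using fun_cong[OF conv_normal_density_zero_mean[of "sqrt (2 * s)" "sqrt (2 * t)"], of v] assms
    by (simp add: distrib_left)
  have 2: "(\<integral>\<^sup>+y. ennreal (heat_kernel s (v - y) * heat_kernel t y) \<partial>lborel)
       = ennreal (heat_kernel (s + t) v)" for v :: "real^'n"
  proof -
    have "(\<integral>\<^sup>+y. ennreal (heat_kernel s (v - y) * heat_kernel t y) \<partial>lborel)
       = (\<integral>\<^sup>+y. (\<Prod>b\<in>(Basis :: (real^'n) set). ennreal (normal_density 0 (sqrt (2 * s)) (v \<bullet> b - y \<bullet> b)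
              * normal_density 0 (sqrt (2 * t)) (y \<bullet> b))) \<partial>lborel)"
      using assms by (simp add: heat_kernel_prod prod_ennreal prod.distrib inner_diff_left)
    also have "\<dots> = (\<Prod>b\<in>(Basis :: (real^'n) set). ennreal (normal_density 0 (sqrt (2 * (s + t))) (v \<bullet> b)))"
      by (subst nn_integral_lborel_prod) (auto simp: 1)
    also have "\<dots> = ennreal (heat_kernel (s + t) v)"
      using assms by (simp add: heat_kernel_prod prod_ennreal)
    finally show ?thesis .
  qed
  have "(\<integral>\<^sup>+y. ennreal (heat_kernel s (x - y) * heat_kernel t (y - z)) \<partial>lebesgue)
      = (\<integral>\<^sup>+y. ennreal (heat_kernel s (x - y) * heat_kernel t (y - z)) \<partial>distr lborel borel ((+) z))"
    unfolding lborel_distr_plus nn_integral_completion ..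
  also have "\<dots> = (\<integral>\<^sup>+y. ennreal (heat_kernel s ((x - z) - y) * heat_kernel t y) \<partial>lborel)"
    by (subst nn_integral_distr) (simp_all add: diff_diff_eq)
  finally show ?thesis
    by (simp add: 2)
qed

section \<open>Decay and Lipschitz bounds for the heat kernel\<close>

lemma power_le_exp:
  fixes v :: real
  assumes "0 \<le> v"
  shows "v ^ m \<le> real m ^ m * exp v"
proof (cases "m = 0")
  case False
  \<comment> \<open>The inequality \<open>w \<le> exp w\<close> at \<open>w = v / m\<close>, raised
    to the power \<open>m\<close>, is the source of the constant \<open>m ^ m\<close>.\<close>
  have "(v / m) ^ m \<le> exp (v / m) ^ m"
    using assms exp_ge_add_one_self[of "v / m"] by (intro power_mono order.trans[OF _ exp_ge_add_one_self]) auto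
  also have "\<dots> = exp v"
    using False by (simp flip: exp_of_nat_mult)
  finally show ?thesis
    using False by (simp add: power_divide field_simps)
qed (use assms in simp)

lemma gaussian_decay: "\<exists>C>0. \<forall>u\<ge>0. exp (- (u::real)\<^sup>2 / 4) \<le> C / (1 + u) ^ m" for m :: nat
\<comment> \<open>The factor \<open>m ^ m\<close> comes from \<open>power_le_exp\<close> at
  \<open>1 + u\<close>, and \<open>exp 2\<close> bounds \<open>exp (1 + u - u^2 / 4)\<close>, whose
  exponent is largest at \<open>u = 2\<close>.\<close>
proof (intro exI[of _ "real m ^ m * exp 2"] conjI allI impI)
  show "0 < real m ^ m * exp 2"
    by (cases "m = 0") auto
  fix u :: real assume "0 \<le> u"
  have "(1 + u) ^ m * exp (- u\<^sup>2 / 4) \<le> real m ^ m * exp (1 + u) * exp (- u\<^sup>2 / 4)"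
    using \<open>0 \<le> u\<close> by (intro mult_right_mono power_le_exp) auto
  also have "\<dots> = real m ^ m * exp (1 + u + - u\<^sup>2 / 4)"
    by (simp only: exp_add mult.assoc)
  also have "\<dots> \<le> real m ^ m * exp 2"
  proof -
    have "0 \<le> (u / 2 - 1)\<^sup>2" by simp
    then have "1 + u + - u\<^sup>2 / 4 \<le> 2"
      by (simp add: power2_eq_square algebra_simps)
    then show ?thesis by (intro mult_left_mono) auto
  qed
  finally show "exp (- u\<^sup>2 / 4) \<le> real m ^ m * exp 2 / (1 + u) ^ m"
    using \<open>0 \<le> u\<close> by (simp add: field_simps)
qed

text \<open>By the mean value theorem the difference is governed by
  \<open>\<xi> * exp (- \<xi>^2 / 4)\<close> at an intermediate point \<xi>. One extra power of
  decay absorbs the factor \<xi>, and what remains is largest at the smaller endpoint. Adding the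
  weights of both endpoints makes the bound symmetric.\<close>

lemma gaussian_lipschitz:
  "\<exists>C>0. \<forall>u\<ge>0. \<forall>v\<ge>0. \<bar>exp (- (u::real)\<^sup>2 / 4) - exp (- v\<^sup>2 / 4)\<bar> \<le> C * \<bar>u - v\<bar> * (1 / (1 + u) ^ m + 1 / (1 + v) ^ m)"
  for m :: nat
proof -
  obtain C where "C > 0" and C: "\<And>u::real. 0 \<le> u \<Longrightarrow> exp (- u\<^sup>2 / 4) \<le> C / (1 + u) ^ Suc m"
    using gaussian_decay[of "Suc m"] by auto
  have aux: "\<bar>exp (- u\<^sup>2 / 4) - exp (- v\<^sup>2 / 4)\<bar> \<le> C * \<bar>u - v\<bar> * (1 / (1 + u) ^ m)"
    if "0 \<le> u" "u < v" for u v :: real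
  proof -
    have "\<exists>\<xi>>u. \<xi> < v \<and> exp (- v\<^sup>2 / 4) - exp (- u\<^sup>2 / 4) = (v - u) * (exp (- \<xi>\<^sup>2 / 4) * (- \<xi> / 2))"
      using \<open>u < v\<close> by (intro MVT2) (auto intro!: derivative_eq_intros)
    then obtain \<xi> where \<xi>: "u < \<xi>" "\<xi> < v"
      and eq: "exp (- v\<^sup>2 / 4) - exp (- u\<^sup>2 / 4) = (v - u) * (exp (- \<xi>\<^sup>2 / 4) * (- \<xi> / 2))"
      by auto
    have "exp (- \<xi>\<^sup>2 / 4) * (\<xi> / 2) \<le> C / (1 + \<xi>) ^ Suc m * (1 + \<xi>)"
      using C[of \<xi>] \<xi> \<open>0 \<le> u\<close> \<open>0 < C\<close> by (intro mult_mono) auto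
    also have "\<dots> = C / (1 + \<xi>) ^ m"
      using \<xi> \<open>0 \<le> u\<close> nonzero_mult_divide_mult_cancel_right[of "1 + \<xi>" C "(1 + \<xi>) ^ m"]
      by (simp add: mult.commute)
    also have "\<dots> \<le> C / (1 + u) ^ m"
      using \<xi> \<open>0 \<le> u\<close> \<open>0 < C\<close> by (intro divide_left_mono power_mono mult_pos_pos zero_less_power) auto
    finally have "\<bar>exp (- \<xi>\<^sup>2 / 4) * (- \<xi> / 2)\<bar> \<le> C / (1 + u) ^ m"
      using \<xi> \<open>0 \<le> u\<close> by (simp add: abs_mult)
    then have "\<bar>v - u\<bar> * \<bar>exp (- \<xi>\<^sup>2 / 4) * (- \<xi> / 2)\<bar> \<le> \<bar>v - u\<bar> * (C / (1 + u) ^ m)"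
      by (intro mult_left_mono) auto
    then show ?thesis
      by (subst abs_minus_commute, subst eq) (simp add: abs_mult mult_ac abs_minus_commute)
  qed
  show ?thesis
  proof (intro exI[of _ C] conjI allI impI \<open>0 < C\<close>)
    fix u v :: real assume uv: "0 \<le> u" "0 \<le> v"
    have mono: "C * \<bar>u - v\<bar> * (1 / (1 + w) ^ m) \<le> C * \<bar>u - v\<bar> * (1 / (1 + u) ^ m + 1 / (1 + v) ^ m)"
      if "w = u \<or> w = v" for w
      using that uv \<open>0 < C\<close> by (intro mult_left_mono) auto
    show "\<bar>exp (- u\<^sup>2 / 4) - exp (- v\<^sup>2 / 4)\<bar> \<le> C * \<bar>u - v\<bar> * (1 / (1 + u) ^ m + 1 / (1 + v) ^ m)"
      using aux[of u v] aux[of v u] mono[of u] mono[of v] uv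
      by (cases u v rule: linorder_cases) (auto simp: abs_minus_commute)
  qed
qed

lemma heat_kernel_eq_gaussian:
  fixes x :: "real^'n"
  assumes "0 < t"
  shows "heat_kernel t x = exp (- (norm x / sqrt t)\<^sup>2 / 4) / (sqrt (4 * pi) * sqrt t) ^ CARD('n)"
  using assms by (simp add: heat_kernel_def powr_half_nat power_divide real_sqrt_mult)

lemma gaussian_normalization_ge:
  assumes "0 < t"
  shows "sqrt t ^ n \<le> (sqrt (4 * pi) * sqrt t) ^ n"
proof -
  have "1 \<le> sqrt (4 * pi)"
    using pi_gt3 by simp
  then show ?thesis
    using assms by (intro power_mono) (auto simp: mult_le_cancel_right1)
qed

lemma heat_kernel_decay:
  "\<exists>C>0. \<forall>t>0. \<forall>x :: real^'n. heat_kernel t x \<le> C / sqrt t ^ CARD('n) * (1 / (1 + norm x / sqrt t) ^ m)"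
proof -
  obtain C where "C > 0" and C: "\<And>u::real. 0 \<le> u \<Longrightarrow> exp (- u\<^sup>2 / 4) \<le> C / (1 + u) ^ m"
    using gaussian_decay[of m] by auto
  have "heat_kernel t x \<le> C / sqrt t ^ CARD('n) * (1 / (1 + norm x / sqrt t) ^ m)"
    if "0 < t" for t and x :: "real^'n"
  proof -
    have "heat_kernel t x \<le> (C / (1 + norm x / sqrt t) ^ m) / sqrt t ^ CARD('n)"
      unfolding heat_kernel_eq_gaussian[OF that]
      using that \<open>0 < C\<close> by (intro frac_le C gaussian_normalization_ge) auto
    then show ?thesis by (simp add: mult.commute)
  qed
  with \<open>0 < C\<close> show ?thesis by blast
qed

text \<open>After rescaling by \<open>sqrt t\<close> the two radii differ by at most
  \<open>norm (x - y) / sqrt t\<close>. This power of \<open>sqrt t\<close>, on top of the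
  normalisation \<open>sqrt t ^ n\<close>, is the origin of the exponent n + 1.\<close>

lemma heat_kernel_lipschitz:
  "\<exists>C>0. \<forall>t>0. \<forall>x y :: real^'n. \<bar>heat_kernel t x - heat_kernel t y\<bar> \<le>
     C * norm (x - y) / sqrt t ^ (CARD('n) + 1) *
       (1 / (1 + norm x / sqrt t) ^ m + 1 / (1 + norm y / sqrt t) ^ m)"
proof -
  obtain C where "C > 0" and C: "\<And>u v::real. 0 \<le> u \<Longrightarrow> 0 \<le> v \<Longrightarrow>
      \<bar>exp (- u\<^sup>2 / 4) - exp (- v\<^sup>2 / 4)\<bar> \<le> C * \<bar>u - v\<bar> * (1 / (1 + u) ^ m + 1 / (1 + v) ^ m)"
    using gaussian_lipschitz[of m] by auto
  have "\<bar>heat_kernel t x - heat_kernel t y\<bar> \<le>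
     C * norm (x - y) / sqrt t ^ (CARD('n) + 1) *
       (1 / (1 + norm x / sqrt t) ^ m + 1 / (1 + norm y / sqrt t) ^ m)"
    if "0 < t" for t and x y :: "real^'n"
  proof -
    let ?u = "norm x / sqrt t" and ?v = "norm y / sqrt t"
    have "\<bar>heat_kernel t x - heat_kernel t y\<bar>
        = \<bar>exp (- ?u\<^sup>2 / 4) - exp (- ?v\<^sup>2 / 4)\<bar> / (sqrt (4 * pi) * sqrt t) ^ CARD('n)"
      unfolding heat_kernel_eq_gaussian[OF that] using that
      by (simp flip: diff_divide_distrib add: abs_divide abs_mult)
    also have "\<dots> \<le> (C * \<bar>?u - ?v\<bar> * (1 / (1 + ?u) ^ m + 1 / (1 + ?v) ^ m)) / sqrt t ^ CARD('n)"
      using that \<open>0 < C\<close> by (intro frac_le C gaussian_normalization_ge) auto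
    also have "\<dots> \<le> (C * (norm (x - y) / sqrt t) * (1 / (1 + ?u) ^ m + 1 / (1 + ?v) ^ m)) / sqrt t ^ CARD('n)"
    proof -
      have "\<bar>?u - ?v\<bar> \<le> norm (x - y) / sqrt t"
        using norm_triangle_ineq3[of x y] that
        by (simp flip: diff_divide_distrib add: divide_right_mono)
      then show ?thesis
        using \<open>0 < C\<close> that by (intro divide_right_mono mult_right_mono mult_left_mono) auto
    qed
    finally show ?thesis by (simp add: mult_ac)
  qed
  with \<open>0 < C\<close> show ?thesis by blast
qed

text \<open>Completing the square in \<open>(norm z - 2 * k * t)^2\<close> trades the Gaussian for
  exponential decay of any rate \<open>k\<close>. Polynomial decay would be too weak against
  functions that are merely \<open>exp_integrable\<close>.\<close>

lemma heat_kernel_exp_decay: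
  fixes z :: "real^'n"
  assumes "0 < t"
  shows "heat_kernel t z \<le> exp (k\<^sup>2 * t) / (4 * pi * t) powr (real CARD('n) / 2) * exp (- k * norm z)"
proof -
  have "0 \<le> (norm z - 2 * k * t)\<^sup>2 / (4 * t)"
    using assms by simp
  also have "\<dots> = (norm z)\<^sup>2 / (4 * t) - k * norm z + k\<^sup>2 * t"
    using assms by (simp add: power2_eq_square field_simps)
  finally have "exp (- (norm z)\<^sup>2 / (4 * t)) \<le> exp (k\<^sup>2 * t + - k * norm z)"
    by simp
  then show ?thesis
    unfolding heat_kernel_def times_divide_eq_left exp_add[symmetric]
    by (rule divide_right_mono) simp
qed

section \<open>Exponential integrability and the heat semigroup\<close>

text \<open>This gives access to Tonelli and Fubini for the completed measure, in which all the
  notions are phrased.\<close>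

lemma sigma_finite_lebesgue: "sigma_finite_measure (lebesgue :: 'a::euclidean_space measure)"
proof
  obtain A :: "'a set set" where A: "countable A" "A \<subseteq> sets lborel" "\<Union>A = space lborel"
      "\<And>a. a \<in> A \<Longrightarrow> emeasure lborel a \<noteq> \<infinity>"
    using lborel.sigma_finite_countable by metis
  then show "\<exists>A::'a set set. countable A \<and> A \<subseteq> sets lebesgue \<and> \<Union>A = space lebesgue \<and> (\<forall>a\<in>A. emeasure lebesgue a \<noteq> \<infinity>)"
    by (intro exI[of _ A]) auto
qed

interpretation lebesgue: sigma_finite_measure "lebesgue :: 'a::euclidean_space measure"
  by (rule sigma_finite_lebesgue)

interpretation lebesgue_pair: pair_sigma_finite
  "lebesgue :: 'a::euclidean_space measure" "lebesgue :: 'b::euclidean_space measure" ..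

text \<open>This rule and the next two let Borel functions of one or two variables count as
  measurable for the completed measure and its products.\<close>

lemma id_lebesgue_measurable [measurable]: "(\<lambda>x. x) \<in> lebesgue \<rightarrow>\<^sub>M borel"
  by (rule measurable_completion) simp

lemma fst_lebesgue_measurable [measurable]: "fst \<in> lebesgue \<Otimes>\<^sub>M M \<rightarrow>\<^sub>M borel"
  using measurable_compose[OF measurable_fst id_lebesgue_measurable] by simp

lemma snd_lebesgue_measurable [measurable]: "snd \<in> M \<Otimes>\<^sub>M lebesgue \<rightarrow>\<^sub>M borel"
  using measurable_compose[OF measurable_snd id_lebesgue_measurable] by simp

lemma emeasure_lebesgue_ball:
  fixes x :: "real^'n"
  assumes "0 \<le> r"
  shows "emeasure lebesgue (ball x r) = ennreal (unit_ball_vol CARD('n) * r ^ CARD('n))"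
  using emeasure_ball[OF assms, of x] by simp

section \<open>Polynomial growth of integrals over concentric balls\<close>

definition ball_growth :: "nat \<Rightarrow> real \<Rightarrow> (real^'n \<Rightarrow> complex) \<Rightarrow> real^'n \<Rightarrow> real \<Rightarrow> bool" where
  "ball_growth m A F x r \<longleftrightarrow> F \<in> borel_measurable lebesgue \<and>
     (\<forall>R\<ge>r. (\<integral>\<^sup>+y\<in>ball x R. ennreal (norm (F y)) \<partial>lebesgue) \<le> ennreal (A * (R / r) ^ m))"

text \<open>Cut space into shells on which \<open>norm (x - y) / r\<close> lies between
  \<open>k\<close> and \<open>k + 1\<close>. There the weight is at most
  \<open>1 / (k + 1) ^ (m + 2)\<close>, while the surrounding ball carries mass at most
  \<open>A * (k + 1) ^ m\<close>. The two additional powers leave the series of inverse squares,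
  hence the constant. Since growth is measured relative to \<open>r\<close>, no other dependence on
  \<open>r\<close> remains.\<close>

lemma ball_growth_weighted_integral:
  assumes "0 < r" "0 \<le> A" and growth: "ball_growth m A F x r"
  shows "(\<integral>\<^sup>+y. ennreal (norm (F y) * (1 / (1 + norm (x - y) / r) ^ (m + 2))) \<partial>lebesgue)
           \<le> ennreal (pi\<^sup>2 / 6 * A)"
proof -
  have [measurable]: "F \<in> borel_measurable lebesgue"
    using growth by (simp add: ball_growth_def)
  have [measurable]: "ball x R \<in> sets lebesgue" for R by simp
  let ?g = "\<lambda>k y. ennreal (norm (F y)) * indicator (ball x ((real k + 1) * r)) y * ennreal (1 / (real k + 1) ^ (m + 2))"
  have pointwise: "ennreal (norm (F y) * (1 / (1 + norm (x - y) / r) ^ (m + 2))) \<le> (\<Sum>k. ?g k y)" for y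
  proof -
    define u where "u = norm (x - y) / r"
    define k where "k = nat \<lfloor>u\<rfloor>"
    have "0 \<le> u" using \<open>0 < r\<close> by (simp add: u_def)
    then have k: "real k \<le> u" "u < real k + 1"
      unfolding k_def by linarith+
    then have "norm (x - y) < (real k + 1) * r"
      using \<open>0 < r\<close> by (simp add: u_def pos_divide_less_eq)
    then have "y \<in> ball x ((real k + 1) * r)"
      by (simp add: dist_norm)
    moreover have "norm (F y) * (1 / (1 + u) ^ (m + 2)) \<le> norm (F y) * (1 / (real k + 1) ^ (m + 2))"
      using k \<open>0 \<le> u\<close> by (intro mult_left_mono divide_left_mono power_mono mult_pos_pos zero_less_power) auto
    ultimately have "ennreal (norm (F y) * (1 / (1 + u) ^ (m + 2))) \<le> ?g k y"
      by (simp add: ennreal_mult'[symmetric] ennreal_leI del: power_Suc power_add_numeral2 power_add_numeral)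
    also have "\<dots> \<le> (\<Sum>k. ?g k y)"
      using sum_le_suminf[OF summableI, of "{k}" "\<lambda>k. ?g k y"] by simp
    finally show ?thesis by (simp add: u_def)
  qed
  have "(\<integral>\<^sup>+y. ennreal (norm (F y) * (1 / (1 + norm (x - y) / r) ^ (m + 2))) \<partial>lebesgue)
      \<le> (\<integral>\<^sup>+y. (\<Sum>k. ?g k y) \<partial>lebesgue)"
    by (intro nn_integral_mono pointwise)
  also have "\<dots> = (\<Sum>k. \<integral>\<^sup>+y. ?g k y \<partial>lebesgue)"
    by (rule nn_integral_suminf) measurable
  also have "\<dots> \<le> (\<Sum>k. ennreal (A * (1 / (real k + 1)\<^sup>2)))"
  proof (intro suminf_le summableI)
    fix k
    have "(\<integral>\<^sup>+y. ?g k y \<partial>lebesgue)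
        = (\<integral>\<^sup>+y\<in>ball x ((real k + 1) * r). ennreal (norm (F y)) \<partial>lebesgue) * ennreal (1 / (real k + 1) ^ (m + 2))"
      by (rule nn_integral_multc) measurable
    also have "\<dots> \<le> ennreal (A * (((real k + 1) * r) / r) ^ m) * ennreal (1 / (real k + 1) ^ (m + 2))"
    proof -
      have "r \<le> (real k + 1) * r"
        using \<open>0 < r\<close> by (simp add: distrib_right)
      then have "(\<integral>\<^sup>+y\<in>ball x ((real k + 1) * r). ennreal (norm (F y)) \<partial>lebesgue) \<le> ennreal (A * (((real k + 1) * r) / r) ^ m)"
        using growth unfolding ball_growth_def by (elim conjE allE impE)
      then show ?thesis
        by (rule mult_right_mono) simp
    qed
    also have "\<dots> = ennreal (A * (1 / (real k + 1)\<^sup>2))"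
      using \<open>0 < r\<close> \<open>0 \<le> A\<close> by (simp add: ennreal_mult'[symmetric] power_add power2_eq_square)
    finally show "(\<integral>\<^sup>+y. ?g k y \<partial>lebesgue) \<le> ennreal (A * (1 / (real k + 1)\<^sup>2))" .
  qed
  also have "\<dots> = ennreal (pi\<^sup>2 / 6 * A)"
  proof -
    have *: "(\<lambda>k. A * (1 / (real k + 1)\<^sup>2)) sums (A * (pi\<^sup>2 / 6))"
      using inverse_squares_sums by (intro sums_mult) (simp add: add_ac)
    then have "(\<Sum>k. ennreal (A * (1 / (real k + 1)\<^sup>2))) = ennreal (\<Sum>k. A * (1 / (real k + 1)\<^sup>2))"
      using \<open>0 \<le> A\<close> by (intro suminf_ennreal2 sums_summable) auto
    then show ?thesis
      using sums_unique[OF *] by (simp only: mult.commute)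
  qed
  finally show ?thesis .
qed

lemma exp_decay: "\<exists>C>0. \<forall>u\<ge>0. exp (- u) \<le> C * (1 / (1 + (u::real)) ^ m)"
proof (intro exI[of _ "real m ^ m * exp 1"] conjI allI impI)
  show "0 < real m ^ m * exp 1"
    by (cases "m = 0") auto
  fix u :: real assume "0 \<le> u"
  have "(1 + u) ^ m * exp (- u) \<le> real m ^ m * exp (1 + u) * exp (- u)"
    using \<open>0 \<le> u\<close> by (intro mult_right_mono power_le_exp) auto
  also have "\<dots> = real m ^ m * exp 1"
    by (simp add: exp_add exp_minus)
  finally show "exp (- u) \<le> real m ^ m * exp 1 * (1 / (1 + u) ^ m)"
    using \<open>0 \<le> u\<close> by (simp add: field_simps)
qed

text \<open>The weight \<open>exp (- norm x)\<close> decays faster than the polynomial weight of the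
  shell estimate about the origin.\<close>

lemma exp_integrable_if_growth:
  assumes "ball_growth m A F 0 1" "0 \<le> A"
  shows "exp_integrable F"
proof -
  obtain C where C: "0 < C" "\<And>u. 0 \<le> u \<Longrightarrow> exp (- u) \<le> C * (1 / (1 + (u::real)) ^ (m + 2))"
    using exp_decay[of "m + 2"] by auto
  have [measurable]: "F \<in> borel_measurable lebesgue"
    using assms by (simp add: ball_growth_def)
  have "(\<integral>\<^sup>+x. ennreal (norm (F x) * exp (- norm x)) \<partial>lebesgue)
      \<le> (\<integral>\<^sup>+x. ennreal C * ennreal (norm (F x) * (1 / (1 + norm (0 - x) / 1) ^ (m + 2))) \<partial>lebesgue)"
  proof (intro nn_integral_mono)
    fix x
    have "norm (F x) * exp (- norm x) \<le> norm (F x) * (C * (1 / (1 + norm x) ^ (m + 2)))"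
      by (intro mult_left_mono C) auto
    then show "ennreal (norm (F x) * exp (- norm x)) \<le> ennreal C * ennreal (norm (F x) * (1 / (1 + norm (0 - x) / 1) ^ (m + 2)))"
      using C(1) by (subst ennreal_mult'[symmetric]) (auto intro!: ennreal_leI simp: mult_ac)
  qed
  also have "\<dots> = ennreal C * (\<integral>\<^sup>+x. ennreal (norm (F x) * (1 / (1 + norm (0 - x) / 1) ^ (m + 2))) \<partial>lebesgue)"
    by (rule nn_integral_cmult) measurable
  also have "\<dots> \<le> ennreal C * ennreal (pi\<^sup>2 / 6 * A)"
    using assms by (intro mult_left_mono ball_growth_weighted_integral) auto
  also have "\<dots> < top"
    by (simp add: ennreal_mult_less_top)
  finally show ?thesis
    by (simp add: exp_integrable_def)
qed

lemma ball_growth_const: "0 < r \<Longrightarrow> ball_growth CARD('n) (norm c * unit_ball_vol CARD('n) * r ^ CARD('n)) (\<lambda>_. c) (x :: real^'n) r"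
  by (auto simp: ball_growth_def nn_integral_cmult_indicator emeasure_ball ennreal_mult'[symmetric] power_divide)

lemma exp_integrable_const: "exp_integrable (\<lambda>_ :: real^'n. c)"
  by (rule exp_integrable_if_growth[OF ball_growth_const]) auto

text \<open>The constant function 1 has the same growth about every centre, so one \<open>D\<close>
  serves all \<open>x\<close>. This uniformity is used to integrate out a variable in
  \<open>exp_integrable_heat\<close>.\<close>

lemma nn_integral_exp_dist: "\<exists>D. \<forall>x :: real^'n. (\<integral>\<^sup>+y. ennreal (exp (- norm (x - y))) \<partial>lebesgue) \<le> ennreal D"
proof -
  obtain C where C: "0 < C" "\<And>u. 0 \<le> u \<Longrightarrow> exp (- u) \<le> C * (1 / (1 + (u::real)) ^ (CARD('n) + 2))"
    using exp_decay[of "CARD('n) + 2"] by auto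
  have "(\<integral>\<^sup>+y. ennreal (exp (- norm (x - y))) \<partial>lebesgue)
     \<le> ennreal (C * (pi\<^sup>2 / 6 * unit_ball_vol CARD('n)))" for x :: "real^'n"
  proof -
    have "(\<integral>\<^sup>+y. ennreal (exp (- norm (x - y))) \<partial>lebesgue)
        \<le> (\<integral>\<^sup>+y. ennreal C * ennreal (norm (1::complex) * (1 / (1 + norm (x - y) / 1) ^ (CARD('n) + 2))) \<partial>lebesgue)"
      using C by (intro nn_integral_mono) (auto simp: ennreal_mult'[symmetric] intro!: ennreal_leI)
    also have "\<dots> = ennreal C * (\<integral>\<^sup>+y. ennreal (norm (1::complex) * (1 / (1 + norm (x - y) / 1) ^ (CARD('n) + 2))) \<partial>lebesgue)"
      by (rule nn_integral_cmult) measurable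
    also have "\<dots> \<le> ennreal C * ennreal (pi\<^sup>2 / 6 * unit_ball_vol CARD('n))"
      using ball_growth_const[of 1 "1::complex" x]
      by (intro mult_left_mono ball_growth_weighted_integral) auto
    finally show ?thesis
      using C(1) by (simp add: ennreal_mult'[symmetric])
  qed
  then show ?thesis by blast
qed

section \<open>Heat extensions of exponentially integrable functions\<close>

lemma heat_kernel_pair_measurable:
  fixes f :: "real^'n \<Rightarrow> complex"
  assumes [measurable]: "f \<in> borel_measurable lebesgue"
  shows "(\<lambda>(x, y). heat_kernel t (x - y) *\<^sub>R f y) \<in> borel_measurable (lebesgue \<Otimes>\<^sub>M lebesgue)"
  by measurable

lemma heat_measurable:
  assumes "f \<in> borel_measurable lebesgue"
  shows "heat t f \<in> borel_measurable lebesgue"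
  unfolding heat_eq[abs_def]
  by (rule lebesgue.borel_measurable_lebesgue_integral[OF heat_kernel_pair_measurable[OF assms]])

lemma integrable_heat:
  fixes f :: "real^'n \<Rightarrow> complex"
  assumes "exp_integrable f" "0 < t"
  shows "integrable lebesgue (\<lambda>y. heat_kernel t (x - y) *\<^sub>R f y)"
proof (rule integrableI_bounded)
  have [measurable]: "f \<in> borel_measurable lebesgue"
    using assms by (simp add: exp_integrable_def)
  show "(\<lambda>y. heat_kernel t (x - y) *\<^sub>R f y) \<in> borel_measurable lebesgue"
    by measurable
  \<comment> \<open>As \<open>x\<close> is fixed, \<open>exp (norm x)\<close> may enter the
    constant: \<open>exp (- norm (x - y))\<close> is at most
    \<open>exp (norm x) * exp (- norm y)\<close>, so decay of rate 1 is enough.\<close>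
  define c where "c = exp t / (4 * pi * t) powr (real CARD('n) / 2) * exp (norm x)"
  have "0 \<le> c" by (simp add: c_def)
  have "(\<integral>\<^sup>+y. ennreal (norm (heat_kernel t (x - y) *\<^sub>R f y)) \<partial>lebesgue)
      \<le> (\<integral>\<^sup>+y. ennreal c * ennreal (norm (f y) * exp (- norm y)) \<partial>lebesgue)"
  proof (intro nn_integral_mono)
    fix y
    have "heat_kernel t (x - y) \<le> exp t / (4 * pi * t) powr (real CARD('n) / 2) * exp (- norm (x - y))"
      using heat_kernel_exp_decay[OF \<open>0 < t\<close>, of "x - y" 1] by simp
    also have "\<dots> \<le> exp t / (4 * pi * t) powr (real CARD('n) / 2) * exp (norm x - norm y)"
      using norm_triangle_ineq2[of y x] by (intro mult_left_mono) (auto simp: norm_minus_commute)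
    also have "\<dots> = c * exp (- norm y)"
      by (simp add: c_def exp_diff exp_minus field_simps)
    finally have "heat_kernel t (x - y) * norm (f y) \<le> c * exp (- norm y) * norm (f y)"
      by (rule mult_right_mono) simp
    then show "ennreal (norm (heat_kernel t (x - y) *\<^sub>R f y)) \<le> ennreal c * ennreal (norm (f y) * exp (- norm y))"
      using \<open>0 \<le> c\<close> by (subst ennreal_mult'[symmetric]) (auto intro!: ennreal_leI simp: mult_ac)
  qed
  also have "\<dots> = ennreal c * (\<integral>\<^sup>+y. ennreal (norm (f y) * exp (- norm y)) \<partial>lebesgue)"
    by (rule nn_integral_cmult) measurable
  also have "\<dots> < \<infinity>"
    using assms by (simp add: ennreal_mult_less_top exp_integrable_def)
  finally show "(\<integral>\<^sup>+y. ennreal (norm (heat_kernel t (x - y) *\<^sub>R f y)) \<partial>lebesgue) < \<infinity>" .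
qed

lemma integral_heat_kernel:
  fixes x :: "real^'n"
  assumes "0 < t"
  shows "integrable lebesgue (\<lambda>y. heat_kernel t (x - y))" "(LINT y|lebesgue. heat_kernel t (x - y)) = 1"
proof -
  have "(\<integral>\<^sup>+y. ennreal (heat_kernel t (x - y)) \<partial>lebesgue)
      = (\<integral>\<^sup>+y. ennreal (heat_kernel t (y - x)) \<partial>distr lborel borel ((+) x))"
    unfolding lborel_distr_plus nn_integral_completion using heat_kernel_minus[of t "x - y" for y] by simp
  also have "\<dots> = (\<integral>\<^sup>+y. ennreal (heat_kernel t (y :: real^'n)) \<partial>lborel)"
    by (subst nn_integral_distr) simp_all
  finally have *: "(\<integral>\<^sup>+y. ennreal (heat_kernel t (x - y)) \<partial>lebesgue) = 1"
    using nn_integral_heat_kernel[OF assms] by simp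
  then show "integrable lebesgue (\<lambda>y. heat_kernel t (x - y))"
    by (intro integrableI_nonneg) auto
  show "(LINT y|lebesgue. heat_kernel t (x - y)) = 1"
    by (subst integral_eq_nn_integral) (auto simp: *)
qed

lemma heat_const: "0 < t \<Longrightarrow> heat t (\<lambda>_. c) x = c"
  unfolding heat_eq by (simp add: integral_heat_kernel)

lemma exp_integrable_add:
  assumes "exp_integrable f" "exp_integrable g"
  shows "exp_integrable (\<lambda>x. f x + g x)"
proof -
  have [measurable]: "f \<in> borel_measurable lebesgue" "g \<in> borel_measurable lebesgue"
    using assms by (auto simp: exp_integrable_def)
  have "(\<integral>\<^sup>+x. ennreal (norm (f x + g x) * exp (- norm x)) \<partial>lebesgue)
     \<le> (\<integral>\<^sup>+x. ennreal (norm (f x) * exp (- norm x)) + ennreal (norm (g x) * exp (- norm x)) \<partial>lebesgue)"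
    by (intro nn_integral_mono)
       (simp flip: ennreal_plus distrib_right add: ennreal_leI mult_right_mono norm_triangle_ineq)
  also have "\<dots> = (\<integral>\<^sup>+x. ennreal (norm (f x) * exp (- norm x)) \<partial>lebesgue) + (\<integral>\<^sup>+x. ennreal (norm (g x) * exp (- norm x)) \<partial>lebesgue)"
    by (rule nn_integral_add) measurable
  also have "\<dots> < top"
    using assms by (simp add: exp_integrable_def)
  finally show ?thesis
    by (simp add: exp_integrable_def)
qed

lemma exp_integrable_minus: "exp_integrable f \<Longrightarrow> exp_integrable (\<lambda>x. - f x)"
  by (simp add: exp_integrable_def)

lemma exp_integrable_diff:
  assumes "exp_integrable f" "exp_integrable g"
  shows "exp_integrable (\<lambda>x. f x - g x)"
  using exp_integrable_add[OF assms(1) exp_integrable_minus[OF assms(2)]] by simp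

lemma heat_diff:
  assumes "exp_integrable f" "exp_integrable g" "0 < t"
  shows "heat t (\<lambda>x. f x - g x) x = heat t f x - heat t g x"
  unfolding heat_eq scaleR_diff_right using assms by (intro Bochner_Integration.integral_diff integrable_heat)

text \<open>Tonelli's theorem with kernel decay of rate 2: one factor
  \<open>exp (- norm (x - y))\<close> converts the weight at \<open>x\<close> into the weight at
  \<open>y\<close>, and the other is integrated over \<open>x\<close>.\<close>

lemma exp_integrable_heat:
  fixes f :: "real^'n \<Rightarrow> complex"
  assumes f: "exp_integrable f" and "0 < t"
  shows "exp_integrable (heat t f)"
proof -
  have [measurable]: "f \<in> borel_measurable lebesgue"
    using assms by (simp add: exp_integrable_def)
  note [measurable] = heat_measurable[OF this]
  obtain D where D: "\<And>y :: real^'n. (\<integral>\<^sup>+x. ennreal (exp (- norm (y - x))) \<partial>lebesgue) \<le> ennreal D"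
    using nn_integral_exp_dist by blast
  define c where "c = exp (4 * t) / (4 * pi * t) powr (real CARD('n) / 2)"
  have "0 \<le> c" by (simp add: c_def)
  have "(\<integral>\<^sup>+x. ennreal (norm (heat t f x) * exp (- norm x)) \<partial>lebesgue)
     \<le> (\<integral>\<^sup>+x. (\<integral>\<^sup>+y. ennreal (norm (f y) * exp (- norm y)) * ennreal (c * exp (- norm (y - x))) \<partial>lebesgue) \<partial>lebesgue)"
  proof (intro nn_integral_mono)
    fix x
    have "ennreal (norm (heat t f x)) \<le> (\<integral>\<^sup>+y. ennreal (norm (heat_kernel t (x - y) *\<^sub>R f y)) \<partial>lebesgue)"
      unfolding heat_eq by (intro integral_norm_bound_ennreal integrable_heat assms)
    then have "ennreal (norm (heat t f x) * exp (- norm x))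
      \<le> (\<integral>\<^sup>+y. ennreal (norm (heat_kernel t (x - y) *\<^sub>R f y)) \<partial>lebesgue) * ennreal (exp (- norm x))"
      by (subst ennreal_mult) (auto intro!: mult_right_mono)
    also have "\<dots> = (\<integral>\<^sup>+y. ennreal (norm (heat_kernel t (x - y) *\<^sub>R f y)) * ennreal (exp (- norm x)) \<partial>lebesgue)"
      by (rule nn_integral_multc[symmetric]) measurable
    also have "\<dots> \<le> (\<integral>\<^sup>+y. ennreal (norm (f y) * exp (- norm y)) * ennreal (c * exp (- norm (y - x))) \<partial>lebesgue)"
    proof (intro nn_integral_mono)
      fix y
      have "heat_kernel t (x - y) \<le> c * exp (- 2 * norm (x - y))"
        using heat_kernel_exp_decay[OF \<open>0 < t\<close>, of "x - y" 2] by (simp add: c_def)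
      then have "heat_kernel t (x - y) * exp (- norm x) \<le> c * exp (- 2 * norm (x - y)) * exp (- norm x)"
        by (intro mult_right_mono) auto
      also have "\<dots> = c * exp (- 2 * norm (x - y) - norm x)"
        by (simp add: exp_diff exp_minus field_simps)
      also have "\<dots> \<le> c * exp (- norm y - norm (y - x))"
        using norm_triangle_ineq2[of y x] \<open>0 \<le> c\<close> by (intro mult_left_mono) (auto simp: norm_minus_commute)
      also have "\<dots> = exp (- norm y) * (c * exp (- norm (y - x)))"
        by (simp add: exp_diff exp_minus field_simps)
      finally have "norm (f y) * (heat_kernel t (x - y) * exp (- norm x)) \<le> norm (f y) * (exp (- norm y) * (c * exp (- norm (y - x))))"
        by (intro mult_left_mono) auto
      then show "ennreal (norm (heat_kernel t (x - y) *\<^sub>R f y)) * ennreal (exp (- norm x))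
        \<le> ennreal (norm (f y) * exp (- norm y)) * ennreal (c * exp (- norm (y - x)))"
        using \<open>0 \<le> c\<close> by (simp add: ennreal_mult'[symmetric] mult_ac ennreal_leI)
    qed
    finally show "ennreal (norm (heat t f x) * exp (- norm x))
      \<le> (\<integral>\<^sup>+y. ennreal (norm (f y) * exp (- norm y)) * ennreal (c * exp (- norm (y - x))) \<partial>lebesgue)" .
  qed
  also have "\<dots> = (\<integral>\<^sup>+y. (\<integral>\<^sup>+x. ennreal (norm (f y) * exp (- norm y)) * ennreal (c * exp (- norm (y - x))) \<partial>lebesgue) \<partial>lebesgue)"
    by (rule lebesgue_pair.Fubini') measurable
  also have "\<dots> \<le> (\<integral>\<^sup>+y. ennreal (norm (f y) * exp (- norm y)) * ennreal (c * D) \<partial>lebesgue)"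
  proof (intro nn_integral_mono)
    fix y
    have "(\<integral>\<^sup>+x. ennreal (norm (f y) * exp (- norm y)) * ennreal (c * exp (- norm (y - x))) \<partial>lebesgue)
      = ennreal (norm (f y) * exp (- norm y)) * (ennreal c * (\<integral>\<^sup>+x. ennreal (exp (- norm (y - x))) \<partial>lebesgue))"
      using \<open>0 \<le> c\<close> by (simp add: nn_integral_cmult ennreal_mult')
    also have "\<dots> \<le> ennreal (norm (f y) * exp (- norm y)) * (ennreal c * ennreal D)"
      by (intro mult_left_mono D) auto
    finally show "(\<integral>\<^sup>+x. ennreal (norm (f y) * exp (- norm y)) * ennreal (c * exp (- norm (y - x))) \<partial>lebesgue)
       \<le> ennreal (norm (f y) * exp (- norm y)) * ennreal (c * D)"
      using \<open>0 \<le> c\<close> by (simp add: ennreal_mult')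
  qed
  also have "\<dots> = (\<integral>\<^sup>+y. ennreal (norm (f y) * exp (- norm y)) \<partial>lebesgue) * ennreal (c * D)"
    by (rule nn_integral_multc) measurable
  also have "\<dots> < top"
    using f by (simp add: ennreal_mult_less_top exp_integrable_def)
  finally show ?thesis
    by (simp add: exp_integrable_def)
qed

text \<open>Fubini's theorem and the convolution of kernels. The double integral converges
  absolutely because the kernels are nonnegative: integrating norms over the middle variable
  reproduces the kernel at time \<open>s + t\<close>, against which \<open>f\<close> is
  integrable.\<close>

lemma heat_semigroup:
  fixes f :: "real^'n \<Rightarrow> complex"
  assumes f: "exp_integrable f" and "0 < s" "0 < t"
  shows "heat s (heat t f) x = heat (s + t) f x"
proof -
  have [measurable]: "f \<in> borel_measurable lebesgue"
    using assms by (simp add: exp_integrable_def)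
  let ?k = "\<lambda>y z. (heat_kernel s (x - y) * heat_kernel t (y - z)) *\<^sub>R f z"
  have nn: "(\<integral>\<^sup>+y. ennreal (heat_kernel s (x - y) * heat_kernel t (y - z)) \<partial>lebesgue) = ennreal (heat_kernel (s + t) (x - z))" for z
    by (rule nn_integral_heat_kernel_convolution) fact+
  have int: "integrable lebesgue (\<lambda>y. heat_kernel s (x - y) * heat_kernel t (y - z))" for z
    by (rule integrableI_nonneg) (auto simp: nn)
  have eq: "(LINT y|lebesgue. heat_kernel s (x - y) * heat_kernel t (y - z)) = heat_kernel (s + t) (x - z)" for z
    by (subst integral_eq_nn_integral) (auto simp: nn)
  have pair: "integrable (lebesgue \<Otimes>\<^sub>M lebesgue) (\<lambda>(y, z). ?k y z)"
  proof (rule integrableI_bounded)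
    show [measurable]: "(\<lambda>(y, z). ?k y z) \<in> borel_measurable (lebesgue \<Otimes>\<^sub>M lebesgue)"
      by measurable
    have "(\<integral>\<^sup>+p. ennreal (norm (case p of (y, z) \<Rightarrow> ?k y z)) \<partial>(lebesgue \<Otimes>\<^sub>M lebesgue))
        = (\<integral>\<^sup>+z. (\<integral>\<^sup>+y. ennreal (norm (?k y z)) \<partial>lebesgue) \<partial>lebesgue)"
      by (subst lebesgue_pair.nn_integral_snd[symmetric]) auto
    also have "\<dots> = (\<integral>\<^sup>+z. ennreal (norm (heat_kernel (s + t) (x - z) *\<^sub>R f z)) \<partial>lebesgue)"
    proof (rule nn_integral_cong)
      fix z
      have "(\<integral>\<^sup>+y. ennreal (norm (?k y z)) \<partial>lebesgue)
          = (\<integral>\<^sup>+y. ennreal (heat_kernel s (x - y) * heat_kernel t (y - z)) * ennreal (norm (f z)) \<partial>lebesgue)"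
        by (simp add: ennreal_mult' abs_mult)
      also have "\<dots> = ennreal (heat_kernel (s + t) (x - z)) * ennreal (norm (f z))"
        by (subst nn_integral_multc) (auto simp: nn)
      finally show "(\<integral>\<^sup>+y. ennreal (norm (?k y z)) \<partial>lebesgue) = ennreal (norm (heat_kernel (s + t) (x - z) *\<^sub>R f z))"
        by (simp add: ennreal_mult')
    qed
    also have "\<dots> < \<infinity>"
      using integrable_heat[OF f, of "s + t" x] assms by (simp add: integrable_iff_bounded)
    finally show "(\<integral>\<^sup>+p. ennreal (norm (case p of (y, z) \<Rightarrow> ?k y z)) \<partial>(lebesgue \<Otimes>\<^sub>M lebesgue)) < \<infinity>" .
  qed
  have "heat s (heat t f) x = (LINT y|lebesgue. LINT z|lebesgue. ?k y z)"
    unfolding heat_eq using integrable_heat[OF f \<open>0 < t\<close>]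
    by (simp flip: scaleR_scaleR)
  also have "\<dots> = (LINT z|lebesgue. LINT y|lebesgue. ?k y z)"
    by (rule lebesgue_pair.Fubini_integral[OF pair, symmetric])
  also have "\<dots> = heat (s + t) f x"
    unfolding heat_eq by (simp add: int eq)
  finally show ?thesis .
qed

text \<open>Kernel decay of order \<open>m + 2\<close> meets growth of order \<open>m\<close> in
  \<open>ball_growth_weighted_integral\<close>, with \<open>sqrt s\<close> as the natural length at
  time \<open>s\<close>. The constant depends only on \<open>m\<close> and the dimension.\<close>

lemma heat_growth_bound:
  "\<exists>C>0. \<forall>s F (x :: real^'n) A. 0 < s \<longrightarrow> 0 \<le> A \<longrightarrow> exp_integrable F \<longrightarrow> ball_growth m A F x (sqrt s) \<longrightarrow>
     norm (heat s F x) \<le> C * A / sqrt s ^ CARD('n)"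
proof -
  obtain C where C: "0 < C" "\<And>t x. 0 < t \<Longrightarrow>
      heat_kernel t (x :: real^'n) \<le> C / sqrt t ^ CARD('n) * (1 / (1 + norm x / sqrt t) ^ (m + 2))"
    using heat_kernel_decay[of "m + 2"] by blast
  have "norm (heat s F x) \<le> (C * (pi\<^sup>2 / 6)) * A / sqrt s ^ CARD('n)"
    if "0 < s" "0 \<le> A" and F: "exp_integrable F" "ball_growth m A F x (sqrt s)" for s F A and x :: "real^'n"
  proof -
    have [measurable]: "F \<in> borel_measurable lebesgue"
      using F by (simp add: exp_integrable_def)
    let ?c = "C / sqrt s ^ CARD('n)"
    let ?w = "\<lambda>z. norm (F z) * (1 / (1 + norm (x - z) / sqrt s) ^ (m + 2))"
    have "ennreal (norm (heat s F x)) \<le> (\<integral>\<^sup>+z. ennreal (norm (heat_kernel s (x - z) *\<^sub>R F z)) \<partial>lebesgue)"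
      unfolding heat_eq by (intro integral_norm_bound_ennreal integrable_heat that)
    also have "\<dots> \<le> (\<integral>\<^sup>+z. ennreal ?c * ennreal (?w z) \<partial>lebesgue)"
    proof (intro nn_integral_mono)
      fix z
      have "norm (F z) * heat_kernel s (x - z) \<le> norm (F z) * (?c * (1 / (1 + norm (x - z) / sqrt s) ^ (m + 2)))"
        using C \<open>0 < s\<close> by (intro mult_left_mono) auto
      then show "ennreal (norm (heat_kernel s (x - z) *\<^sub>R F z)) \<le> ennreal ?c * ennreal (?w z)"
        using C \<open>0 < s\<close> by (subst ennreal_mult'[symmetric]) (auto intro!: ennreal_leI simp: mult_ac)
    qed
    also have "\<dots> = ennreal ?c * (\<integral>\<^sup>+z. ennreal (?w z) \<partial>lebesgue)"
      by (rule nn_integral_cmult) measurable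
    also have "\<dots> \<le> ennreal ?c * ennreal (pi\<^sup>2 / 6 * A)"
      using that by (intro mult_left_mono ball_growth_weighted_integral) auto
    also have "\<dots> = ennreal (?c * (pi\<^sup>2 / 6 * A))"
      using C \<open>0 < s\<close> by (subst ennreal_mult'[symmetric]) auto
    finally show ?thesis
      using C \<open>0 < s\<close> \<open>0 \<le> A\<close> by (subst (asm) ennreal_le_iff) (auto simp: mult_ac)
  qed
  then show ?thesis
    using C(1) by (intro exI[of _ "C * (pi\<^sup>2 / 6)"]) auto
qed

text \<open>The Lipschitz bound of the kernel carries a weight centred at each of the two points,
  hence the growth assumption about both. Compared with \<open>heat_growth_bound\<close> the
  estimate gains the factor \<open>norm (x - y) / sqrt s\<close>.\<close>

lemma heat_growth_lipschitz:
  "\<exists>C>0. \<forall>s F (x :: real^'n) y A B. 0 < s \<longrightarrow> 0 \<le> A \<longrightarrow> 0 \<le> B \<longrightarrow> exp_integrable F \<longrightarrow>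
     ball_growth m A F x (sqrt s) \<longrightarrow> ball_growth m B F y (sqrt s) \<longrightarrow>
     norm (heat s F x - heat s F y) \<le> C * norm (x - y) * (A + B) / sqrt s ^ (CARD('n) + 1)"
proof -
  obtain C where C: "0 < C" "\<And>t x y. 0 < t \<Longrightarrow>
      \<bar>heat_kernel t (x :: real^'n) - heat_kernel t y\<bar> \<le> C * norm (x - y) / sqrt t ^ (CARD('n) + 1) *
       (1 / (1 + norm x / sqrt t) ^ (m + 2) + 1 / (1 + norm y / sqrt t) ^ (m + 2))"
    using heat_kernel_lipschitz[of "m + 2"] by blast
  have "norm (heat s F x - heat s F y) \<le> (C * (pi\<^sup>2 / 6)) * norm (x - y) * (A + B) / sqrt s ^ (CARD('n) + 1)"
    if "0 < s" "0 \<le> A" "0 \<le> B" and F: "exp_integrable F" "ball_growth m A F x (sqrt s)" "ball_growth m B F y (sqrt s)"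
    for s F A B and x y :: "real^'n"
  proof -
    have [measurable]: "F \<in> borel_measurable lebesgue"
      using F by (simp add: exp_integrable_def)
    let ?c = "C * norm (x - y) / sqrt s ^ (CARD('n) + 1)"
    have "0 \<le> ?c" using C \<open>0 < s\<close> by simp
    let ?w = "\<lambda>x z. norm (F z) * (1 / (1 + norm (x - z) / sqrt s) ^ (m + 2))"
    have "heat s F x - heat s F y = (LINT z|lebesgue. heat_kernel s (x - z) *\<^sub>R F z - heat_kernel s (y - z) *\<^sub>R F z)"
      unfolding heat_eq using that by (intro Bochner_Integration.integral_diff[symmetric] integrable_heat)
    then have "ennreal (norm (heat s F x - heat s F y))
        \<le> (\<integral>\<^sup>+z. ennreal (norm (heat_kernel s (x - z) *\<^sub>R F z - heat_kernel s (y - z) *\<^sub>R F z)) \<partial>lebesgue)"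
      using that by (simp only:) (intro integral_norm_bound_ennreal Bochner_Integration.integrable_diff integrable_heat)
    also have "\<dots> \<le> (\<integral>\<^sup>+z. ennreal ?c * (ennreal (?w x z) + ennreal (?w y z)) \<partial>lebesgue)"
    proof (intro nn_integral_mono)
      fix z
      have "norm (F z) * \<bar>heat_kernel s (x - z) - heat_kernel s (y - z)\<bar>
         \<le> norm (F z) * (?c * (1 / (1 + norm (x - z) / sqrt s) ^ (m + 2) + 1 / (1 + norm (y - z) / sqrt s) ^ (m + 2)))"
        using C(2)[OF \<open>0 < s\<close>, of "x - z" "y - z"] by (intro mult_left_mono) auto
      also have "\<dots> = ?c * (?w x z + ?w y z)"
        by (simp add: distrib_left mult_ac)
      finally have "norm (heat_kernel s (x - z) *\<^sub>R F z - heat_kernel s (y - z) *\<^sub>R F z) \<le> ?c * (?w x z + ?w y z)"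
        by (simp add: mult.commute flip: scaleR_diff_left)
      then have "ennreal (norm (heat_kernel s (x - z) *\<^sub>R F z - heat_kernel s (y - z) *\<^sub>R F z)) \<le> ennreal (?c * (?w x z + ?w y z))"
        by (rule ennreal_leI)
      also have "\<dots> = ennreal ?c * (ennreal (?w x z) + ennreal (?w y z))"
        using \<open>0 \<le> ?c\<close> \<open>0 < s\<close> by (subst ennreal_mult') (auto simp: ennreal_plus)
      finally show "ennreal (norm (heat_kernel s (x - z) *\<^sub>R F z - heat_kernel s (y - z) *\<^sub>R F z))
         \<le> ennreal ?c * (ennreal (?w x z) + ennreal (?w y z))" .
    qed
    also have "\<dots> = ennreal ?c * ((\<integral>\<^sup>+z. ennreal (?w x z) \<partial>lebesgue) + (\<integral>\<^sup>+z. ennreal (?w y z) \<partial>lebesgue))"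
      by (subst nn_integral_cmult, measurable, subst nn_integral_add) auto
    also have "\<dots> \<le> ennreal ?c * (ennreal (pi\<^sup>2 / 6 * A) + ennreal (pi\<^sup>2 / 6 * B))"
      using that by (intro mult_left_mono add_mono ball_growth_weighted_integral) auto
    also have "\<dots> = ennreal (?c * (pi\<^sup>2 / 6 * A + pi\<^sup>2 / 6 * B))"
      using \<open>0 \<le> ?c\<close> that by (subst ennreal_mult') (auto simp: ennreal_plus)
    also have "?c * (pi\<^sup>2 / 6 * A + pi\<^sup>2 / 6 * B) = (C * (pi\<^sup>2 / 6)) * norm (x - y) * (A + B) / sqrt s ^ (CARD('n) + 1)"
      by (simp add: field_simps)
    finally show ?thesis
      using C \<open>0 < s\<close> \<open>0 \<le> A\<close> \<open>0 \<le> B\<close> by (subst (asm) ennreal_le_iff) auto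
  qed
  then show ?thesis
    using C(1) by (intro exI[of _ "C * (pi\<^sup>2 / 6)"]) auto
qed

section \<open>Heat oscillation with respect to a doubling gauge\<close>

lemma ennreal_le_divide_real:
  assumes "I * ennreal v \<le> ennreal b" "0 < v"
  shows "I \<le> ennreal (b / v)"
proof -
  have "I = I * ennreal v * ennreal (1 / v)"
    using assms(2) by (simp add: mult.assoc ennreal_mult'[symmetric])
  also have "\<dots> \<le> ennreal b * ennreal (1 / v)"
    using assms by (intro mult_right_mono) auto
  also have "\<dots> = ennreal (b / v)"
    using assms by (subst ennreal_mult''[symmetric]) auto
  finally show ?thesis .
qed

text \<open>Averaging over all balls of radius \<open>\<rho>\<close> takes the place of a covering of the large ball.\<close>
lemma ball_integral_averaging:
  fixes F :: "real^'n \<Rightarrow> complex"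
  assumes [measurable]: "F \<in> borel_measurable lebesgue" and "0 < \<rho>"
  shows "(\<integral>\<^sup>+y\<in>ball x R. ennreal (norm (F y)) \<partial>lebesgue) * ennreal (unit_ball_vol CARD('n) * \<rho> ^ CARD('n))
     \<le> (\<integral>\<^sup>+z\<in>ball x (R + \<rho>). (\<integral>\<^sup>+y\<in>ball z \<rho>. ennreal (norm (F y)) \<partial>lebesgue) \<partial>lebesgue)"
proof -
  have [measurable]: "ball x R \<in> sets lebesgue" for x :: "real^'n" and R by simp
  let ?K = "\<lambda>z y. ennreal (norm (F y)) * indicator {..<\<rho>} (dist z y) * indicator (ball x (R + \<rho>)) z"
  have *: "indicator (ball z \<rho>) y = (indicator {..<\<rho>} (dist z y) :: ennreal)" for z y :: "real^'n"
    by (simp split: split_indicator)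
  have "(\<integral>\<^sup>+y\<in>ball x R. ennreal (norm (F y)) \<partial>lebesgue) * ennreal (unit_ball_vol CARD('n) * \<rho> ^ CARD('n))
      = (\<integral>\<^sup>+y. ennreal (norm (F y)) * indicator (ball x R) y * ennreal (unit_ball_vol CARD('n) * \<rho> ^ CARD('n)) \<partial>lebesgue)"
    by (rule nn_integral_multc[symmetric]) measurable
  also have "\<dots> = (\<integral>\<^sup>+y. ennreal (norm (F y)) * indicator (ball x R) y * (\<integral>\<^sup>+z. indicator (ball y \<rho>) z \<partial>lebesgue) \<partial>lebesgue)"
    using \<open>0 < \<rho>\<close> by (subst nn_integral_indicator) (auto simp: emeasure_ball)
  also have "\<dots> = (\<integral>\<^sup>+y. (\<integral>\<^sup>+z. ennreal (norm (F y)) * indicator (ball x R) y * indicator (ball y \<rho>) z \<partial>lebesgue) \<partial>lebesgue)"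
    by (subst nn_integral_cmult) auto
  also have "\<dots> \<le> (\<integral>\<^sup>+y. (\<integral>\<^sup>+z. ?K z y \<partial>lebesgue) \<partial>lebesgue)"
  proof (intro nn_integral_mono)
    fix y z
    show "ennreal (norm (F y)) * indicator (ball x R) y * indicator (ball y \<rho>) z \<le> ?K z y"
    proof (cases "y \<in> ball x R \<and> z \<in> ball y \<rho>")
      case True
      then have "z \<in> ball x (R + \<rho>)"
        using dist_triangle[of x z y] by auto
      then show ?thesis using True by (simp add: dist_commute)
    qed auto
  qed
  also have "\<dots> = (\<integral>\<^sup>+z. (\<integral>\<^sup>+y. ?K z y \<partial>lebesgue) \<partial>lebesgue)"
    by (rule lebesgue_pair.Fubini') measurable
  also have "\<dots> = (\<integral>\<^sup>+z\<in>ball x (R + \<rho>). (\<integral>\<^sup>+y\<in>ball z \<rho>. ennreal (norm (F y)) \<partial>lebesgue) \<partial>lebesgue)"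
    by (subst nn_integral_multc) (auto simp: *)
  finally show ?thesis .
qed

text \<open>Moving the centre by at most \<open>r\<close> enlarges the radius
  \<open>R \<ge> r\<close> to \<open>R + r \<le> 2 * R\<close>, which costs
  \<open>2 ^ m\<close>.\<close>

lemma ball_growth_shift:
  assumes "ball_growth m A F x r" "dist x y \<le> r" "0 < r" "0 \<le> A"
  shows "ball_growth m (2 ^ m * A) F y r"
  unfolding ball_growth_def
proof (intro conjI allI impI)
  show "F \<in> borel_measurable lebesgue"
    using assms by (simp add: ball_growth_def)
  fix R assume "r \<le> R"
  have "ball y R \<subseteq> ball x (R + r)"
    using assms(2) by (simp add: ball_subset_ball_iff dist_commute)
  then have "(\<integral>\<^sup>+z\<in>ball y R. ennreal (norm (F z)) \<partial>lebesgue) \<le> (\<integral>\<^sup>+z\<in>ball x (R + r). ennreal (norm (F z)) \<partial>lebesgue)"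
    by (intro nn_integral_mono) (auto split: split_indicator)
  also have "\<dots> \<le> ennreal (A * ((R + r) / r) ^ m)"
    using assms \<open>r \<le> R\<close> unfolding ball_growth_def by simp
  also have "\<dots> \<le> ennreal (A * (2 * (R / r)) ^ m)"
    using assms \<open>r \<le> R\<close> by (intro ennreal_leI mult_left_mono power_mono) (auto simp: field_simps)
  finally show "(\<integral>\<^sup>+z\<in>ball y R. ennreal (norm (F z)) \<partial>lebesgue) \<le> ennreal (2 ^ m * A * (R / r) ^ m)"
    by (simp add: power_mult_distrib power_divide mult_ac)
qed

lemma exp_integrable_if_polynomial_bound:
  fixes F :: "real^'n \<Rightarrow> complex"
  assumes [measurable]: "F \<in> borel_measurable lebesgue" and F: "\<And>x. norm (F x) \<le> c * (1 + norm x) ^ k"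
  shows "exp_integrable F"
proof (rule exp_integrable_if_growth)
  have "0 \<le> c" using order.trans[OF norm_ge_zero F[of 0]] by simp
  show "0 \<le> c * 2 ^ k * unit_ball_vol CARD('n)"
    using \<open>0 \<le> c\<close> by simp
  \<comment> \<open>For \<open>R \<ge> 1\<close> one has \<open>1 + norm y \<le> 2 * R\<close> on
    the ball, which gives \<open>2 ^ k\<close> and order \<open>k\<close>; the volume adds n to the
    order.\<close>
  show "ball_growth (k + CARD('n)) (c * 2 ^ k * unit_ball_vol CARD('n)) F 0 1"
    unfolding ball_growth_def
  proof (intro conjI allI impI)
    fix R :: real assume "1 \<le> R"
    have "(\<integral>\<^sup>+y\<in>ball 0 R. ennreal (norm (F y)) \<partial>lebesgue) \<le> (\<integral>\<^sup>+y\<in>ball 0 R. ennreal (c * (2 * R) ^ k) \<partial>(lebesgue :: (real^'n) measure))"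
    proof (intro nn_integral_mono)
      fix y
      show "ennreal (norm (F y)) * indicator (ball 0 R) y \<le> ennreal (c * (2 * R) ^ k) * indicator (ball 0 R) y"
      proof (cases "y \<in> ball 0 R")
        case True
        then have "norm (F y) \<le> c * (2 * R) ^ k"
          using \<open>1 \<le> R\<close> \<open>0 \<le> c\<close> by (intro order.trans[OF F] mult_left_mono power_mono) auto
        then show ?thesis using True by (simp add: ennreal_leI)
      qed simp
    qed
    also have "\<dots> = ennreal (c * 2 ^ k * unit_ball_vol CARD('n) * (R / 1) ^ (k + CARD('n)))"
      using \<open>1 \<le> R\<close> \<open>0 \<le> c\<close>
      by (subst nn_integral_cmult_indicator)
         (auto simp: emeasure_ball ennreal_mult'[symmetric] power_mult_distrib power_add mult_ac)
    finally show "(\<integral>\<^sup>+y\<in>ball 0 R. ennreal (norm (F y)) \<partial>lebesgue) \<le> ennreal (c * 2 ^ k * unit_ball_vol CARD('n) * (R / 1) ^ (k + CARD('n)))" .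
  qed fact
qed

text \<open>The analytic part uses \<psi> through these properties alone. The bound on
  \<open>a\<close> makes \<psi> x r / r ^ (n + 1) tend to 0 as r grows, and monotonicity for balls
  with different centres allows gauges at different points to be compared.\<close>

locale ball_gauge =
  fixes \<psi> :: "real^'n \<Rightarrow> real \<Rightarrow> real" and K a :: real
  assumes gauge_nonneg: "0 \<le> \<psi> x r"
    and gauge_mono: "0 < r \<Longrightarrow> ball x r \<subseteq> ball y s \<Longrightarrow> \<psi> x r \<le> \<psi> y s"
    and gauge_doubling: "0 < r \<Longrightarrow> r \<le> R \<Longrightarrow> \<psi> x R \<le> K * (R / r) powr a * \<psi> x r"
    and K_ge_1: "1 \<le> K" and a_less: "a < real CARD('n) + 1"
begin

text \<open>Rounds the exponent up to an integer, as \<open>ball_growth\<close> requires. Any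
  polynomial order is good enough there; the sharp exponent \<open>a\<close> is kept where decay
  matters.\<close>

lemma gauge_doubling_power:
  assumes "0 < r" "r \<le> R"
  shows "\<psi> x R \<le> K * (R / r) ^ (CARD('n) + 1) * \<psi> x r"
proof -
  have "(R / r) powr a \<le> (R / r) powr real (CARD('n) + 1)"
    using a_less assms by (intro powr_mono) auto
  also have "\<dots> = (R / r) ^ (CARD('n) + 1)"
    using assms by (intro powr_realpow) auto
  finally have "K * (R / r) powr a * \<psi> x r \<le> K * (R / r) ^ (CARD('n) + 1) * \<psi> x r"
    using K_ge_1 gauge_nonneg by (intro mult_right_mono mult_left_mono) auto
  then show ?thesis
    using gauge_doubling[OF assms] by (rule order.trans[rotated])
qed

text \<open>Up to a constant, the Lipschitz constant near \<open>x\<close> of the heat extension at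
  time \<open>s\<close> of a function whose integrals over balls of radius about
  \<open>sqrt s\<close> are of the size of the gauge.\<close>

definition gauge_ratio :: "real^'n \<Rightarrow> real \<Rightarrow> real" where
  "gauge_ratio x s = \<psi> x (sqrt s) / sqrt s ^ (CARD('n) + 1)"

lemma gauge_ratio_nonneg: "0 < s \<Longrightarrow> 0 \<le> gauge_ratio x s"
  by (simp add: gauge_ratio_def gauge_nonneg)

text \<open>Doubling costs \<open>sqrt c powr a\<close> while the denominator gains
  \<open>sqrt c ^ (n + 1)\<close>. The resulting exponent is negative, which yields both the limit 0
  and geometric decay along \<open>2 ^ j * s\<close>.\<close>

lemma gauge_ratio_scale:
  assumes "0 < s" "1 \<le> c"
  shows "gauge_ratio x (c * s) \<le> K * sqrt c powr (a - CARD('n) - 1) * gauge_ratio x s"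
proof -
  have "\<psi> x (sqrt (c * s)) \<le> K * (sqrt (c * s) / sqrt s) powr a * \<psi> x (sqrt s)"
    using assms by (intro gauge_doubling) (auto simp: real_sqrt_mult mult_le_cancel_right1)
  also have "sqrt (c * s) / sqrt s = sqrt c"
    using assms by (simp add: real_sqrt_mult)
  finally have "gauge_ratio x (c * s) \<le> K * sqrt c powr a * \<psi> x (sqrt s) / sqrt (c * s) ^ (CARD('n) + 1)"
    unfolding gauge_ratio_def using assms by (intro divide_right_mono) auto
  also have "\<dots> = K * (sqrt c powr a / sqrt c ^ (CARD('n) + 1)) * gauge_ratio x s"
    using assms by (simp add: gauge_ratio_def real_sqrt_mult power_mult_distrib)
  also have "sqrt c powr a / sqrt c ^ (CARD('n) + 1) = sqrt c powr (a - CARD('n) - 1)"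
    using assms by (subst powr_realpow[symmetric]) (auto simp: powr_diff[symmetric] diff_diff_eq add.commute)
  finally show ?thesis .
qed

lemma gauge_ratio_tendsto_0: "((\<lambda>s. gauge_ratio x s) \<longlongrightarrow> 0) at_top"
proof (rule tendsto_sandwich)
  show "\<forall>\<^sub>F s in at_top. 0 \<le> gauge_ratio x s"
    using eventually_gt_at_top[of 0] by eventually_elim (rule gauge_ratio_nonneg)
  show "\<forall>\<^sub>F s in at_top. gauge_ratio x s \<le> K * sqrt s powr (a - CARD('n) - 1) * gauge_ratio x 1"
    using eventually_ge_at_top[of 1] by eventually_elim (use gauge_ratio_scale[of 1] in auto)
  have "((\<lambda>s. sqrt s powr (a - CARD('n) - 1)) \<longlongrightarrow> 0) at_top"
    using a_less by (intro tendsto_neg_powr sqrt_at_top) auto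
  then show "((\<lambda>s. K * sqrt s powr (a - CARD('n) - 1) * gauge_ratio x 1) \<longlongrightarrow> 0) at_top"
    by (intro tendsto_mult_left_zero tendsto_mult_right_zero)
qed simp

text \<open>Separates the variables into a negative power of \<open>s\<close> and a polynomial in
  \<open>x\<close>. The gauge at \<open>x\<close> is transported to the origin because
  \<open>ball x 1\<close> lies in \<open>ball 0 (1 + norm x)\<close>.\<close>

lemma gauge_ratio_polynomial:
  assumes "1 \<le> s"
  shows "gauge_ratio x s \<le> K * sqrt s powr (a - CARD('n) - 1) * (K * (1 + norm x) ^ (CARD('n) + 1) * gauge_ratio 0 1)"
proof -
  have "gauge_ratio x s \<le> K * sqrt s powr (a - CARD('n) - 1) * gauge_ratio x 1"
    using gauge_ratio_scale[of 1 s x] assms by simp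
  also have "\<dots> \<le> K * sqrt s powr (a - CARD('n) - 1) * (K * (1 + norm x) ^ (CARD('n) + 1) * gauge_ratio 0 1)"
  proof -
    have "ball x 1 \<subseteq> ball 0 (1 + norm x)"
      by (simp add: ball_subset_ball_iff)
    then have "\<psi> x 1 \<le> \<psi> 0 (1 + norm x)"
      by (intro gauge_mono) auto
    also have "\<dots> \<le> K * ((1 + norm x) / 1) ^ (CARD('n) + 1) * \<psi> 0 1"
      by (intro gauge_doubling_power) auto
    finally have "gauge_ratio x 1 \<le> K * (1 + norm x) ^ (CARD('n) + 1) * gauge_ratio 0 1"
      by (simp add: gauge_ratio_def)
    then show ?thesis
      using K_ge_1 by (intro mult_left_mono) auto
  qed
  finally show ?thesis .
qed

text \<open>The assumption concerns the single radius \<rho>, so larger balls are reached by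
  averaging over balls of radius \<rho> with centres in \<open>ball x (R + \<rho>)\<close>. Their
  gauges are at most that of \<open>ball x (5 * R)\<close>, because
  \<open>\<rho> \<le> 2 * r \<le> 2 * R\<close>. The ratio of volumes contributes n to the order,
  and doubling contributes n + 1.\<close>

lemma ball_growth_if_ball_bound:
  fixes F :: "real^'n \<Rightarrow> complex"
  assumes [measurable]: "F \<in> borel_measurable lebesgue" and "0 \<le> N" "0 < r" "r \<le> \<rho>" "\<rho> \<le> 2 * r"
    and F: "\<And>z. (\<integral>\<^sup>+y\<in>ball z \<rho>. ennreal (norm (F y)) \<partial>lebesgue) \<le> ennreal (N * \<psi> z \<rho>)"
  shows "ball_growth (2 * CARD('n) + 1) (3 ^ CARD('n) * 5 ^ (CARD('n) + 1) * K * N * \<psi> x r) F x r"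
  unfolding ball_growth_def
proof (intro conjI allI impI)
  fix R assume "r \<le> R"
  let ?n = "CARD('n)"
  let ?V = "unit_ball_vol CARD('n)"
  have "?V > 0" and "?V \<noteq> 0"
    using unit_ball_vol_pos[of "CARD('n)"] by linarith+
  have "0 < \<rho>" using assms by simp
  have "(\<integral>\<^sup>+y\<in>ball x R. ennreal (norm (F y)) \<partial>lebesgue) * ennreal (?V * \<rho> ^ ?n)
     \<le> (\<integral>\<^sup>+z\<in>ball x (R + \<rho>). (\<integral>\<^sup>+y\<in>ball z \<rho>. ennreal (norm (F y)) \<partial>lebesgue) \<partial>lebesgue)"
    by (rule ball_integral_averaging) fact+
  also have "\<dots> \<le> (\<integral>\<^sup>+z\<in>ball x (R + \<rho>). ennreal (N * \<psi> x (R + 2 * \<rho>)) \<partial>lebesgue)"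
  proof (intro nn_integral_mono)
    fix z
    show "(\<integral>\<^sup>+y\<in>ball z \<rho>. ennreal (norm (F y)) \<partial>lebesgue) * indicator (ball x (R + \<rho>)) z
       \<le> ennreal (N * \<psi> x (R + 2 * \<rho>)) * indicator (ball x (R + \<rho>)) z"
    proof (cases "z \<in> ball x (R + \<rho>)")
      case True
      then have "ball z \<rho> \<subseteq> ball x (R + 2 * \<rho>)"
        by (simp add: ball_subset_ball_iff dist_commute)
      then have "N * \<psi> z \<rho> \<le> N * \<psi> x (R + 2 * \<rho>)"
        using assms \<open>0 < \<rho>\<close> by (intro mult_left_mono gauge_mono) auto
      then show ?thesis
        using True order.trans[OF F[of z] ennreal_leI] by simp
    qed simp
  qed
  also have "\<dots> = ennreal (N * \<psi> x (R + 2 * \<rho>) * (?V * (R + \<rho>) ^ ?n))"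
    using \<open>r \<le> R\<close> \<open>0 < r\<close> \<open>0 < \<rho>\<close> \<open>0 \<le> N\<close> gauge_nonneg
    by (subst nn_integral_cmult_indicator) (auto simp: emeasure_ball ennreal_mult''[symmetric])
  finally have "(\<integral>\<^sup>+y\<in>ball x R. ennreal (norm (F y)) \<partial>lebesgue)
      \<le> ennreal (N * \<psi> x (R + 2 * \<rho>) * (?V * (R + \<rho>) ^ ?n) / (?V * \<rho> ^ ?n))"
    using \<open>?V > 0\<close> \<open>0 < \<rho>\<close> by (intro ennreal_le_divide_real) auto
  also have "N * \<psi> x (R + 2 * \<rho>) * (?V * (R + \<rho>) ^ ?n) / (?V * \<rho> ^ ?n) = N * \<psi> x (R + 2 * \<rho>) * ((R + \<rho>) / \<rho>) ^ ?n"
    using \<open>?V \<noteq> 0\<close> by (simp add: power_divide)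
  also have "\<dots> \<le> N * (5 ^ (?n + 1) * K * (R / r) ^ (?n + 1) * \<psi> x r) * (3 * (R / r)) ^ ?n"
  proof (intro mult_mono power_mono mult_left_mono)
    have "ball x (R + 2 * \<rho>) \<subseteq> ball x (5 * R)"
      using assms \<open>r \<le> R\<close> by (intro subset_ball) auto
    then have "\<psi> x (R + 2 * \<rho>) \<le> \<psi> x (5 * R)"
      using assms \<open>r \<le> R\<close> by (intro gauge_mono) auto
    also have "\<dots> \<le> K * ((5 * R) / r) ^ (?n + 1) * \<psi> x r"
      using assms \<open>r \<le> R\<close> by (intro gauge_doubling_power) auto
    also have "\<dots> = 5 ^ (?n + 1) * K * (R / r) ^ (?n + 1) * \<psi> x r"
      by (simp only: power_mult_distrib power_divide times_divide_eq_left times_divide_eq_right mult_ac)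
    finally show "\<psi> x (R + 2 * \<rho>) \<le> 5 ^ (?n + 1) * K * (R / r) ^ (?n + 1) * \<psi> x r" .
    have "R / \<rho> \<le> R / r"
      using assms \<open>r \<le> R\<close> by (intro divide_left_mono) auto
    moreover have "1 \<le> R / r"
      using assms \<open>r \<le> R\<close> by simp
    ultimately have "R / \<rho> + 1 \<le> 3 * (R / r)"
      by linarith
    then show "(R + \<rho>) / \<rho> \<le> 3 * (R / r)"
      using \<open>0 < \<rho>\<close> by (simp add: add_divide_distrib)
  qed (use assms \<open>r \<le> R\<close> K_ge_1 gauge_nonneg in \<open>auto intro!: mult_nonneg_nonneg\<close>)
  also have "\<dots> = 3 ^ ?n * 5 ^ (?n + 1) * K * N * \<psi> x r * (R / r) ^ (2 * ?n + 1)"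
    by (simp only: power_mult_distrib[of 3 "R / r"] mult_2 mult_2_right power_add power_one_right mult_ac)
  finally show "(\<integral>\<^sup>+y\<in>ball x R. ennreal (norm (F y)) \<partial>lebesgue)
      \<le> ennreal (3 ^ ?n * 5 ^ (?n + 1) * K * N * \<psi> x r * (R / r) ^ (2 * ?n + 1))"
    by (simp add: ennreal_leI)
qed fact

section \<open>Lipschitz decay of differences of the heat flow\<close>

definition heat_osc :: "real \<Rightarrow> (real^'n \<Rightarrow> complex) \<Rightarrow> bool" where
  "heat_osc N f \<longleftrightarrow> exp_integrable f \<and> 0 \<le> N \<and>
     (\<forall>z. \<forall>r>0. (\<integral>\<^sup>+y\<in>ball z r. ennreal (norm (f y - heat (r\<^sup>2) f y)) \<partial>lebesgue) \<le> ennreal (N * \<psi> z r))"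

text \<open>The restriction on \<open>s'\<close> keeps \<open>\<rho> = sqrt (s' - s)\<close> between
  \<open>sqrt s\<close> and \<open>2 * sqrt s\<close>. The oscillation bound on balls of radius
  \<rho> then gives growth of \<open>f - heat (\<rho>^2) f\<close> at base radius
  \<open>sqrt s\<close>, which is what the Lipschitz estimate at time \<open>s\<close> asks
  for.\<close>

lemma heat_osc_step:
  "\<exists>C>0. \<forall>N f s (s' :: real) x y. heat_osc N f \<longrightarrow> 0 < s \<longrightarrow> 2 * s \<le> s' \<longrightarrow> s' \<le> 4 * s \<longrightarrow>
     norm ((heat s f x - heat s' f x) - (heat s f y - heat s' f y))
       \<le> C * N * norm (x - y) * (gauge_ratio x s + gauge_ratio y s)"
proof -
  let ?n = "CARD('n)"
  let ?c = "3 ^ ?n * 5 ^ (?n + 1) * K"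
  have "?c > 0" using K_ge_1 by simp
  obtain C where C: "C > 0" "\<And>s F x y A B. 0 < s \<Longrightarrow> 0 \<le> A \<Longrightarrow> 0 \<le> B \<Longrightarrow> exp_integrable F \<Longrightarrow>
     ball_growth (2 * ?n + 1) A F (x :: real^'n) (sqrt s) \<Longrightarrow> ball_growth (2 * ?n + 1) B F y (sqrt s) \<Longrightarrow>
     norm (heat s F x - heat s F y) \<le> C * norm (x - y) * (A + B) / sqrt s ^ (?n + 1)"
    using heat_growth_lipschitz[where 'n = 'n, of "2 * ?n + 1"] by blast
  show ?thesis
  proof (intro exI[of _ "C * ?c"] conjI allI impI)
    show "0 < C * ?c" using \<open>C > 0\<close> \<open>?c > 0\<close> by simp
    fix N f and s s' :: real and x y :: "real^'n"
    assume f: "heat_osc N f" and s: "0 < s" "2 * s \<le> s'" "s' \<le> 4 * s"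
    define \<rho> where "\<rho> = sqrt (s' - s)"
    have \<rho>: "\<rho>\<^sup>2 = s' - s" "sqrt s \<le> \<rho>" "\<rho> \<le> 2 * sqrt s"
    proof -
      show "\<rho>\<^sup>2 = s' - s" "sqrt s \<le> \<rho>" using s by (auto simp: \<rho>_def)
      have "\<rho> \<le> sqrt (4 * s)" using s unfolding \<rho>_def by (intro real_sqrt_le_mono) simp
      then show "\<rho> \<le> 2 * sqrt s" by (simp add: real_sqrt_mult)
    qed
    have "\<rho> > 0" using s by (simp add: \<rho>_def)
    let ?F = "\<lambda>y. f y - heat (\<rho>\<^sup>2) f y"
    have fi: "exp_integrable f" and "0 \<le> N" using f by (auto simp: heat_osc_def)
    have Fi: "exp_integrable ?F"
      using fi \<open>\<rho> > 0\<close> by (intro exp_integrable_diff exp_integrable_heat) auto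
    have heatF: "heat s ?F z = heat s f z - heat s' f z" for z
    proof -
      have "heat s ?F z = heat s f z - heat s (heat (\<rho>\<^sup>2) f) z"
        using fi s \<open>\<rho> > 0\<close> by (intro heat_diff exp_integrable_heat) auto
      also have "heat s (heat (\<rho>\<^sup>2) f) z = heat s' f z"
        using fi s \<open>\<rho> > 0\<close> by (subst heat_semigroup) (auto simp: \<rho>)
      finally show ?thesis .
    qed
    have growth: "ball_growth (2 * ?n + 1) (?c * N * \<psi> z (sqrt s)) ?F z (sqrt s)" for z
    proof (rule ball_growth_if_ball_bound[where \<rho> = \<rho>])
      show "?F \<in> borel_measurable lebesgue"
        using Fi by (simp add: exp_integrable_def)
      show "(\<integral>\<^sup>+y\<in>ball z \<rho>. ennreal (norm (?F y)) \<partial>lebesgue) \<le> ennreal (N * \<psi> z \<rho>)" for z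
        using f \<open>\<rho> > 0\<close> unfolding heat_osc_def by blast
    qed (use s \<rho> \<open>0 \<le> N\<close> in auto)
    have "norm (heat s ?F x - heat s ?F y)
        \<le> C * norm (x - y) * (?c * N * \<psi> x (sqrt s) + ?c * N * \<psi> y (sqrt s)) / sqrt s ^ (?n + 1)"
      using \<open>0 \<le> N\<close> gauge_nonneg K_ge_1 by (intro C(2) growth Fi s mult_nonneg_nonneg) auto
    also have "\<dots> = C * ?c * N * norm (x - y) * (gauge_ratio x s + gauge_ratio y s)"
      using s by (simp add: gauge_ratio_def field_simps)
    finally show "norm ((heat s f x - heat s' f x) - (heat s f y - heat s' f y))
       \<le> C * ?c * N * norm (x - y) * (gauge_ratio x s + gauge_ratio y s)"
      by (simp only: heatF)
  qed
qed

lemma heat_osc_chain: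
  "\<exists>C>0. \<forall>N f s (s' :: real) x y. heat_osc N f \<longrightarrow> 0 < s \<longrightarrow> 2 * s \<le> s' \<longrightarrow>
     norm ((heat s f x - heat s' f x) - (heat s f y - heat s' f y))
       \<le> C * N * norm (x - y) * (gauge_ratio x s + gauge_ratio y s)"
proof -
  obtain C where "C > 0" and C: "\<And>N f s s' x y. heat_osc N f \<Longrightarrow> 0 < s \<Longrightarrow> 2 * s \<le> s' \<Longrightarrow> s' \<le> 4 * s \<Longrightarrow>
     norm ((heat s f x - heat s' f x) - (heat s f y - heat s' f y))
       \<le> C * N * norm (x - y) * (gauge_ratio x s + gauge_ratio y s)"
    using heat_osc_step by blast
  \<comment> \<open>The ratio of the geometric series: doubling the time multiplies the length
    \<open>sqrt s\<close> by \<open>sqrt 2\<close>.\<close>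
  define \<theta> where "\<theta> = sqrt 2 powr (a - CARD('n) - 1)"
  have \<theta>: "0 < \<theta>" "\<theta> < 1"
    using a_less by (auto simp: \<theta>_def powr_less_one)
  have chain: "norm ((heat s f x - heat s' f x) - (heat s f y - heat s' f y))
       \<le> C * N * norm (x - y) * (\<Sum>j\<le>m. gauge_ratio x (2 ^ j * s) + gauge_ratio y (2 ^ j * s))"
    if "heat_osc N f" "0 < s" "2 * s \<le> s'" "s' \<le> 2 ^ (m + 2) * s" for N f s s' x y m
    using that
  proof (induction m arbitrary: s)
    case 0
    then show ?case using C[of N f s s' x y] by simp
  next
    case (Suc m)
    have nonneg: "0 \<le> gauge_ratio x (2 ^ j * s) + gauge_ratio y (2 ^ j * s)" for j
      using Suc.prems by (intro add_nonneg_nonneg gauge_ratio_nonneg) auto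
    have "0 \<le> N" using Suc.prems by (simp add: heat_osc_def)
    have split: "(\<Sum>j\<le>Suc m. gauge_ratio x (2 ^ j * s) + gauge_ratio y (2 ^ j * s))
      = (gauge_ratio x s + gauge_ratio y s)
        + (\<Sum>j\<le>m. gauge_ratio x (2 ^ j * (2 * s)) + gauge_ratio y (2 ^ j * (2 * s)))"
      by (subst sum.atMost_Suc_shift) (simp add: mult_ac)
    show ?case
    \<comment> \<open>A last step of ratio between 2 and 4 absorbs an arbitrary final time. If
      \<open>s' > 4 * s\<close>, then after the step from \<open>s\<close> to \<open>2 * s\<close>
      the requirement \<open>2 * (2 * s) \<le> s'\<close> still holds.\<close>
    proof (cases "s' \<le> 4 * s")
      case True
      have "norm ((heat s f x - heat s' f x) - (heat s f y - heat s' f y))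
        \<le> C * N * norm (x - y) * (gauge_ratio x s + gauge_ratio y s)"
        using Suc.prems True by (intro C)
      also have "\<dots> \<le> C * N * norm (x - y) * (\<Sum>j\<le>Suc m. gauge_ratio x (2 ^ j * s) + gauge_ratio y (2 ^ j * s))"
        unfolding split using \<open>C > 0\<close> \<open>0 \<le> N\<close> nonneg[of "Suc _"]
        by (intro mult_left_mono) (auto intro!: sum_nonneg simp: mult_ac)
      finally show ?thesis .
    next
      case False
      have "norm ((heat (2 * s) f x - heat s' f x) - (heat (2 * s) f y - heat s' f y))
         \<le> C * N * norm (x - y) * (\<Sum>j\<le>m. gauge_ratio x (2 ^ j * (2 * s)) + gauge_ratio y (2 ^ j * (2 * s)))"
        using Suc.prems False by (intro Suc.IH) auto
      moreover have "norm ((heat s f x - heat (2 * s) f x) - (heat s f y - heat (2 * s) f y))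
        \<le> C * N * norm (x - y) * (gauge_ratio x s + gauge_ratio y s)"
        using Suc.prems by (intro C) auto
      ultimately show ?thesis
        unfolding split distrib_left[of "C * N * norm (x - y)"]
        using norm_triangle_ineq[of "(heat s f x - heat (2 * s) f x) - (heat s f y - heat (2 * s) f y)"
           "(heat (2 * s) f x - heat s' f x) - (heat (2 * s) f y - heat s' f y)"]
        by (simp add: algebra_simps)
    qed
  qed
  \<comment> \<open>Each term is compared directly with the one at \<open>s\<close>, so that
    \<open>K\<close> occurs once and does not accumulate as \<open>K ^ j\<close>.\<close>
  have ratio: "(\<Sum>j\<le>m. gauge_ratio x (2 ^ j * s)) \<le> K / (1 - \<theta>) * gauge_ratio x s" if "0 < s" for x s m
  proof -
    have "(\<Sum>j\<le>m. gauge_ratio x (2 ^ j * s)) \<le> (\<Sum>j\<le>m. K * gauge_ratio x s * \<theta> ^ j)"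
    proof (intro sum_mono)
      fix j
      have "sqrt (2 ^ j) powr (a - CARD('n) - 1) = \<theta> ^ j"
      proof -
        have "sqrt (2 ^ j) = sqrt 2 powr real j"
          by (simp add: real_sqrt_power powr_realpow)
        then have "sqrt (2 ^ j) powr (a - CARD('n) - 1) = \<theta> powr real j"
          unfolding \<theta>_def by (simp only: powr_powr mult.commute)
        then show ?thesis
          using \<theta> by (simp add: powr_realpow)
      qed
      then show "gauge_ratio x (2 ^ j * s) \<le> K * gauge_ratio x s * \<theta> ^ j"
        using gauge_ratio_scale[OF \<open>0 < s\<close>, of "2 ^ j" x] by (simp add: mult_ac)
    qed
    also have "\<dots> = K * gauge_ratio x s * (\<Sum>j\<le>m. \<theta> ^ j)"
      by (simp add: sum_distrib_left)
    also have "\<dots> \<le> K * gauge_ratio x s * (1 / (1 - \<theta>))"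
    proof (intro mult_left_mono)
      have "(\<Sum>j\<le>m. \<theta> ^ j) \<le> (\<Sum>j. \<theta> ^ j)"
        using \<theta> by (intro sum_le_suminf summable_geometric) auto
      then show "(\<Sum>j\<le>m. \<theta> ^ j) \<le> 1 / (1 - \<theta>)"
        using \<theta> by (simp add: suminf_geometric)
    qed (use gauge_ratio_nonneg[OF \<open>0 < s\<close>] K_ge_1 in auto)
    finally show ?thesis by simp
  qed
  show ?thesis
  proof (intro exI[of _ "C * (K / (1 - \<theta>))"] conjI allI impI)
    show "0 < C * (K / (1 - \<theta>))" using \<open>C > 0\<close> \<theta> K_ge_1 by simp
    fix N f and s s' :: real and x y
    assume *: "heat_osc N f" "0 < s" "2 * s \<le> s'"
    then have "0 \<le> N" by (simp add: heat_osc_def)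
    obtain m where "s' / s < 2 ^ m"
      using real_arch_pow[of 2 "s' / s"] by auto
    then have "s' \<le> 2 ^ m * s" using * by (simp add: field_simps)
    also have "\<dots> \<le> 2 ^ (m + 2) * s" using * by simp
    finally have "norm ((heat s f x - heat s' f x) - (heat s f y - heat s' f y))
       \<le> C * N * norm (x - y) * (\<Sum>j\<le>m. gauge_ratio x (2 ^ j * s) + gauge_ratio y (2 ^ j * s))"
      using * by (intro chain) auto
    also have "\<dots> \<le> C * N * norm (x - y) * (K / (1 - \<theta>) * gauge_ratio x s + K / (1 - \<theta>) * gauge_ratio y s)"
      unfolding sum.distrib using \<open>C > 0\<close> \<open>0 \<le> N\<close> * by (intro mult_left_mono add_mono ratio) auto
    finally show "norm ((heat s f x - heat s' f x) - (heat s f y - heat s' f y))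
       \<le> C * (K / (1 - \<theta>)) * N * norm (x - y) * (gauge_ratio x s + gauge_ratio y s)"
      by (subst (asm) distrib_left[symmetric]) (simp only: mult_ac)
  qed
qed

end

section \<open>Mean oscillation\<close>

lemma ball_integral_add_const:
  fixes u v :: "real^'n \<Rightarrow> real"
  assumes [measurable]: "v \<in> borel_measurable lebesgue" and "\<And>y. 0 \<le> v y" "0 \<le> E" "0 \<le> b" "0 \<le> r"
    and u: "\<And>y. y \<in> ball x r \<Longrightarrow> u y \<le> v y + E"
    and v: "(\<integral>\<^sup>+y\<in>ball x r. ennreal (v y) \<partial>lebesgue) \<le> ennreal b"
  shows "(\<integral>\<^sup>+y\<in>ball x r. ennreal (u y) \<partial>lebesgue) \<le> ennreal (b + E * (unit_ball_vol CARD('n) * r ^ CARD('n)))"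
proof -
  have [measurable]: "ball x r \<in> sets lebesgue" by simp
  have "(\<integral>\<^sup>+y\<in>ball x r. ennreal (u y) \<partial>lebesgue)
     \<le> (\<integral>\<^sup>+y. ennreal (v y) * indicator (ball x r) y + ennreal E * indicator (ball x r) y \<partial>lebesgue)"
    using u assms by (intro nn_integral_mono) (auto simp flip: ennreal_plus intro!: ennreal_leI split: split_indicator)
  also have "\<dots> = (\<integral>\<^sup>+y\<in>ball x r. ennreal (v y) \<partial>lebesgue) + (\<integral>\<^sup>+y. ennreal E * indicator (ball x r) y \<partial>lebesgue)"
    by (rule nn_integral_add) measurable
  also have "\<dots> \<le> ennreal b + ennreal (E * (unit_ball_vol CARD('n) * r ^ CARD('n)))"
    using v assms by (intro add_mono) (auto simp: nn_integral_cmult_indicator emeasure_ball ennreal_mult')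
  finally show ?thesis
    using assms by (simp add: ennreal_plus)
qed

text \<open>The difference \<open>ball_mean g x r - c\<close> is the mean of \<open>g - c\<close>.
  Consequently an oscillation bound with respect to any constant \<open>c\<close> can be turned into
  one with respect to the mean.\<close>

lemma ball_mean_diff_bound:
  fixes g :: "real^'n \<Rightarrow> complex"
  assumes g: "set_integrable lebesgue (ball x r) g" and "0 < r"
    and b: "(\<integral>\<^sup>+y\<in>ball x r. ennreal (norm (g y - c)) \<partial>lebesgue) \<le> ennreal b" and "0 \<le> b"
  shows "norm (ball_mean g x r - c) * (unit_ball_vol CARD('n) * r ^ CARD('n)) \<le> b"
proof -
  let ?B = "ball x r"
  define v where "v = unit_ball_vol CARD('n) * r ^ CARD('n)"
  have "0 < v" using \<open>0 < r\<close> unit_ball_vol_pos[of "CARD('n)"] by (simp add: v_def)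
  have B: "emeasure lebesgue ?B = ennreal v"
    using \<open>0 < r\<close> by (simp add: v_def emeasure_ball)
  then have mB: "measure lebesgue ?B = v"
    using \<open>0 < v\<close> by (simp add: measure_def)
  have gi: "integrable lebesgue (\<lambda>y. indicator ?B y *\<^sub>R g y)"
    using g by (simp add: set_integrable_def)
  have ind: "integrable lebesgue (indicator ?B :: _ \<Rightarrow> real)"
    using B by (intro integrable_real_indicator) auto
  then have ci: "integrable lebesgue (\<lambda>y. indicator ?B y *\<^sub>R c)"
    by simp
  have "(LINT y|lebesgue. indicator ?B y *\<^sub>R (g y - c)) = (LINT y|lebesgue. indicator ?B y *\<^sub>R g y) - (LINT y|lebesgue. indicator ?B y *\<^sub>R c)"
    using gi ci by (simp add: scaleR_diff_right)
  also have "(LINT y|lebesgue. indicator ?B y *\<^sub>R c) = v *\<^sub>R c"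
    using ind mB by simp
  also have "(LINT y|lebesgue. indicator ?B y *\<^sub>R g y) = v *\<^sub>R ball_mean g x r"
    using mB \<open>0 < v\<close> by (simp add: ball_mean_def set_lebesgue_integral_def)
  finally have eq: "(LINT y|lebesgue. indicator ?B y *\<^sub>R (g y - c)) = v *\<^sub>R (ball_mean g x r - c)"
    by (simp add: scaleR_diff_right)
  have "ennreal (norm (LINT y|lebesgue. indicator ?B y *\<^sub>R (g y - c)))
      \<le> (\<integral>\<^sup>+y. ennreal (norm (indicator ?B y *\<^sub>R (g y - c))) \<partial>lebesgue)"
    using gi ci by (intro integral_norm_bound_ennreal) (simp add: scaleR_diff_right)
  also have "\<dots> = (\<integral>\<^sup>+y\<in>?B. ennreal (norm (g y - c)) \<partial>lebesgue)"
    by (intro nn_integral_cong) (auto split: split_indicator)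
  also note b
  finally show ?thesis
    unfolding eq using \<open>0 < v\<close> \<open>0 \<le> b\<close> by (simp add: mult.commute v_def[symmetric])
qed

lemma exp_integrable_locally:
  fixes f :: "real^'n \<Rightarrow> complex"
  assumes f: "exp_integrable f" and "bounded S" and [measurable]: "S \<in> sets lebesgue"
  shows "set_integrable lebesgue S f"
proof -
  have [measurable]: "f \<in> borel_measurable lebesgue"
    using f by (simp add: exp_integrable_def)
  obtain R where R: "\<And>x. x \<in> S \<Longrightarrow> norm x \<le> R"
    using \<open>bounded S\<close> by (auto simp: bounded_iff)
  have "integrable lebesgue (\<lambda>x. indicator S x *\<^sub>R f x)"
  proof (rule integrableI_bounded)
    have "(\<integral>\<^sup>+x. ennreal (norm (indicator S x *\<^sub>R f x)) \<partial>lebesgue)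
       \<le> (\<integral>\<^sup>+x. ennreal (exp R) * ennreal (norm (f x) * exp (- norm x)) \<partial>lebesgue)"
    proof (intro nn_integral_mono)
      fix x
      show "ennreal (norm (indicator S x *\<^sub>R f x)) \<le> ennreal (exp R) * ennreal (norm (f x) * exp (- norm x))"
      proof (cases "x \<in> S")
        case True
        have "norm (f x) * 1 \<le> norm (f x) * exp (R - norm x)"
          using R[OF True] by (intro mult_left_mono) auto
        then show ?thesis
          using True by (subst ennreal_mult'[symmetric]) (auto intro!: ennreal_leI simp: exp_diff exp_minus field_simps)
      qed simp
    qed
    also have "\<dots> = ennreal (exp R) * (\<integral>\<^sup>+x. ennreal (norm (f x) * exp (- norm x)) \<partial>lebesgue)"
      by (rule nn_integral_cmult) measurable
    also have "\<dots> < \<infinity>"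
      using f by (simp add: ennreal_mult_less_top exp_integrable_def)
    finally show "(\<integral>\<^sup>+x. ennreal (norm (indicator S x *\<^sub>R f x)) \<partial>lebesgue) < \<infinity>" .
  qed measurable
  then show ?thesis by (simp add: set_integrable_def)
qed

lemma measurable_if_locally_integrable:
  fixes g :: "real^'n \<Rightarrow> complex"
  assumes "\<And>r. 0 < r \<Longrightarrow> set_integrable lebesgue (ball 0 r) g"
  shows "g \<in> borel_measurable lebesgue"
proof (rule borel_measurable_LIMSEQ_metric)
  fix k :: nat
  show "(\<lambda>x. indicator (ball 0 (real k + 1)) x *\<^sub>R g x) \<in> borel_measurable lebesgue"
    using assms[of "real k + 1"] by (simp add: set_integrable_def borel_measurable_integrable)
next
  fix x :: "real^'n"
  obtain k0 where "norm x < real k0"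
    using reals_Archimedean2 by blast
  have "\<forall>\<^sub>F k in sequentially. indicator (ball 0 (real k + 1)) x *\<^sub>R g x = g x"
    using eventually_ge_at_top[of k0]
  proof eventually_elim
    case (elim k)
    then have "real k0 \<le> real k" by simp
    then show ?case
      using \<open>norm x < real k0\<close> by (simp split: split_indicator)
  qed
  then show "(\<lambda>k. indicator (ball 0 (real k + 1)) x *\<^sub>R g x) \<longlonglongrightarrow> g x"
    by (rule tendsto_eventually)
qed

text \<open>The estimates control differences of values only, so only these are required to converge
  and \<open>h\<close> is determined up to an additive constant. Restricting to integer times makes
  \<open>h\<close> a limit of a sequence, as its measurability proof needs.\<close>

definition heat_limit :: "(real^'n \<Rightarrow> complex) \<Rightarrow> (real^'n \<Rightarrow> complex) \<Rightarrow> bool" where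
  "heat_limit f h \<longleftrightarrow> h \<in> borel_measurable lebesgue \<and>
     (\<forall>x y. (\<lambda>m. heat (real m) f x - heat (real m) f y) \<longlonglongrightarrow> h x - h y)"

section \<open>The limit of the heat flow modulo constants\<close>

context ball_gauge
begin

lemma heat_limit_bound:
  "\<exists>C>0. \<forall>N f h s x y. heat_osc N f \<longrightarrow> heat_limit f h \<longrightarrow> 0 < s \<longrightarrow>
     norm ((heat s f x - h x) - (heat s f y - h y))
       \<le> C * N * norm (x - y) * (gauge_ratio x s + gauge_ratio y s)"
proof -
  obtain C where "C > 0" and C: "\<And>N f s s' x y. heat_osc N f \<Longrightarrow> 0 < s \<Longrightarrow> 2 * s \<le> s' \<Longrightarrow>
     norm ((heat s f x - heat s' f x) - (heat s f y - heat s' f y))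
       \<le> C * N * norm (x - y) * (gauge_ratio x s + gauge_ratio y s)"
    using heat_osc_chain by blast
  have "norm ((heat s f x - h x) - (heat s f y - h y))
       \<le> C * N * norm (x - y) * (gauge_ratio x s + gauge_ratio y s)"
    if "heat_osc N f" "heat_limit f h" "0 < s" for N f h s x y
  proof (rule Lim_norm_ubound)
    have "(\<lambda>m. (heat s f x - heat s f y) - (heat (real m) f x - heat (real m) f y))
        \<longlonglongrightarrow> (heat s f x - heat s f y) - (h x - h y)"
      by (rule tendsto_diff[OF tendsto_const]) (use that in \<open>simp add: heat_limit_def\<close>)
    then show "(\<lambda>m. (heat s f x - heat (real m) f x) - (heat s f y - heat (real m) f y))
        \<longlonglongrightarrow> (heat s f x - h x) - (heat s f y - h y)"
      by (simp add: algebra_simps)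
    obtain k :: nat where "2 * s \<le> real k"
      using real_arch_simple by blast
    show "\<forall>\<^sub>F m in sequentially. norm ((heat s f x - heat (real m) f x) - (heat s f y - heat (real m) f y))
        \<le> C * N * norm (x - y) * (gauge_ratio x s + gauge_ratio y s)"
      using eventually_ge_at_top[of k]
    proof eventually_elim
      case (elim m)
      then have "2 * s \<le> real m" using \<open>2 * s \<le> real k\<close> by simp
      then show ?case by (rule C[OF that(1,3)])
    qed
  qed simp
  with \<open>C > 0\<close> show ?thesis by blast
qed

lemma heat_limit_exists:
  assumes f: "heat_osc N f"
  shows "\<exists>h. heat_limit f h"
proof -
  obtain C where "C > 0" and C: "\<And>s s' x y. 0 < s \<Longrightarrow> 2 * s \<le> s' \<Longrightarrow>
     norm ((heat s f x - heat s' f x) - (heat s f y - heat s' f y))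
       \<le> C * N * norm (x - y) * (gauge_ratio x s + gauge_ratio y s)"
    using heat_osc_chain f by blast
  have [measurable]: "f \<in> borel_measurable lebesgue"
    using f by (simp add: heat_osc_def exp_integrable_def)
  \<comment> \<open>Subtracting the value at 0 fixes the free constant: the limit constructed here
    vanishes at the origin.\<close>
  define d where "d m x = heat (real m) f x - heat (real m) f 0" for m :: nat and x
  have [measurable]: "d m \<in> borel_measurable lebesgue" for m
    unfolding d_def[abs_def] using heat_measurable[of f] by measurable
  have "Cauchy (\<lambda>m. d m x)" for x
  proof (rule CauchyI)
    fix e :: real assume "0 < e"
    let ?b = "\<lambda>s. C * N * norm (x - 0) * (gauge_ratio x s + gauge_ratio 0 s)"
    have "(?b \<longlongrightarrow> C * N * norm (x - 0) * (0 + 0)) at_top"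
      by (intro tendsto_intros gauge_ratio_tendsto_0)
    then have "((\<lambda>m. ?b (real m)) \<longlongrightarrow> 0) sequentially"
      using filterlim_compose[OF _ filterlim_real_sequentially, of ?b] by simp
    then have "\<forall>\<^sub>F m in sequentially. ?b (real m) < e / 2"
      by (rule order_tendstoD(2)) (use \<open>0 < e\<close> in simp)
    then obtain M where M: "\<And>m. M \<le> m \<Longrightarrow> ?b (real m) < e / 2"
      by (auto simp: eventually_sequentially)
    have "norm (d m x - d m' x) < e" if "max M 1 \<le> m" "max M 1 \<le> m'" for m m'
    proof -
      \<comment> \<open>A common later time. \<open>heat_osc_chain\<close> compares only times of
        ratio at least 2, so \<open>m\<close> and \<open>m'\<close> are compared with
        \<open>p\<close> rather than with each other.\<close>
      define p where "p = 2 * (m + m')"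
      have *: "norm (d i x - d p x) < e / 2" if "i \<in> {m, m'}" for i
      proof -
        have "norm (d i x - d p x) \<le> ?b (real i)"
          using C[of "real i" "real p" x 0] that \<open>max M 1 \<le> m\<close> \<open>max M 1 \<le> m'\<close>
          by (auto simp: d_def p_def algebra_simps)
        also have "\<dots> < e / 2"
          using that \<open>max M 1 \<le> m\<close> \<open>max M 1 \<le> m'\<close> by (intro M) auto
        finally show ?thesis .
      qed
      have "norm (d m x - d m' x) \<le> norm (d m x - d p x) + norm (d m' x - d p x)"
        using norm_triangle_ineq4[of "d m x - d p x" "d m' x - d p x"] by simp
      then show ?thesis
        using *[of m] *[of m'] by simp
    qed
    then show "\<exists>M. \<forall>m\<ge>M. \<forall>n\<ge>M. norm (d m x - d n x) < e"
      by blast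
  qed
  then have lim: "(\<lambda>m. d m x) \<longlonglongrightarrow> lim (\<lambda>m. d m x)" for x
    by (simp add: Cauchy_convergent_iff convergent_LIMSEQ_iff)
  show ?thesis
    unfolding heat_limit_def
  proof (intro exI[of _ "\<lambda>x. lim (\<lambda>m. d m x)"] conjI allI)
    show "(\<lambda>x. lim (\<lambda>m. d m x)) \<in> borel_measurable lebesgue"
      by (rule borel_measurable_LIMSEQ_metric[OF _ lim]) measurable
    show "(\<lambda>m. heat (real m) f x - heat (real m) f y) \<longlonglongrightarrow> lim (\<lambda>m. d m x) - lim (\<lambda>m. d m y)" for x y
      using tendsto_diff[OF lim[of x] lim[of y]] by (simp add: d_def)
  qed
qed

text \<open>The error decays in \<open>s\<close> uniformly in \<open>x\<close> up to a polynomial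
  weight. It dominates when the heat operator is applied to the convergence towards
  \<open>h\<close>, and at \<open>s = 1\<close> it makes \<open>h\<close> exponentially
  integrable.\<close>

lemma heat_limit_polynomial_bound:
  assumes f: "heat_osc N f" and h: "heat_limit f h"
  shows "\<exists>B\<ge>0. \<forall>s\<ge>1. \<forall>x. norm ((heat s f x - h x) - (heat s f 0 - h 0))
    \<le> B * sqrt s powr (a - CARD('n) - 1) * (1 + norm x) ^ (CARD('n) + 2)"
proof -
  let ?e = "a - CARD('n) - 1"
  obtain C where "C > 0" and C: "\<And>s x y. 0 < s \<Longrightarrow>
     norm ((heat s f x - h x) - (heat s f y - h y)) \<le> C * N * norm (x - y) * (gauge_ratio x s + gauge_ratio y s)"
    using heat_limit_bound f h by blast
  have "0 \<le> N" using f by (simp add: heat_osc_def)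
  let ?B = "C * N * (K * K * gauge_ratio 0 1 * 2)"
  show ?thesis
  proof (intro exI[of _ ?B] conjI allI impI)
    show "0 \<le> ?B"
      using \<open>C > 0\<close> \<open>0 \<le> N\<close> K_ge_1 gauge_ratio_nonneg[of 1 0] by simp
    fix s :: real and x :: "real^'n" assume "1 \<le> s"
    let ?p = "K * sqrt s powr ?e * (K * (1 + norm x) ^ (CARD('n) + 1) * gauge_ratio 0 1)"
    have p: "gauge_ratio x s \<le> ?p"
      using \<open>1 \<le> s\<close> by (rule gauge_ratio_polynomial)
    have "gauge_ratio 0 s \<le> K * sqrt s powr ?e * (K * 1 * gauge_ratio 0 1)"
      using gauge_ratio_polynomial[OF \<open>1 \<le> s\<close>, of 0] by simp
    also have "\<dots> \<le> ?p"
      using K_ge_1 gauge_ratio_nonneg[of 1 0] by (intro mult_left_mono mult_right_mono one_le_power) auto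
    finally have p0: "gauge_ratio 0 s \<le> ?p" .
    have "norm ((heat s f x - h x) - (heat s f 0 - h 0)) \<le> C * N * norm (x - 0) * (gauge_ratio x s + gauge_ratio 0 s)"
      using \<open>1 \<le> s\<close> by (intro C) auto
    also have "\<dots> \<le> C * N * (1 + norm x) * (?p + ?p)"
      using p p0 \<open>C > 0\<close> \<open>0 \<le> N\<close> gauge_ratio_nonneg[of s] \<open>1 \<le> s\<close> by (intro mult_mono add_mono) auto
    also have "\<dots> = ?B * sqrt s powr ?e * (1 + norm x) ^ (CARD('n) + 2)"
      by (simp add: mult_ac)
    finally show "norm ((heat s f x - h x) - (heat s f 0 - h 0)) \<le> ?B * sqrt s powr ?e * (1 + norm x) ^ (CARD('n) + 2)" .
  qed
qed

lemma heat_limit_exp_integrable: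
  assumes f: "heat_osc N f" and h: "heat_limit f h"
  shows "exp_integrable h"
proof -
  obtain B where B: "\<And>s x. 1 \<le> s \<Longrightarrow> norm ((heat s f x - h x) - (heat s f 0 - h 0))
    \<le> B * sqrt s powr (a - CARD('n) - 1) * (1 + norm x) ^ (CARD('n) + 2)"
    using heat_limit_polynomial_bound[OF f h] by blast
  have fi: "exp_integrable f"
    using f by (simp add: heat_osc_def)
  have [measurable]: "h \<in> borel_measurable lebesgue" "f \<in> borel_measurable lebesgue"
    using fi h by (auto simp: heat_limit_def exp_integrable_def)
  note [measurable] = heat_measurable[OF this(2)]
  let ?D = "\<lambda>x. (heat 1 f x - h x) - (heat 1 f 0 - h 0)"
  have D: "exp_integrable ?D"
  proof (rule exp_integrable_if_polynomial_bound)
    show "norm (?D x) \<le> B * (1 + norm x) ^ (CARD('n) + 2)" for x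
      using B[of 1 x] by simp
  qed measurable
  have "exp_integrable (\<lambda>x. (heat 1 f x - ?D x) - (heat 1 f 0 - h 0))"
    by (rule exp_integrable_diff[OF exp_integrable_diff[OF exp_integrable_heat[OF fi] D] exp_integrable_const]) simp
  also have "(\<lambda>x. (heat 1 f x - ?D x) - (heat 1 f 0 - h 0)) = h"
    by (rule ext) simp
  finally show ?thesis .
qed

text \<open>Like \<open>heat_osc\<close>, a real form of a norm bound by \<open>N\<close>.
  Integrability on balls is included because the integral in \<open>ball_mean\<close> would
  otherwise take its default value 0.\<close>

definition mean_osc :: "real \<Rightarrow> (real^'n \<Rightarrow> complex) \<Rightarrow> bool" where
  "mean_osc N g \<longleftrightarrow> (\<forall>x. \<forall>r>0. set_integrable lebesgue (ball x r) g) \<and> 0 \<le> N \<and>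
     (\<forall>x. \<forall>r>0. (\<integral>\<^sup>+y\<in>ball x r. ennreal (norm (g y - ball_mean g x r)) \<partial>lebesgue) \<le> ennreal (N * \<psi> x r))"

lemma mean_osc_measurable: "mean_osc N g \<Longrightarrow> g \<in> borel_measurable lebesgue"
  by (rule measurable_if_locally_integrable) (simp add: mean_osc_def)

text \<open>The means over the two balls are compared in one step: restricting the oscillation on
  the large ball to the small one bounds their difference by \<open>N * \<psi> x R\<close> divided
  by the small volume. Integration over the large ball turns this into order n, and doubling adds n
  + 1.\<close>

lemma mean_osc_growth:
  assumes g: "mean_osc N g" and "0 < r"
  shows "ball_growth (2 * CARD('n) + 1) (2 * K * N * \<psi> x r) (\<lambda>y. g y - ball_mean g x r) x r"
  unfolding ball_growth_def
proof (intro conjI allI impI)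
  have [measurable]: "g \<in> borel_measurable lebesgue"
    using g by (rule mean_osc_measurable)
  show "(\<lambda>y. g y - ball_mean g x r) \<in> borel_measurable lebesgue"
    by measurable
  fix R assume "r \<le> R"
  let ?n = "CARD('n)"
  let ?V = "unit_ball_vol CARD('n)"
  have "?V > 0" and "?V \<noteq> 0"
    using unit_ball_vol_pos[of "CARD('n)"] by linarith+
  have "0 \<le> N" using g by (simp add: mean_osc_def)
  have "0 < R" using \<open>0 < r\<close> \<open>r \<le> R\<close> by simp
  let ?c = "ball_mean g x R" and ?c' = "ball_mean g x r"
  let ?b = "N * \<psi> x R"
  have "0 \<le> ?b" using \<open>0 \<le> N\<close> gauge_nonneg by simp
  have R: "(\<integral>\<^sup>+y\<in>ball x R. ennreal (norm (g y - ?c)) \<partial>lebesgue) \<le> ennreal ?b"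
    using g \<open>0 < R\<close> unfolding mean_osc_def by blast
  have "(\<integral>\<^sup>+y\<in>ball x r. ennreal (norm (g y - ?c)) \<partial>lebesgue) \<le> (\<integral>\<^sup>+y\<in>ball x R. ennreal (norm (g y - ?c)) \<partial>lebesgue)"
    using \<open>r \<le> R\<close> by (intro nn_integral_mono) (auto split: split_indicator)
  then have "norm (?c' - ?c) * (?V * r ^ ?n) \<le> ?b"
    using g \<open>0 < r\<close> R \<open>0 \<le> ?b\<close> by (intro ball_mean_diff_bound) (auto simp: mean_osc_def)
  then have cc: "norm (?c' - ?c) \<le> ?b / (?V * r ^ ?n)"
    using \<open>?V > 0\<close> \<open>0 < r\<close> by (subst pos_le_divide_eq) auto
  have "(\<integral>\<^sup>+y\<in>ball x R. ennreal (norm (g y - ?c')) \<partial>lebesgue)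
      \<le> ennreal (?b + ?b / (?V * r ^ ?n) * (?V * R ^ ?n))"
  proof (rule ball_integral_add_const[OF _ _ _ _ _ _ R])
    fix y
    show "norm (g y - ?c') \<le> norm (g y - ?c) + ?b / (?V * r ^ ?n)"
      using norm_triangle_ineq4[of "g y - ?c" "?c' - ?c"] cc by simp
  qed (use \<open>0 \<le> ?b\<close> \<open>0 < r\<close> \<open>0 < R\<close> \<open>?V > 0\<close> in auto)
  also have "?b / (?V * r ^ ?n) * (?V * R ^ ?n) = (R / r) ^ ?n * ?b"
    using \<open>?V \<noteq> 0\<close> \<open>0 < r\<close> by (simp add: power_divide)
  also have "?b + (R / r) ^ ?n * ?b = (1 + (R / r) ^ ?n) * ?b"
    by (simp only: distrib_right mult_1)
  also have "\<dots> \<le> (2 * (R / r) ^ ?n) * (N * (K * (R / r) ^ (?n + 1) * \<psi> x r))"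
  proof (intro mult_mono mult_left_mono gauge_doubling_power)
    have "1 \<le> (R / r) ^ ?n"
      using \<open>0 < r\<close> \<open>r \<le> R\<close> by (intro one_le_power) simp
    then show "1 + (R / r) ^ ?n \<le> 2 * (R / r) ^ ?n" by simp
  qed (use \<open>0 < r\<close> \<open>r \<le> R\<close> \<open>0 \<le> N\<close> gauge_nonneg in auto)
  also have "\<dots> = 2 * K * N * \<psi> x r * (R / r) ^ (2 * ?n + 1)"
    by (simp only: mult_2[of "CARD('n)"] mult_2_right[of "CARD('n)"] power_add power_one_right mult_ac)
  finally show "(\<integral>\<^sup>+y\<in>ball x R. ennreal (norm (g y - ?c')) \<partial>lebesgue) \<le> ennreal (2 * K * N * \<psi> x r * (R / r) ^ (2 * ?n + 1))"
    by (simp add: ennreal_leI)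
qed

lemma mean_osc_exp_integrable:
  assumes g: "mean_osc N g"
  shows "exp_integrable g"
proof -
  have "0 \<le> N" using g by (simp add: mean_osc_def)
  then have "exp_integrable (\<lambda>y. g y - ball_mean g 0 1)"
    using gauge_nonneg K_ge_1 by (intro exp_integrable_if_growth[OF mean_osc_growth[OF g]]) auto
  from exp_integrable_add[OF this exp_integrable_const[of "ball_mean g 0 1"]] show ?thesis
    by simp
qed

lemma heat_sub_const:
  assumes "exp_integrable g" "0 < s"
  shows "heat s (\<lambda>y. g y - c) x = heat s g x - c"
  using heat_diff[OF assms(1) exp_integrable_const assms(2)] heat_const[OF assms(2)] by simp

text \<open>Constants are heat fixed, so \<open>g - heat (r^2) g\<close> is \<open>g - c\<close>
  minus its heat extension, with \<open>c\<close> the mean over the ball. The first part is the mean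
  oscillation; the second is bounded at every point of the ball by recentring the growth of
  \<open>g - c\<close> there.\<close>

lemma heat_osc_if_mean_osc: "\<exists>C>0. \<forall>N g. mean_osc N g \<longrightarrow> heat_osc (C * N) g"
proof -
  let ?n = "CARD('n)" and ?M = "2 * CARD('n) + 1"
  let ?V = "unit_ball_vol CARD('n)"
  obtain C where "C > 0" and C: "\<And>s F x A. 0 < s \<Longrightarrow> 0 \<le> A \<Longrightarrow> exp_integrable F \<Longrightarrow>
     ball_growth ?M A F (x :: real^'n) (sqrt s) \<Longrightarrow> norm (heat s F x) \<le> C * A / sqrt s ^ ?n"
    using heat_growth_bound[where 'n = 'n, of ?M] by blast
  \<comment> \<open>The 1 stands for the mean oscillation itself. The rest is the pointwise bound
    times the volume, with \<open>2 ^ ?M\<close> from recentring and \<open>2 * K\<close> from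
    \<open>mean_osc_growth\<close>.\<close>
  define D where "D = 1 + C * 2 ^ ?M * (2 * K) * ?V"
  have "D > 0" using \<open>C > 0\<close> K_ge_1 by (simp add: D_def add_pos_nonneg)
  have "heat_osc (D * N) g" if g: "mean_osc N g" for N g
    unfolding heat_osc_def
  proof (intro conjI allI impI)
    show gi: "exp_integrable g" using g by (rule mean_osc_exp_integrable)
    have "0 \<le> N" using g by (simp add: mean_osc_def)
    then show "0 \<le> D * N" using \<open>D > 0\<close> by simp
    have [measurable]: "g \<in> borel_measurable lebesgue"
      using g by (rule mean_osc_measurable)
    fix x r assume "(0::real) < r"
    let ?c = "ball_mean g x r"
    let ?A = "2 * K * N * \<psi> x r"
    let ?E = "C * (2 ^ ?M * ?A) / r ^ ?n"
    have "0 \<le> ?A" using K_ge_1 \<open>0 \<le> N\<close> gauge_nonneg by simp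
    have "(\<integral>\<^sup>+y\<in>ball x r. ennreal (norm (g y - heat (r\<^sup>2) g y)) \<partial>lebesgue)
        \<le> ennreal (N * \<psi> x r + ?E * (?V * r ^ ?n))"
    proof (rule ball_integral_add_const)
      show "(\<integral>\<^sup>+y\<in>ball x r. ennreal (norm (g y - ?c)) \<partial>lebesgue) \<le> ennreal (N * \<psi> x r)"
        using g \<open>0 < r\<close> by (simp add: mean_osc_def)
      fix y assume "y \<in> ball x r"
      have "norm (heat (r\<^sup>2) (\<lambda>y. g y - ?c) y) \<le> C * (2 ^ ?M * ?A) / sqrt (r\<^sup>2) ^ ?n"
      proof (rule C)
        show "ball_growth ?M (2 ^ ?M * ?A) (\<lambda>y. g y - ?c) y (sqrt (r\<^sup>2))"
          using \<open>y \<in> ball x r\<close> \<open>0 < r\<close> \<open>0 \<le> ?A\<close> ball_growth_shift[OF mean_osc_growth[OF g \<open>0 < r\<close>], of x y]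
          by simp
      qed (use gi \<open>0 < r\<close> \<open>0 \<le> ?A\<close> in \<open>auto intro!: exp_integrable_diff exp_integrable_const\<close>)
      then have "norm (heat (r\<^sup>2) g y - ?c) \<le> ?E"
        using \<open>0 < r\<close> gi by (simp add: heat_sub_const)
      then show "norm (g y - heat (r\<^sup>2) g y) \<le> norm (g y - ?c) + ?E"
        using norm_triangle_ineq4[of "g y - ?c" "heat (r\<^sup>2) g y - ?c"] by simp
    qed (use \<open>0 \<le> N\<close> \<open>0 < r\<close> \<open>C > 0\<close> \<open>0 \<le> ?A\<close> gauge_nonneg in auto)
    also have "N * \<psi> x r + ?E * (?V * r ^ ?n) = D * N * \<psi> x r"
      using \<open>0 < r\<close> by (simp add: D_def algebra_simps)
    finally show "(\<integral>\<^sup>+y\<in>ball x r. ennreal (norm (g y - heat (r\<^sup>2) g y)) \<partial>lebesgue) \<le> ennreal (D * N * \<psi> x r)" .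
  qed
  with \<open>D > 0\<close> show ?thesis by blast
qed

text \<open>As soon as \<open>dist x y \<le> sqrt s\<close>, the same mean can be subtracted at both
  points and the growth about \<open>x\<close> recentred at \<open>y\<close>. The Lipschitz estimate
  then bounds the difference of values by a multiple of \<open>gauge_ratio x s\<close>, which tends
  to 0.\<close>

lemma mean_osc_heat_limit_0:
  assumes g: "mean_osc N g"
  shows "heat_limit g (\<lambda>_. 0)"
  unfolding heat_limit_def
proof (intro conjI allI)
  fix x y :: "real^'n"
  let ?n = "CARD('n)" and ?M = "2 * CARD('n) + 1"
  obtain C where "C > 0" and C: "\<And>s F x y A B. 0 < s \<Longrightarrow> 0 \<le> A \<Longrightarrow> 0 \<le> B \<Longrightarrow> exp_integrable F \<Longrightarrow>
     ball_growth ?M A F (x :: real^'n) (sqrt s) \<Longrightarrow> ball_growth ?M B F y (sqrt s) \<Longrightarrow>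
     norm (heat s F x - heat s F y) \<le> C * norm (x - y) * (A + B) / sqrt s ^ (?n + 1)"
    using heat_growth_lipschitz[where 'n = 'n, of ?M] by blast
  have gi: "exp_integrable g" and "0 \<le> N"
    using g mean_osc_exp_integrable by (auto simp: mean_osc_def)
  let ?c = "C * norm (x - y) * (1 + 2 ^ ?M) * (2 * K * N)"
  have bound: "norm (heat s g x - heat s g y) \<le> ?c * gauge_ratio x s"
    if "1 \<le> s" "(dist x y)\<^sup>2 \<le> s" for s
  proof -
    have "dist x y \<le> sqrt s"
      using that real_le_rsqrt by blast
    let ?A = "2 * K * N * \<psi> x (sqrt s)"
    let ?F = "\<lambda>z. g z - ball_mean g x (sqrt s)"
    have "0 \<le> ?A" using K_ge_1 \<open>0 \<le> N\<close> gauge_nonneg by simp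
    have growth: "ball_growth ?M ?A ?F x (sqrt s)"
      using that by (intro mean_osc_growth g) auto
    have "norm (heat s ?F x - heat s ?F y) \<le> C * norm (x - y) * (?A + 2 ^ ?M * ?A) / sqrt s ^ (?n + 1)"
      using that \<open>0 \<le> ?A\<close> \<open>dist x y \<le> sqrt s\<close>
      by (intro C growth ball_growth_shift[OF growth] exp_integrable_diff exp_integrable_const gi) auto
    also have "?A + 2 ^ ?M * ?A = (1 + 2 ^ ?M) * ?A"
      by (simp only: distrib_right mult_1)
    finally show ?thesis
      using that gi by (simp add: heat_sub_const gauge_ratio_def mult.assoc)
  qed
  have "((\<lambda>s. ?c * gauge_ratio x s) \<longlongrightarrow> ?c * 0) at_top"
    by (intro tendsto_intros gauge_ratio_tendsto_0)
  then have lim: "((\<lambda>m. ?c * gauge_ratio x (real m)) \<longlongrightarrow> 0) sequentially"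
    using filterlim_compose[OF _ filterlim_real_sequentially, of "\<lambda>s. ?c * gauge_ratio x s"] by simp
  obtain k where k: "(dist x y)\<^sup>2 + 1 \<le> real k"
    using real_arch_simple by blast
  have "(\<lambda>m. heat (real m) g x - heat (real m) g y) \<longlonglongrightarrow> 0"
  proof (rule Lim_null_comparison[OF _ lim])
    show "\<forall>\<^sub>F m in sequentially. norm (heat (real m) g x - heat (real m) g y) \<le> ?c * gauge_ratio x (real m)"
      using eventually_ge_at_top[of k]
    proof eventually_elim
      case (elim m)
      then have "(dist x y)\<^sup>2 + 1 \<le> real m" using k by simp
      then show ?case
        using zero_le_power2[of "dist x y"] by (intro bound) linarith+
    qed
  qed
  then show "(\<lambda>m. heat (real m) g x - heat (real m) g y) \<longlonglongrightarrow> 0 - 0" by simp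
qed simp

text \<open>On \<open>ball x r\<close> the function \<open>f - h\<close> is compared with the
  constant \<open>heat (r^2) f x - h x\<close>. The error is \<open>f - heat (r^2) f\<close> plus a
  difference of values of \<open>heat (r^2) f - h\<close> at points less than \<open>r\<close>
  apart, to which \<open>heat_limit_bound\<close> applies.\<close>

lemma mean_osc_if_heat_osc:
  "\<exists>C>0. \<forall>N f h. heat_osc N f \<longrightarrow> heat_limit f h \<longrightarrow> mean_osc (C * N) (\<lambda>x. f x - h x)"
proof -
  let ?n = "CARD('n)"
  let ?V = "unit_ball_vol CARD('n)"
  obtain C where "C > 0" and C: "\<And>N f h s x y. heat_osc N f \<Longrightarrow> heat_limit f h \<Longrightarrow> 0 < s \<Longrightarrow>
     norm ((heat s f x - h x) - (heat s f y - h y)) \<le> C * N * norm (x - y) * (gauge_ratio x s + gauge_ratio y s)"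
    using heat_limit_bound by blast
  \<comment> \<open>\<open>K * 2 ^ (n + 1)\<close> compares the gauge at a point \<open>y\<close> of
    the ball with that at \<open>x\<close>, as \<open>ball y r\<close> lies in
    \<open>ball x (2 * r)\<close>; the 1 is the gauge at \<open>x\<close>. The factor 2 in
    \<open>E\<close> below pays for passing from the comparison constant to the mean.\<close>
  define D where "D = C * (K * 2 ^ (?n + 1) + 1)"
  have "D > 0" using \<open>C > 0\<close> K_ge_1 by (simp add: D_def add_nonneg_pos)
  define E where "E = 2 * (1 + D * ?V)"
  have "E > 0" using \<open>D > 0\<close> by (simp add: E_def add_pos_nonneg)
  have "mean_osc (E * N) (\<lambda>x. f x - h x)" if f: "heat_osc N f" and h: "heat_limit f h" for N f h
    unfolding mean_osc_def
  proof (intro conjI allI impI)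
    have fi: "exp_integrable f" and "0 \<le> N"
      using f by (auto simp: heat_osc_def)
    have hi: "exp_integrable h"
      using f h by (rule heat_limit_exp_integrable)
    let ?g = "\<lambda>x. f x - h x"
    have gi: "exp_integrable ?g"
      using fi hi by (rule exp_integrable_diff)
    have [measurable]: "f \<in> borel_measurable lebesgue" "h \<in> borel_measurable lebesgue"
      using fi hi by (auto simp: exp_integrable_def)
    note [measurable] = heat_measurable[OF this(1)]
    show set_int: "set_integrable lebesgue (ball x r) ?g" for x r
      by (rule exp_integrable_locally[OF gi]) auto
    show "0 \<le> E * N" using \<open>E > 0\<close> \<open>0 \<le> N\<close> by simp
    fix x :: "real^'n" and r :: real assume "0 < r"
    let ?c = "heat (r\<^sup>2) f x - h x"
    let ?Q = "D * N * \<psi> x r / r ^ ?n"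
    let ?b = "N * \<psi> x r + ?Q * (?V * r ^ ?n)"
    have "0 \<le> ?Q" using \<open>D > 0\<close> \<open>0 \<le> N\<close> \<open>0 < r\<close> gauge_nonneg by simp
    have "0 \<le> ?b"
      using \<open>0 \<le> ?Q\<close> \<open>0 \<le> N\<close> \<open>0 < r\<close> gauge_nonneg
      by (intro add_nonneg_nonneg mult_nonneg_nonneg[of ?Q]) auto
    have 1: "(\<integral>\<^sup>+y\<in>ball x r. ennreal (norm (?g y - ?c)) \<partial>lebesgue) \<le> ennreal ?b"
    proof (rule ball_integral_add_const)
      show "(\<integral>\<^sup>+y\<in>ball x r. ennreal (norm (f y - heat (r\<^sup>2) f y)) \<partial>lebesgue) \<le> ennreal (N * \<psi> x r)"
        using f \<open>0 < r\<close> by (simp add: heat_osc_def)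
      fix y assume y: "y \<in> ball x r"
      have "ball y r \<subseteq> ball x (2 * r)"
        using y by (simp add: ball_subset_ball_iff dist_commute)
      then have "\<psi> y r \<le> \<psi> x (2 * r)"
        using \<open>0 < r\<close> by (intro gauge_mono)
      also have "\<dots> \<le> K * 2 ^ (?n + 1) * \<psi> x r"
        using gauge_doubling_power[of r "2 * r" x] \<open>0 < r\<close> by simp
      finally have "gauge_ratio y (r\<^sup>2) + gauge_ratio x (r\<^sup>2) \<le> (K * 2 ^ (?n + 1) * \<psi> x r + \<psi> x r) / r ^ (?n + 1)"
        unfolding gauge_ratio_def add_divide_distrib using \<open>0 < r\<close> by (simp add: divide_right_mono)
      moreover have "norm (y - x) \<le> r"
        using y by (simp add: dist_norm norm_minus_commute)
      ultimately have "C * N * norm (y - x) * (gauge_ratio y (r\<^sup>2) + gauge_ratio x (r\<^sup>2))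
          \<le> C * N * r * ((K * 2 ^ (?n + 1) * \<psi> x r + \<psi> x r) / r ^ (?n + 1))"
        using \<open>C > 0\<close> \<open>0 \<le> N\<close> \<open>0 < r\<close> gauge_ratio_nonneg[of "r\<^sup>2"]
        by (intro mult_mono[OF mult_left_mono]) auto
      also have "K * 2 ^ (?n + 1) * \<psi> x r + \<psi> x r = (K * 2 ^ (?n + 1) + 1) * \<psi> x r"
        by (simp only: distrib_right mult_1)
      also have "C * N * r * ((K * 2 ^ (?n + 1) + 1) * \<psi> x r / r ^ (?n + 1)) = ?Q"
        using \<open>0 < r\<close> by (simp add: D_def)
      finally have "norm ((heat (r\<^sup>2) f y - h y) - ?c) \<le> ?Q"
        using C[OF f h, of "r\<^sup>2" y x] \<open>0 < r\<close> by simp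
      moreover have "?g y - ?c = (f y - heat (r\<^sup>2) f y) + ((heat (r\<^sup>2) f y - h y) - ?c)"
        by simp
      ultimately show "norm (?g y - ?c) \<le> norm (f y - heat (r\<^sup>2) f y) + ?Q"
        using norm_triangle_ineq[of "f y - heat (r\<^sup>2) f y" "(heat (r\<^sup>2) f y - h y) - ?c"]
        by (simp only:)
    qed (use \<open>0 \<le> N\<close> \<open>0 < r\<close> \<open>0 \<le> ?Q\<close> gauge_nonneg in auto)
    have "(\<integral>\<^sup>+y\<in>ball x r. ennreal (norm (?g y - ball_mean ?g x r)) \<partial>lebesgue)
        \<le> ennreal (?b + norm (ball_mean ?g x r - ?c) * (?V * r ^ ?n))"
    proof (rule ball_integral_add_const[OF _ _ _ _ _ _ 1])
      fix y
      show "norm (?g y - ball_mean ?g x r) \<le> norm (?g y - ?c) + norm (ball_mean ?g x r - ?c)"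
        using dist_triangle2[of "?g y" "ball_mean ?g x r" ?c] by (simp only: dist_norm)
    qed (use \<open>0 \<le> ?b\<close> \<open>0 < r\<close> in auto)
    also have "\<dots> \<le> ennreal (?b + ?b)"
      using ball_mean_diff_bound[OF set_int \<open>0 < r\<close> 1 \<open>0 \<le> ?b\<close>] by (intro ennreal_leI) simp
    also have "?Q * (?V * r ^ ?n) = D * ?V * (N * \<psi> x r)"
      using \<open>0 < r\<close> by simp
    also have "(N * \<psi> x r + D * ?V * (N * \<psi> x r)) + (N * \<psi> x r + D * ?V * (N * \<psi> x r)) = E * N * \<psi> x r"
      by (simp add: E_def distrib_right)
    finally show "(\<integral>\<^sup>+y\<in>ball x r. ennreal (norm (?g y - ball_mean ?g x r)) \<partial>lebesgue) \<le> ennreal (E * N * \<psi> x r)" .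
  qed
  with \<open>E > 0\<close> show ?thesis by blast
qed

end

section \<open>Invariance of the limit under the heat flow\<close>

lemma heat_norm_bound:
  fixes F P :: "real^'n \<Rightarrow> complex"
  assumes "exp_integrable F" "exp_integrable P" "0 < t" and le: "\<And>y. norm (F y) \<le> c * norm (P y)"
  shows "norm (heat t F x) \<le> c * (LINT y|lebesgue. norm (heat_kernel t (x - y) *\<^sub>R P y))"
proof -
  have "norm (heat t F x) \<le> (LINT y|lebesgue. norm (heat_kernel t (x - y) *\<^sub>R F y))"
    unfolding heat_eq by (rule integral_norm_bound)
  also have "\<dots> \<le> (LINT y|lebesgue. c * norm (heat_kernel t (x - y) *\<^sub>R P y))"
  proof (intro integral_mono integrable_norm integrable_mult_right integrable_heat assms)
    fix y
    show "norm (heat_kernel t (x - y) *\<^sub>R F y) \<le> c * norm (heat_kernel t (x - y) *\<^sub>R P y)"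
      using mult_left_mono[OF le[of y], of "heat_kernel t (x - y)"] by (simp add: mult_ac)
  qed
  finally show ?thesis by simp
qed

context ball_gauge
begin

text \<open>The normalised functions \<open>heat (real m) f\<close> differ from the normalised
  \<open>h\<close> by at most a null sequence times a fixed polynomial. Integrating that polynomial
  against the kernel gives the finite number \<open>Q\<close>, so \<open>heat t\<close> may be
  applied to the limit.\<close>

lemma heat_heat_limit_tendsto:
  assumes f: "heat_osc N f" and h: "heat_limit f h" and "0 < t"
  shows "(\<lambda>m. heat (t + real m) f x - heat (real m) f 0) \<longlonglongrightarrow> heat t h x - h 0"
proof -
  let ?e = "a - CARD('n) - 1"
  let ?P = "\<lambda>y :: real^'n. complex_of_real ((1 + norm y) ^ (CARD('n) + 2))"
  obtain B where "B \<ge> 0" and B: "\<And>s x. 1 \<le> s \<Longrightarrow> norm ((heat s f x - h x) - (heat s f 0 - h 0))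
    \<le> B * sqrt s powr ?e * (1 + norm x) ^ (CARD('n) + 2)"
    using heat_limit_polynomial_bound[OF f h] by blast
  have fi: "exp_integrable f" using f by (simp add: heat_osc_def)
  have hi: "exp_integrable h" using f h by (rule heat_limit_exp_integrable)
  have norm_P: "norm (?P y) = (1 + norm y) ^ (CARD('n) + 2)" for y
    by (subst norm_of_real) simp
  have "?P \<in> borel_measurable lebesgue" by measurable
  then have Pi: "exp_integrable ?P"
    by (rule exp_integrable_if_polynomial_bound[of _ 1 "CARD('n) + 2"]) (simp only: norm_P mult_1 order_refl)
  define Q where "Q = (LINT y|lebesgue. norm (heat_kernel t (x - y) *\<^sub>R ?P y))"
  have bound: "norm ((heat (t + real m) f x - heat (real m) f 0) - (heat t h x - h 0)) \<le> B * Q * sqrt (real m) powr ?e"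
    if "1 \<le> m" for m
  proof -
    let ?c = "heat (real m) f 0 - h 0"
    let ?E = "\<lambda>y. (heat (real m) f y - h y) - ?c"
    have mi: "exp_integrable (heat (real m) f)"
      using fi that by (intro exp_integrable_heat) auto
    note di = exp_integrable_diff[OF mi hi]
    have "norm (heat t ?E x) \<le> B * sqrt (real m) powr ?e * Q"
      unfolding Q_def
    proof (rule heat_norm_bound[OF exp_integrable_diff[OF di exp_integrable_const] Pi \<open>0 < t\<close>])
      fix y
      show "norm (?E y) \<le> B * sqrt (real m) powr ?e * norm (?P y)"
        unfolding norm_P using that by (intro B) simp
    qed
    also have "heat t ?E x = (heat (t + real m) f x - heat t h x) - ?c"
      using fi that \<open>0 < t\<close> by (simp add: heat_sub_const[OF di] heat_diff[OF mi hi] heat_semigroup)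
    finally show ?thesis
      by (simp add: algebra_simps)
  qed
  have "((\<lambda>s. sqrt s powr ?e) \<longlongrightarrow> 0) at_top"
    using a_less by (intro tendsto_neg_powr sqrt_at_top) auto
  from filterlim_compose[OF this filterlim_real_sequentially]
  have "((\<lambda>m. B * Q * sqrt (real m) powr ?e) \<longlongrightarrow> 0) sequentially"
    by (rule tendsto_mult_right_zero)
  then have "(\<lambda>m. (heat (t + real m) f x - heat (real m) f 0) - (heat t h x - h 0)) \<longlonglongrightarrow> 0"
  proof (rule Lim_null_comparison[rotated])
    show "\<forall>\<^sub>F m in sequentially. norm ((heat (t + real m) f x - heat (real m) f 0) - (heat t h x - h 0))
        \<le> B * Q * sqrt (real m) powr ?e"
      using eventually_ge_at_top[of 1] by eventually_elim (rule bound)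
  qed
  then show ?thesis
    by (simp add: LIM_zero_iff)
qed

text \<open>The difference of the values of \<open>heat (t + real m) f\<close> at \<open>x\<close>
  and 0 has two limits: one by applying \<open>heat t\<close> to the convergence, the other by the
  bound at time \<open>t + real m\<close>. That time may fail to be an integer, so the second limit
  rests on the estimate for all real \<open>s \<ge> 1\<close>.\<close>

lemma heat_limit_shift:
  assumes f: "heat_osc N f" and h: "heat_limit f h" and "0 < t"
  shows "heat t h x = h x + (heat t h 0 - h 0)"
proof -
  let ?e = "a - CARD('n) - 1"
  obtain B where "B \<ge> 0" and B: "\<And>s x. 1 \<le> s \<Longrightarrow> norm ((heat s f x - h x) - (heat s f 0 - h 0))
    \<le> B * sqrt s powr ?e * (1 + norm x) ^ (CARD('n) + 2)"
    using heat_limit_polynomial_bound[OF f h] by blast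
  have 1: "(\<lambda>m. heat (t + real m) f x - heat (t + real m) f 0) \<longlonglongrightarrow> heat t h x - heat t h 0"
    using tendsto_diff[OF heat_heat_limit_tendsto[OF assms, of x] heat_heat_limit_tendsto[OF assms, of 0]] by simp
  have "((\<lambda>s. sqrt s powr ?e) \<longlongrightarrow> 0) at_top"
    using a_less by (intro tendsto_neg_powr sqrt_at_top) auto
  moreover have "filterlim (\<lambda>m. t + real m) at_top sequentially"
    by (intro filterlim_tendsto_add_at_top[OF tendsto_const] filterlim_real_sequentially)
  ultimately have "((\<lambda>m. sqrt (t + real m) powr ?e) \<longlongrightarrow> 0) sequentially"
    by (rule filterlim_compose)
  then have "((\<lambda>m. B * sqrt (t + real m) powr ?e * (1 + norm x) ^ (CARD('n) + 2)) \<longlongrightarrow> 0) sequentially"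
    by (intro tendsto_mult_left_zero tendsto_mult_right_zero)
  then have "(\<lambda>m. (heat (t + real m) f x - h x) - (heat (t + real m) f 0 - h 0)) \<longlonglongrightarrow> 0"
  proof (rule Lim_null_comparison[rotated])
    show "\<forall>\<^sub>F m in sequentially. norm ((heat (t + real m) f x - h x) - (heat (t + real m) f 0 - h 0))
        \<le> B * sqrt (t + real m) powr ?e * (1 + norm x) ^ (CARD('n) + 2)"
      using eventually_ge_at_top[of 1] by eventually_elim (use \<open>0 < t\<close> in \<open>intro B, simp\<close>)
  qed
  then have "(\<lambda>m. (heat (t + real m) f x - heat (t + real m) f 0) - (h x - h 0)) \<longlonglongrightarrow> 0"
    by (simp add: algebra_simps)
  then have "(\<lambda>m. heat (t + real m) f x - heat (t + real m) f 0) \<longlonglongrightarrow> h x - h 0"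
    by (simp add: LIM_zero_iff)
  then have "heat t h x - heat t h 0 = h x - h 0"
    using 1 LIMSEQ_unique by blast
  then show ?thesis by (simp add: algebra_simps)
qed

text \<open>By the previous lemma \<open>heat t h = h + c t\<close> with \<open>c\<close> additive. Since both \<open>f\<close> and \<open>f - h\<close>
  have controlled heat oscillation, so does \<open>h\<close>, whence \<open>c (r\<^sup>2) = O(r powr (a - n))\<close>; as
  \<open>a - n < 1\<close>, the linear growth of \<open>c\<close> forces \<open>c = 0\<close>.\<close>
lemma heat_limit_fixed:
  assumes f: "heat_osc N f" and h: "heat_limit f h" and "0 < t"
  shows "heat t h x = h x"
proof -
  let ?n = "CARD('n)" and ?V = "unit_ball_vol CARD('n)"
  have "?V > 0" and "?V \<noteq> 0"
    using unit_ball_vol_pos[of "CARD('n)"] by linarith+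
  have fi: "exp_integrable f" and "0 \<le> N" using f by (auto simp: heat_osc_def)
  have hi: "exp_integrable h" using f h by (rule heat_limit_exp_integrable)
  define c where "c s = heat s h 0 - h 0" for s
  have shift: "heat s h y = h y + c s" if "0 < s" for s y
    unfolding c_def using heat_limit_shift[OF f h that] .
  have add: "c (s + s') = c s + c s'" if "0 < s" "0 < s'" for s s'
  proof -
    have "heat (s + s') h 0 = heat s (heat s' h) 0"
      using hi that by (rule heat_semigroup[symmetric])
    also have "heat s' h = (\<lambda>y. h y - (- c s'))"
      using shift[OF that(2)] by (simp add: fun_eq_iff)
    also have "heat s (\<lambda>y. h y - (- c s')) 0 = heat s h 0 + c s'"
      using heat_sub_const[OF hi that(1), of "- c s'" 0] by simp
    finally show ?thesis by (simp add: c_def)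
  qed
  have c_mult: "c (real (Suc k) * t) = real (Suc k) *\<^sub>R c t" for k
  proof (induction k)
    case (Suc k)
    have "c (real (Suc (Suc k)) * t) = c (real (Suc k) * t + t)"
      by (simp add: algebra_simps)
    also have "\<dots> = c (real (Suc k) * t) + c t"
      using \<open>0 < t\<close> by (intro add) (auto simp: add_pos_nonneg)
    also have "\<dots> = real (Suc (Suc k)) *\<^sub>R c t"
      unfolding Suc.IH by (simp add: scaleR_conv_of_real algebra_simps)
    finally show ?case .
  qed simp
  obtain C\<^sub>1 where C1: "mean_osc (C\<^sub>1 * N) (\<lambda>x. f x - h x)"
    using mean_osc_if_heat_osc f h by blast
  then obtain C\<^sub>2 where "heat_osc (C\<^sub>2 * (C\<^sub>1 * N)) (\<lambda>x. f x - h x)"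
    using heat_osc_if_mean_osc by blast
  then obtain N' where N': "heat_osc N' (\<lambda>x. f x - h x)" by blast
  let ?g = "\<lambda>x. f x - h x"
  have gi: "exp_integrable ?g" and "0 \<le> N'" using N' by (auto simp: heat_osc_def)
  have c_bound: "norm (c (r\<^sup>2)) * (?V * r ^ ?n) \<le> (N + N') * \<psi> 0 r" if "0 < r" for r
  proof -
    have [measurable]: "f \<in> borel_measurable lebesgue" "?g \<in> borel_measurable lebesgue"
      using fi gi by (auto simp: exp_integrable_def)
    note [measurable] = heat_measurable[OF this(1)] heat_measurable[OF this(2)]
    have [measurable]: "ball 0 r \<in> sets (lebesgue :: (real^'n) measure)" by simp
    have "ennreal (norm (c (r\<^sup>2)) * (?V * r ^ ?n)) = (\<integral>\<^sup>+y\<in>ball (0::real^'n) r. ennreal (norm (c (r\<^sup>2))) \<partial>lebesgue)"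
      using that by (subst nn_integral_cmult_indicator) (auto simp: emeasure_ball ennreal_mult')
    also have "\<dots> \<le> (\<integral>\<^sup>+y. ennreal (norm (f y - heat (r\<^sup>2) f y)) * indicator (ball 0 r) y
        + ennreal (norm (?g y - heat (r\<^sup>2) ?g y)) * indicator (ball 0 r) y \<partial>lebesgue)"
    proof (intro nn_integral_mono)
      fix y
      have "c (r\<^sup>2) = (?g y - heat (r\<^sup>2) ?g y) - (f y - heat (r\<^sup>2) f y)"
        using that by (simp add: heat_diff[OF fi hi] shift)
      then have "norm (c (r\<^sup>2)) \<le> norm (?g y - heat (r\<^sup>2) ?g y) + norm (f y - heat (r\<^sup>2) f y)"
        by (simp only: norm_triangle_ineq4)
      then show "ennreal (norm (c (r\<^sup>2))) * indicator (ball 0 r) y \<le> ennreal (norm (f y - heat (r\<^sup>2) f y)) * indicator (ball 0 r) y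
        + ennreal (norm (?g y - heat (r\<^sup>2) ?g y)) * indicator (ball 0 r) y"
        by (auto simp flip: ennreal_plus intro!: ennreal_leI split: split_indicator)
    qed
    also have "\<dots> = (\<integral>\<^sup>+y\<in>ball 0 r. ennreal (norm (f y - heat (r\<^sup>2) f y)) \<partial>lebesgue)
        + (\<integral>\<^sup>+y\<in>ball 0 r. ennreal (norm (?g y - heat (r\<^sup>2) ?g y)) \<partial>lebesgue)"
      by (rule nn_integral_add) measurable
    also have "\<dots> \<le> ennreal (N * \<psi> 0 r) + ennreal (N' * \<psi> 0 r)"
      using f N' that unfolding heat_osc_def by (intro add_mono) blast+
    also have "\<dots> = ennreal ((N + N') * \<psi> 0 r)"
      using \<open>0 \<le> N\<close> \<open>0 \<le> N'\<close> gauge_nonneg by (subst ennreal_plus[symmetric]) (auto simp: distrib_right)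
    finally show ?thesis
      using \<open>0 \<le> N\<close> \<open>0 \<le> N'\<close> gauge_nonneg by (subst (asm) ennreal_le_iff) auto
  qed
  let ?D = "(N + N') * t / ?V"
  have "norm (c t) \<le> ?D * gauge_ratio 0 (real (Suc k) * t)" if "1 \<le> real (Suc k) * t" for k
  proof -
    define r where "r = sqrt (real (Suc k) * t)"
    have "0 < real (Suc k) * t" using that by linarith
    then have r2: "r\<^sup>2 = real (Suc k) * t" and "0 < r"
      by (auto simp: r_def)
    have "1 \<le> r" using that by (simp add: r_def del: of_nat_Suc)
    have "norm (c (r\<^sup>2)) = (r\<^sup>2 / t) * norm (c t)"
      using \<open>0 < t\<close> by (simp add: r2 c_mult del: of_nat_Suc)
    then have "(r\<^sup>2 / t) * norm (c t) * (?V * r ^ ?n) \<le> (N + N') * \<psi> 0 r"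
      using c_bound[OF \<open>0 < r\<close>] by simp
    moreover have "(r\<^sup>2 / t) * norm (c t) * (?V * r ^ ?n) = (norm (c t) * r) * (?V * r ^ (?n + 1) / t)"
      by (simp add: power2_eq_square)
    ultimately have "(norm (c t) * r) * (?V * r ^ (?n + 1) / t) \<le> (N + N') * \<psi> 0 r"
      by (simp only:)
    moreover have "0 < ?V * r ^ (?n + 1) / t"
      using \<open>0 < t\<close> \<open>0 < r\<close> \<open>?V > 0\<close> by simp
    ultimately have "norm (c t) * r \<le> (N + N') * \<psi> 0 r / (?V * r ^ (?n + 1) / t)"
      by (subst pos_le_divide_eq)
    then have "norm (c t) * r \<le> ?D * (\<psi> 0 r / r ^ (?n + 1))"
      by (simp add: mult.commute mult.left_commute)
    \<comment> \<open>Linear growth of \<open>c\<close> supplies two powers of \<open>r\<close>. One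
      completes \<open>r ^ n\<close> to the denominator of \<open>gauge_ratio\<close>; the other is
      at least 1 and is dropped.\<close>
    moreover have "norm (c t) * 1 \<le> norm (c t) * r"
      using \<open>1 \<le> r\<close> by (intro mult_left_mono) auto
    ultimately show ?thesis
      by (simp add: gauge_ratio_def r_def del: of_nat_Suc)
  qed
  note bound = this
  have lim: "filterlim (\<lambda>k. real (Suc k) * t) at_top sequentially"
  proof (rule filterlim_at_top_mult_tendsto_pos[OF tendsto_const \<open>0 < t\<close>])
    show "filterlim (\<lambda>k. real (Suc k)) at_top sequentially"
      using filterlim_compose[OF filterlim_real_sequentially filterlim_Suc] .
  qed
  then have "\<forall>\<^sub>F k in sequentially. 1 \<le> real (Suc k) * t"
    unfolding filterlim_at_top by blast
  then have ev: "\<forall>\<^sub>F k in sequentially. norm (c t) \<le> ?D * gauge_ratio 0 (real (Suc k) * t)"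
    by (rule eventually_mono) (rule bound)
  from lim have "(\<lambda>k. gauge_ratio 0 (real (Suc k) * t)) \<longlonglongrightarrow> 0"
    by (rule filterlim_compose[OF gauge_ratio_tendsto_0])
  then have "(\<lambda>k. ?D * gauge_ratio 0 (real (Suc k) * t)) \<longlonglongrightarrow> 0"
    by (rule tendsto_mult_right_zero)
  then have "norm (c t) \<le> 0"
    by (rule tendsto_lowerbound[OF _ ev]) simp
  then show ?thesis
    using shift[OF \<open>0 < t\<close>] by simp
qed

end

section \<open>The gauge of a growth function\<close>

lemma ennreal_powr_top [simp]: "ennreal_powr top p = top"
  by (simp add: ennreal_powr_def)

definition ball_weight :: "(real^'n \<Rightarrow> real \<Rightarrow> real) \<Rightarrow> real^'n \<Rightarrow> real \<Rightarrow> real \<Rightarrow> ennreal" where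
  "ball_weight \<phi> x r t = (\<integral>\<^sup>+y\<in>ball x r. ennreal (\<phi> y t) \<partial>lebesgue)"

lemma nn_integral_ball_pos:
  fixes w :: "real^'n \<Rightarrow> real"
  assumes [measurable]: "w \<in> borel_measurable lebesgue" and "\<And>y. 0 < w y" "0 < r"
  shows "0 < (\<integral>\<^sup>+y\<in>ball x r. ennreal (w y) \<partial>lebesgue)"
proof -
  have [measurable]: "ball x r \<in> sets lebesgue" by simp
  have "(\<integral>\<^sup>+y\<in>ball x r. ennreal (w y) \<partial>lebesgue) \<noteq> 0"
  proof
    assume "(\<integral>\<^sup>+y\<in>ball x r. ennreal (w y) \<partial>lebesgue) = 0"
    then have "AE y in lebesgue. ennreal (w y) * indicator (ball x r) y = 0"
      by (subst (asm) nn_integral_0_iff_AE) auto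
    then have "AE y in lebesgue. y \<notin> ball x r"
      using assms(2) by (auto elim!: eventually_mono split: split_indicator_asm simp: ennreal_eq_0_iff not_le)
    then have "emeasure lebesgue (ball x r) = 0"
      by (subst (asm) AE_iff_measurable[of "ball x r"]) auto
    then show False
      using emeasure_lebesgue_ball[of r x] \<open>0 < r\<close> unit_ball_vol_pos[of "CARD('n)"] by (simp del: unit_ball_vol_pos)
  qed
  then show ?thesis by (simp add: zero_less_iff_neq_zero)
qed

lemma muckenhoupt_bound:
  fixes \<phi> :: "real^'n \<Rightarrow> real \<Rightarrow> real"
  assumes "muckenhoupt q \<phi>"
  obtains W where "0 < W" "\<And>t x r. 0 < t \<Longrightarrow> 0 < r \<Longrightarrow>
    ball_avg (\<lambda>y. ennreal (\<phi> y t)) x r *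
        (if q = 1 then esssup (lebesgue_on (ball x r)) (\<lambda>y. inverse (ennreal (\<phi> y t)))
         else ennreal_powr
                (ball_avg (\<lambda>y. ennreal (\<phi> y t powr (- 1 / (q - 1)))) x r) (q - 1)) \<le> ennreal W"
proof -
  define F where "F t x r = ball_avg (\<lambda>y. ennreal (\<phi> y t)) x r *
        (if q = 1 then esssup (lebesgue_on (ball x r)) (\<lambda>y. inverse (ennreal (\<phi> y t)))
         else ennreal_powr
                (ball_avg (\<lambda>y. ennreal (\<phi> y t powr (- 1 / (q - 1)))) x r) (q - 1))" for t x r
  let ?S = "SUP t\<in>{0<..}. SUP x. SUP r\<in>{0<..}. F t x r"
  have "?S < top" using assms unfolding muckenhoupt_def F_def .
  then have S: "?S \<le> ennreal (enn2real ?S + 1)"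
    by (subst ennreal_enn2real[symmetric]) (auto intro!: ennreal_leI)
  have "F t x r \<le> ?S" if "0 < t" "0 < r" for t x r
    by (rule SUP_upper2[of t], (use that in simp), rule SUP_upper2[of x], simp,
        rule SUP_upper2[of r], (use that in simp), rule order_refl)
  then show ?thesis
    using S that[of "enn2real ?S + 1", folded F_def] by (meson add_nonneg_pos enn2real_nonneg order.trans zero_less_one)
qed

text \<open>Let \<open>Z\<close> be the essential supremum of \<open>1 / \<phi>\<close> on the large
  ball. The volume of the small ball is at most its weight times \<open>Z\<close>, while the
  condition bounds the weight of the large ball times \<open>Z\<close> by \<open>W\<close> times its
  volume. Combining the two eliminates \<open>Z\<close>.\<close>

lemma muckenhoupt_1_doubling:
  fixes \<phi> :: "real^'n \<Rightarrow> real \<Rightarrow> real"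
  assumes "muckenhoupt 1 \<phi>" and pos: "\<And>x t. 0 < t \<Longrightarrow> 0 < \<phi> x t"
    and meas: "\<And>t. 0 < t \<Longrightarrow> (\<lambda>x. \<phi> x t) \<in> borel_measurable lebesgue"
  shows "\<exists>A. \<forall>t>0. \<forall>x. \<forall>r>0. \<forall>R\<ge>r. ball_weight \<phi> x R t < top \<and>
    ball_weight \<phi> x R t \<le> ennreal (A * (R / r) ^ CARD('n)) * ball_weight \<phi> x r t"
proof -
  obtain W where "0 < W" and W: "\<And>t x r. 0 < t \<Longrightarrow> 0 < r \<Longrightarrow>
    ball_avg (\<lambda>y. ennreal (\<phi> y t)) x r * esssup (lebesgue_on (ball x r)) (\<lambda>y. inverse (ennreal (\<phi> y t))) \<le> ennreal W"
    using muckenhoupt_bound[OF assms(1)] by auto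
  show ?thesis
  proof (intro exI[of _ W] allI impI)
    fix t r R :: real and x :: "real^'n"
    assume "0 < t" "0 < r" "r \<le> R"
    then have "0 < R" by simp
    note [measurable] = meas[OF \<open>0 < t\<close>]
    let ?V = "unit_ball_vol CARD('n)"
    have "?V > 0" and "?V \<noteq> 0"
      using unit_ball_vol_pos[of "CARD('n)"] by linarith+
    define I e \<beta> \<epsilon> Z where "I = ball_weight \<phi> x R t" and "e = ball_weight \<phi> x r t"
      and "\<beta> = ?V * R ^ CARD('n)" and "\<epsilon> = ?V * r ^ CARD('n)"
      and "Z = esssup (lebesgue_on (ball x R)) (\<lambda>y. inverse (ennreal (\<phi> y t)))"
    have "0 < \<beta>" "0 < \<epsilon>" using \<open>?V > 0\<close> \<open>0 < r\<close> \<open>0 < R\<close> by (auto simp: \<beta>_def \<epsilon>_def)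
    have [measurable]: "ball x r \<in> sets lebesgue" for r by simp
    have IZ: "I / ennreal \<beta> * Z \<le> ennreal W"
      using W[OF \<open>0 < t\<close> \<open>0 < R\<close>, of x] \<open>0 < R\<close>
      by (simp add: I_def Z_def \<beta>_def ball_weight_def ball_avg_def emeasure_ball)
    have Z: "AE y in lebesgue. y \<in> ball x R \<longrightarrow> inverse (ennreal (\<phi> y t)) \<le> Z"
      using esssup_AE[of "\<lambda>y. inverse (ennreal (\<phi> y t))" "lebesgue_on (ball x R)"]
      by (subst (asm) AE_restrict_space_iff) (auto simp: Z_def)
    have inv: "ennreal (\<phi> y t) * inverse (ennreal (\<phi> y t)) = 1" for y
      using pos[OF \<open>0 < t\<close>, of y] by (simp add: divide_ennreal_def[symmetric] ennreal_divide_self)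
    have "ennreal \<epsilon> = (\<integral>\<^sup>+y. indicator (ball x r) y \<partial>lebesgue)"
      using \<open>0 < r\<close> by (simp add: \<epsilon>_def emeasure_ball)
    also have "\<dots> \<le> (\<integral>\<^sup>+y. ennreal (\<phi> y t) * indicator (ball x r) y * Z \<partial>lebesgue)"
    proof (rule nn_integral_mono_AE)
      show "AE y in lebesgue. indicator (ball x r) y \<le> ennreal (\<phi> y t) * indicator (ball x r) y * Z"
        using Z
      proof eventually_elim
        case (elim y)
        then show ?case
          using \<open>r \<le> R\<close> inv[of y] mult_left_mono[of "inverse (ennreal (\<phi> y t))" Z "ennreal (\<phi> y t)"]
          by (auto split: split_indicator)
      qed
    qed
    also have "\<dots> = e * Z"
      unfolding e_def ball_weight_def by (rule nn_integral_multc) measurable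
    finally have eZ: "ennreal \<epsilon> \<le> e * Z" .
    have "I * ennreal \<epsilon> \<le> I * (e * Z)"
      using eZ by (rule mult_left_mono) simp
    also have "\<dots> = (I / ennreal \<beta> * Z) * (ennreal \<beta> * e)"
    proof -
      have "I = I / ennreal \<beta> * ennreal \<beta>"
        using \<open>0 < \<beta>\<close> by (simp add: divide_ennreal_def mult.assoc inverse_ennreal ennreal_mult'[symmetric])
      then show ?thesis by (metis mult.assoc mult.commute)
    qed
    also have "\<dots> \<le> ennreal W * (ennreal \<beta> * e)"
      using IZ by (rule mult_right_mono) simp
    finally have "I * ennreal \<epsilon> * ennreal (1 / \<epsilon>) \<le> ennreal W * (ennreal \<beta> * e) * ennreal (1 / \<epsilon>)"
      by (rule mult_right_mono) simp
    also have "I * ennreal \<epsilon> * ennreal (1 / \<epsilon>) = I"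
      using \<open>0 < \<epsilon>\<close> by (simp add: mult.assoc ennreal_mult'[symmetric])
    also have "ennreal W * (ennreal \<beta> * e) * ennreal (1 / \<epsilon>) = ennreal (W * (\<beta> / \<epsilon>)) * e"
    proof -
      have "ennreal (W * (\<beta> / \<epsilon>)) = ennreal W * ennreal \<beta> * ennreal (1 / \<epsilon>)"
        using \<open>0 < W\<close> \<open>0 < \<beta>\<close> \<open>0 < \<epsilon>\<close> by (simp add: ennreal_mult[symmetric])
      then show ?thesis by (simp add: mult_ac)
    qed
    also have "\<beta> / \<epsilon> = (R / r) ^ CARD('n)"
      using \<open>?V \<noteq> 0\<close> by (simp add: \<beta>_def \<epsilon>_def power_divide)
    finally have "I \<le> ennreal (W * (R / r) ^ CARD('n)) * e" .
    \<comment> \<open>An infinite weight leaves the product with \<open>Z\<close> finite only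
      through \<open>0 * top = 0\<close>, that is for \<open>Z = 0\<close>; but then the small ball
      would have volume 0.\<close>
    moreover have "I < top"
    proof (rule ccontr)
      assume "\<not> I < top"
      then have "I = top" using less_top[of I] by auto
      then have "Z = 0"
        using IZ \<open>0 < \<beta>\<close> by (cases "Z = 0") (auto simp: ennreal_top_divide ennreal_top_mult top_unique)
      then show False
        using eZ \<open>0 < \<epsilon>\<close> by simp
    qed
    ultimately show "ball_weight \<phi> x R t < top \<and>
        ball_weight \<phi> x R t \<le> ennreal (W * (R / r) ^ CARD('n)) * ball_weight \<phi> x r t"
      by (simp add: I_def e_def)
  qed
qed

text \<open>Classically, Hoelder's inequality bounds the power \<open>q\<close> of the small volume
  by the small weight times the power \<open>q - 1\<close> of the integral of
  \<open>\<phi> powr (- 1 / (q - 1))\<close>. That integral is enlarged to the large ball, where the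
  Muckenhoupt condition exchanges it for the large weight.\<close>

lemma muckenhoupt_gt_1_doubling:
  fixes \<phi> :: "real^'n \<Rightarrow> real \<Rightarrow> real"
  assumes "muckenhoupt q \<phi>" and "1 < q" and pos: "\<And>x t. 0 < t \<Longrightarrow> 0 < \<phi> x t"
    and meas: "\<And>t. 0 < t \<Longrightarrow> (\<lambda>x. \<phi> x t) \<in> borel_measurable lebesgue"
  shows "\<exists>A. \<forall>t>0. \<forall>x. \<forall>r>0. \<forall>R\<ge>r. ball_weight \<phi> x R t < top \<and>
    ball_weight \<phi> x R t \<le> ennreal (A * ((R / r) ^ CARD('n)) powr q) * ball_weight \<phi> x r t"
proof -
  obtain W where "0 < W" and W: "\<And>t x r. 0 < t \<Longrightarrow> 0 < r \<Longrightarrow>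
    ball_avg (\<lambda>y. ennreal (\<phi> y t)) x r *
      ennreal_powr (ball_avg (\<lambda>y. ennreal (\<phi> y t powr (- 1 / (q - 1)))) x r) (q - 1) \<le> ennreal W"
    using muckenhoupt_bound[OF assms(1)] \<open>1 < q\<close> by auto
  define p where "p = q - 1"
  have "0 < p" using \<open>1 < q\<close> by (simp add: p_def)
  show ?thesis
  proof (intro exI[of _ "W * 2 powr q"] allI impI)
    fix t r R :: real and x :: "real^'n"
    assume "0 < t" "0 < r" "r \<le> R"
    then have "0 < R" by simp
    note [measurable] = meas[OF \<open>0 < t\<close>]
    let ?V = "unit_ball_vol CARD('n)"
    have "?V > 0" and "?V \<noteq> 0"
      using unit_ball_vol_pos[of "CARD('n)"] by linarith+
    define \<beta> \<epsilon> where "\<beta> = ?V * R ^ CARD('n)" and "\<epsilon> = ?V * r ^ CARD('n)"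
    have "0 < \<beta>" "0 < \<epsilon>" using \<open>?V > 0\<close> \<open>0 < r\<close> \<open>0 < R\<close> by (auto simp: \<beta>_def \<epsilon>_def)
    have [measurable]: "ball x r \<in> sets lebesgue" for r by simp
    let ?I = "ball_weight \<phi> x R t" and ?e = "ball_weight \<phi> x r t"
    let ?b = "\<integral>\<^sup>+y\<in>ball x R. ennreal (\<phi> y t powr (- 1 / p)) \<partial>lebesgue"
    have main: "?I / ennreal \<beta> * ennreal_powr (?b / ennreal \<beta>) p \<le> ennreal W"
      using W[OF \<open>0 < t\<close> \<open>0 < R\<close>, of x] \<open>0 < R\<close>
      by (simp add: \<beta>_def p_def ball_weight_def ball_avg_def emeasure_ball)
    \<comment> \<open>Positivity comes first: because \<open>0 * top = 0\<close>, a bound on a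
      product excludes an infinite factor only once the other factor is known to be nonzero.\<close>
    have "0 < ?I"
      unfolding ball_weight_def by (rule nn_integral_ball_pos) (use pos \<open>0 < t\<close> \<open>0 < R\<close> in auto)
    have "0 < ?e"
      unfolding ball_weight_def by (rule nn_integral_ball_pos) (use pos \<open>0 < t\<close> \<open>0 < r\<close> in auto)
    have "0 < ?b"
      by (rule nn_integral_ball_pos) (use less_imp_neq[OF pos[OF \<open>0 < t\<close>]] \<open>0 < R\<close> in auto)
    have "?b \<noteq> top"
    proof
      assume "?b = top"
      then have "?I / ennreal \<beta> * top \<le> ennreal W"
        using main \<open>0 < \<beta>\<close> by (simp add: ennreal_top_divide)
      moreover have "?I / ennreal \<beta> \<noteq> 0"
        using \<open>0 < ?I\<close> by (simp add: divide_ennreal_def)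
      ultimately show False
        by (simp add: ennreal_mult_top top_unique)
    qed
    then obtain b where b: "?b = ennreal b" "0 < b"
      using \<open>0 < ?b\<close> by (cases ?b) auto
    have powr: "ennreal_powr (?b / ennreal \<beta>) p = ennreal ((b / \<beta>) powr p)"
      using b \<open>0 < \<beta>\<close> by (simp add: divide_ennreal ennreal_powr_def)
    have "?I \<noteq> top"
    proof
      assume "?I = top"
      then have "top * ennreal ((b / \<beta>) powr p) \<le> ennreal W"
        using main \<open>0 < \<beta>\<close> unfolding powr by (simp add: ennreal_top_divide)
      then show False
        using b \<open>0 < \<beta>\<close> by (simp add: ennreal_top_mult top_unique)
    qed
    then obtain i where i: "?I = ennreal i" "0 < i"
      using \<open>0 < ?I\<close> by (cases ?I) auto
    have "?e \<le> ?I"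
      unfolding ball_weight_def using \<open>r \<le> R\<close> by (intro nn_integral_mono) (auto split: split_indicator)
    then obtain e where e: "?e = ennreal e" "0 < e"
      using \<open>0 < ?e\<close> i by (cases ?e) (auto simp: top_unique)
    have main': "i / \<beta> * (b / \<beta>) powr p \<le> W"
      using main i b \<open>0 < \<beta>\<close> \<open>0 < W\<close> unfolding powr
      by (simp add: divide_ennreal ennreal_mult[symmetric])
    \<comment> \<open>With this value \<open>l * e\<close> is exactly half of \<epsilon>, so the
      integral \<open>b\<close> over the large ball must account for the other half.\<close>
    define l where "l = \<epsilon> / (2 * e)"
    have "0 < l" using \<open>0 < \<epsilon>\<close> e by (simp add: l_def)
    have "ennreal \<epsilon> \<le> ennreal (l * e + l powr (- 1 / p) * b)"
    proof -
      \<comment> \<open>\<open>1 \<le> u + u powr (- 1 / p)\<close> for \<open>u > 0\<close>, with \<open>l\<close> chosen to balance the two terms,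
        replaces Hoelder's inequality.\<close>
      have pw: "1 \<le> l * \<phi> y t + l powr (- 1 / p) * \<phi> y t powr (- 1 / p)" for y
      proof -
        have "0 < l * \<phi> y t" using \<open>0 < l\<close> pos[OF \<open>0 < t\<close>] by simp
        then have "1 \<le> l * \<phi> y t \<or> 1 \<le> (l * \<phi> y t) powr (- 1 / p)"
          using \<open>0 < p\<close> powr_mono2'[of "- 1 / p" "l * \<phi> y t" 1] by (cases "1 \<le> l * \<phi> y t") auto
        then show ?thesis
          using \<open>0 < l * \<phi> y t\<close> \<open>0 < l\<close> pos[OF \<open>0 < t\<close>, of y]
          by (auto simp: powr_mult add_increasing add_increasing2)
      qed
      have "ennreal \<epsilon> = (\<integral>\<^sup>+y. indicator (ball x r) y \<partial>lebesgue)"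
        using \<open>0 < r\<close> by (simp add: \<epsilon>_def emeasure_ball)
      also have "\<dots> \<le> (\<integral>\<^sup>+y. ennreal l * (ennreal (\<phi> y t) * indicator (ball x r) y)
          + ennreal (l powr (- 1 / p)) * (ennreal (\<phi> y t powr (- 1 / p)) * indicator (ball x R) y) \<partial>lebesgue)"
      proof (rule nn_integral_mono)
        fix y
        have "(1::ennreal) \<le> ennreal (l * \<phi> y t + l powr (- 1 / p) * \<phi> y t powr (- 1 / p))"
          using pw[of y] by (simp add: ennreal_leI flip: ennreal_1)
        also have "\<dots> = ennreal l * ennreal (\<phi> y t) + ennreal (l powr (- 1 / p)) * ennreal (\<phi> y t powr (- 1 / p))"
          using \<open>0 < l\<close> pos[OF \<open>0 < t\<close>, of y] by (simp add: ennreal_mult ennreal_plus)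
        finally show "indicator (ball x r) y \<le> ennreal l * (ennreal (\<phi> y t) * indicator (ball x r) y)
          + ennreal (l powr (- 1 / p)) * (ennreal (\<phi> y t powr (- 1 / p)) * indicator (ball x R) y)"
          using \<open>r \<le> R\<close> by (auto split: split_indicator)
      qed
      also have "\<dots> = ennreal l * ?e + ennreal (l powr (- 1 / p)) * ?b"
        unfolding ball_weight_def by (subst nn_integral_add, measurable, subst (1 2) nn_integral_cmult, auto)
      also have "\<dots> = ennreal (l * e + l powr (- 1 / p) * b)"
        unfolding e b using \<open>0 < l\<close> e(2) b(2) by (simp add: ennreal_mult ennreal_plus)
      finally show ?thesis .
    qed
    then have "\<epsilon> \<le> l * e + l powr (- 1 / p) * b"
      using \<open>0 < l\<close> e(2) b(2) by (subst (asm) ennreal_le_iff) auto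
    moreover have "l * e = \<epsilon> / 2"
      using e(2) by (simp add: l_def)
    ultimately have "\<epsilon> / 2 \<le> l powr (- 1 / p) * b"
      by simp
    then have "(\<epsilon> / 2) powr p \<le> (l powr (- 1 / p) * b) powr p"
      using \<open>0 < \<epsilon>\<close> \<open>0 < p\<close> by (intro powr_mono2) auto
    also have "\<dots> = b powr p / l"
      using \<open>0 < l\<close> b(2) \<open>0 < p\<close> by (simp add: powr_divide powr_powr powr_minus_divide)
    finally have 2: "(\<epsilon> / 2) powr p * \<epsilon> \<le> 2 * e * b powr p"
      using \<open>0 < \<epsilon>\<close> e(2) \<open>0 < l\<close> by (simp add: l_def field_simps)
    have 3: "i * b powr p \<le> W * \<beta> powr q"
    proof -
      have "i * b powr p = (i / \<beta> * (b / \<beta>) powr p) * (\<beta> * \<beta> powr p)"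
        using \<open>0 < \<beta>\<close> b(2) by (simp add: powr_divide)
      also have "\<dots> \<le> W * (\<beta> * \<beta> powr p)"
        using main' \<open>0 < \<beta>\<close> by (intro mult_right_mono) auto
      also have "\<beta> * \<beta> powr p = \<beta> powr q"
        using \<open>0 < \<beta>\<close> by (simp add: p_def powr_diff)
      finally show ?thesis .
    qed
    have 4: "(\<epsilon> / 2) powr p * \<epsilon> = 2 * (\<epsilon> / 2) powr q"
      using \<open>0 < \<epsilon>\<close> by (simp add: p_def powr_diff)
    have "i * (2 * (\<epsilon> / 2) powr q) \<le> i * (2 * e * b powr p)"
      using 2 i(2) unfolding 4 by (intro mult_left_mono) auto
    also have "\<dots> \<le> 2 * e * (W * \<beta> powr q)"
      using mult_left_mono[OF 3, of "2 * e"] e(2) by (simp add: mult_ac)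
    finally have "i \<le> W * \<beta> powr q / (\<epsilon> / 2) powr q * e"
      using \<open>0 < \<epsilon>\<close> by (simp add: field_simps)
    also have "W * \<beta> powr q / (\<epsilon> / 2) powr q = W * 2 powr q * (\<beta> / \<epsilon>) powr q"
      using \<open>0 < \<epsilon>\<close> \<open>0 < \<beta>\<close> by (simp add: powr_divide)
    also have "\<beta> / \<epsilon> = (R / r) ^ CARD('n)"
      using \<open>?V \<noteq> 0\<close> by (simp add: \<beta>_def \<epsilon>_def power_divide)
    finally have "ennreal i \<le> ennreal (W * 2 powr q * ((R / r) ^ CARD('n)) powr q * e)"
      by (rule ennreal_leI)
    then show "ball_weight \<phi> x R t < top \<and>
        ball_weight \<phi> x R t \<le> ennreal (W * 2 powr q * ((R / r) ^ CARD('n)) powr q) * ball_weight \<phi> x r t"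
      unfolding i e using e(2) \<open>0 < W\<close> by (simp add: ennreal_mult'')
  qed
qed

text \<open>The indices are an infimum and a supremum that need not be attained. The strict
  inequality leaves room to choose an admissible \<open>p\<close> close to the supremum, and after
  it an admissible \<open>q\<close> close to the infimum.\<close>

lemma critical_exponents:
  fixes \<phi> :: "real^'n \<Rightarrow> real \<Rightarrow> real"
  assumes "growth_function \<phi>"
    and less: "ereal (real CARD('n)) * weight_index \<phi> < ereal (real CARD('n) + 1) * lower_type_index \<phi>"
  obtains q p where "1 \<le> q" "muckenhoupt q \<phi>" "0 < p" "unif_lower_type \<phi> p"
    "real CARD('n) * q < (real CARD('n) + 1) * p"
proof -
  let ?n = "real CARD('n)"
  have "0 < ?n" by simp
  obtain q0 where q0: "1 \<le> q0" "muckenhoupt q0 \<phi>"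
    using assms(1) by (auto simp: growth_function_def muckenhoupt_inf_def)
  have "weight_index \<phi> \<le> ereal q0"
    unfolding weight_index_def using q0 by (intro INF_lower) auto
  moreover have "1 \<le> weight_index \<phi>"
    unfolding weight_index_def by (intro INF_greatest) auto
  ultimately obtain i where i: "weight_index \<phi> = ereal i"
    by (cases "weight_index \<phi>") auto
  have "ereal (?n * i / (?n + 1)) < lower_type_index \<phi>"
    using less i by (cases "lower_type_index \<phi>") (auto simp: pos_divide_less_eq mult.commute)
  then obtain p where p: "0 < p" "unif_lower_type \<phi> p" "?n * i / (?n + 1) < p"
    unfolding lower_type_index_def by (auto simp: less_SUP_iff)
  then have "i < (?n + 1) * p / ?n"
    using \<open>0 < ?n\<close> by (simp add: pos_divide_less_eq pos_less_divide_eq mult.commute)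
  then have "weight_index \<phi> < ereal ((?n + 1) * p / ?n)"
    by (simp add: i)
  then obtain q where "1 \<le> q" "muckenhoupt q \<phi>" "q < (?n + 1) * p / ?n"
    unfolding weight_index_def by (auto simp: INF_less_iff)
  then show ?thesis
    using p \<open>0 < ?n\<close> by (intro that[of q p]) (auto simp: pos_less_divide_eq mult.commute)
qed

lemma muckenhoupt_doubling:
  fixes \<phi> :: "real^'n \<Rightarrow> real \<Rightarrow> real"
  assumes "growth_function \<phi>" "muckenhoupt q \<phi>" "1 \<le> q"
  obtains A where "1 \<le> A"
    "\<And>t x r. 0 < t \<Longrightarrow> 0 < r \<Longrightarrow> ball_weight \<phi> x r t < top"
    "\<And>t x r R. 0 < t \<Longrightarrow> 0 < r \<Longrightarrow> r \<le> R \<Longrightarrow>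
        ball_weight \<phi> x R t \<le> ennreal (A * (R / r) powr (real CARD('n) * q)) * ball_weight \<phi> x r t"
proof -
  have pos: "0 < \<phi> x t" and meas: "(\<lambda>x. \<phi> x t) \<in> borel_measurable lebesgue" if "0 < t" for x t
    using assms(1) that by (auto simp: growth_function_def)
  obtain A where A: "\<And>t x r R. 0 < t \<Longrightarrow> 0 < r \<Longrightarrow> r \<le> R \<Longrightarrow> ball_weight \<phi> x R t < top \<and>
    ball_weight \<phi> x R t \<le> ennreal (A * ((R / r) ^ CARD('n)) powr q) * ball_weight \<phi> x r t"
  proof (cases "q = 1")
    case True
    obtain A where A: "\<forall>t>0. \<forall>x. \<forall>r>0. \<forall>R\<ge>r. ball_weight \<phi> x R t < top \<and>
      ball_weight \<phi> x R t \<le> ennreal (A * (R / r) ^ CARD('n)) * ball_weight \<phi> x r t"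
      using muckenhoupt_1_doubling[of \<phi>] assms(2) pos meas True by blast
    have "((R / r) ^ CARD('n)) powr q = (R / r) ^ CARD('n)" if "0 < r" "r \<le> R" for r R :: real
      using that True by simp
    then show ?thesis
      using A by (intro that[of A]) auto
  next
    case False
    then have "1 < q" using assms(3) by simp
    then obtain A where "\<forall>t>0. \<forall>x. \<forall>r>0. \<forall>R\<ge>r. ball_weight \<phi> x R t < top \<and>
      ball_weight \<phi> x R t \<le> ennreal (A * ((R / r) ^ CARD('n)) powr q) * ball_weight \<phi> x r t"
      using muckenhoupt_gt_1_doubling[of q \<phi>] assms(2) pos meas by blast
    then show ?thesis
      by (intro that[of A]) auto
  qed
  show ?thesis
  proof (rule that[of "max A 1"])
    show "ball_weight \<phi> x r t < top" if "0 < t" "0 < r" for t x r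
      using A[OF that, of r x] by simp
    fix t r R :: real and x :: "real^'n"
    assume *: "0 < t" "0 < r" "r \<le> R"
    have "((R / r) ^ CARD('n)) powr q = (R / r) powr (real CARD('n) * q)"
      using * powr_realpow[of "R / r" "CARD('n)"] by (simp add: powr_powr[symmetric])
    then have "ball_weight \<phi> x R t \<le> ennreal (A * (R / r) powr (real CARD('n) * q)) * ball_weight \<phi> x r t"
      using A[OF *] by simp
    also have "\<dots> \<le> ennreal (max A 1 * (R / r) powr (real CARD('n) * q)) * ball_weight \<phi> x r t"
      by (intro mult_right_mono ennreal_leI) auto
    finally show "ball_weight \<phi> x R t \<le> ennreal (max A 1 * (R / r) powr (real CARD('n) * q)) * ball_weight \<phi> x r t" .
  qed simp
qed

section \<open>From weight integrals to the Luxemburg norm of balls\<close>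

lemma ball_weight_mono: "ball x r \<subseteq> ball y s \<Longrightarrow> ball_weight \<phi> x r t \<le> ball_weight \<phi> y s t"
  unfolding ball_weight_def by (intro nn_integral_mono) (auto split: split_indicator)

lemma ball_norm_eq:
  fixes \<phi> :: "real^'n \<Rightarrow> real \<Rightarrow> real"
  assumes "growth_function \<phi>"
  shows "ball_norm \<phi> x r = (INF c\<in>{c. 0 < c \<and> ball_weight \<phi> x r (1 / c) \<le> 1}. ennreal c)"
proof -
  have "\<phi> y 0 = 0" for y
    using assms by (simp add: growth_function_def)
  then have "(\<integral>\<^sup>+y. ennreal (\<phi> y (norm (indicator (ball x r) y :: real) / c)) \<partial>lebesgue) = ball_weight \<phi> x r (1 / c)" for c
    unfolding ball_weight_def by (intro nn_integral_cong) (simp split: split_indicator)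
  then show ?thesis
    by (simp add: luxemburg_norm_def)
qed

lemma ball_norm_mono:
  fixes \<phi> :: "real^'n \<Rightarrow> real \<Rightarrow> real"
  assumes "growth_function \<phi>" "ball x r \<subseteq> ball y s"
  shows "ball_norm \<phi> x r \<le> ball_norm \<phi> y s"
  unfolding ball_norm_eq[OF assms(1)]
  using order.trans[OF ball_weight_mono[OF assms(2)]] by (intro INF_superset_mono) auto

lemma ball_weight_lower_type:
  fixes \<phi> :: "real^'n \<Rightarrow> real \<Rightarrow> real"
  assumes "growth_function \<phi>" "unif_lower_type \<phi> p"
  obtains B where "1 \<le> B" "\<And>x r s t. 0 < t \<Longrightarrow> 0 < s \<Longrightarrow> s < 1 \<Longrightarrow>
    ball_weight \<phi> x r (s * t) \<le> ennreal (B * s powr p) * ball_weight \<phi> x r t"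
proof -
  have pos: "0 < \<phi> x t" and meas: "(\<lambda>x. \<phi> x t) \<in> borel_measurable lebesgue" if "0 < t" for x t
    using assms(1) that by (auto simp: growth_function_def)
  obtain C where C: "\<And>x s t. 0 < t \<Longrightarrow> 0 < s \<Longrightarrow> s < 1 \<Longrightarrow> \<phi> x (s * t) \<le> C * s powr p * \<phi> x t"
    using assms(2) unfolding unif_lower_type_def by (metis greaterThanLessThan_iff less_imp_le)
  show ?thesis
  proof (rule that[of "max C 1"])
    fix x :: "real^'n" and r s t :: real
    assume *: "0 < t" "0 < s" "s < 1"
    note [measurable] = meas[OF \<open>0 < t\<close>]
    have [measurable]: "ball x r \<in> sets lebesgue" by simp
    have "ball_weight \<phi> x r (s * t) \<le> (\<integral>\<^sup>+y. ennreal (max C 1 * s powr p) * (ennreal (\<phi> y t) * indicator (ball x r) y) \<partial>lebesgue)"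
      unfolding ball_weight_def
    proof (intro nn_integral_mono)
      fix y
      have "\<phi> y (s * t) \<le> C * s powr p * \<phi> y t" by (intro C *)
      also have "\<dots> \<le> max C 1 * s powr p * \<phi> y t"
        using pos[OF \<open>0 < t\<close>, of y] by (intro mult_right_mono) auto
      finally have "ennreal (\<phi> y (s * t)) \<le> ennreal (max C 1 * s powr p) * ennreal (\<phi> y t)"
        using pos[OF \<open>0 < t\<close>, of y] by (simp add: ennreal_leI ennreal_mult''[symmetric])
      then show "ennreal (\<phi> y (s * t)) * indicator (ball x r) y
        \<le> ennreal (max C 1 * s powr p) * (ennreal (\<phi> y t) * indicator (ball x r) y)"
        by (simp split: split_indicator)
    qed
    also have "\<dots> = ennreal (max C 1 * s powr p) * ball_weight \<phi> x r t"
      unfolding ball_weight_def by (rule nn_integral_cmult) measurable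
    finally show "ball_weight \<phi> x r (s * t) \<le> ennreal (max C 1 * s powr p) * ball_weight \<phi> x r t" .
  qed simp
qed

text \<open>Enlarging the radius from \<open>r\<close> to \<open>R\<close> multiplies the weight by
  at most \<open>A * (R / r) powr (n * q)\<close>. The lower type undoes this if \<open>c\<close> is
  enlarged by about the power \<open>1 / p\<close> of that factor, whence
  \<open>a = n * q / p\<close>, which \<open>critical_exponents\<close> makes smaller than n +
  1.\<close>

lemma ball_norm_ball_gauge:
  fixes \<phi> :: "real^'n \<Rightarrow> real \<Rightarrow> real"
  assumes \<phi>: "growth_function \<phi>"
    and less: "ereal (real CARD('n)) * weight_index \<phi> < ereal (real CARD('n) + 1) * lower_type_index \<phi>"
  obtains K a where "ball_gauge (\<lambda>x r. enn2real (ball_norm \<phi> x r)) K a" "\<And>x r. 0 < r \<Longrightarrow> ball_norm \<phi> x r < top"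
proof -
  let ?n = "real CARD('n)"
  obtain q p where qp: "1 \<le> q" "muckenhoupt q \<phi>" "0 < p" "unif_lower_type \<phi> p" "?n * q < (?n + 1) * p"
    using critical_exponents[OF assms] by blast
  obtain A where "1 \<le> A" and fin: "\<And>t x r. 0 < t \<Longrightarrow> 0 < r \<Longrightarrow> ball_weight \<phi> x r t < top"
    and A: "\<And>t x r R. 0 < t \<Longrightarrow> 0 < r \<Longrightarrow> r \<le> R \<Longrightarrow>
        ball_weight \<phi> x R t \<le> ennreal (A * (R / r) powr (?n * q)) * ball_weight \<phi> x r t"
    using muckenhoupt_doubling[OF \<phi> qp(2,1)] by blast
  obtain B where "1 \<le> B" and B: "\<And>x r s t. 0 < t \<Longrightarrow> 0 < s \<Longrightarrow> s < 1 \<Longrightarrow>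
    ball_weight \<phi> x r (s * t) \<le> ennreal (B * s powr p) * ball_weight \<phi> x r t"
    using ball_weight_lower_type[OF \<phi> qp(4)] by blast
  have rescale: "ball_norm \<phi> x r \<le> ennreal (c * (2 * B * G) powr (1 / p))"
    if "0 < c" "1 \<le> G" "ball_weight \<phi> x r (1 / c) \<le> ennreal G" for x r c G
  proof -
    \<comment> \<open>Chosen so that \<open>B * s powr p * G = 1 / 2\<close>. The factor 2 makes
      \<open>s < 1\<close> strict even for \<open>B = G = 1\<close>, as the lower type speaks only
      of \<open>0 < s < 1\<close>.\<close>
    define s where "s = (2 * B * G) powr (- 1 / p)"
    have "1 * 1 \<le> B * G"
      using \<open>1 \<le> B\<close> \<open>1 \<le> G\<close> by (intro mult_mono) auto
    then have BG: "1 < 2 * B * G" by linarith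
    have "B \<noteq> 0" "G \<noteq> 0"
      using \<open>1 \<le> B\<close> \<open>1 \<le> G\<close> by auto
    then have "0 < s" by (simp add: s_def)
    have "s < 1" using BG qp(3) by (simp add: s_def powr_less_one)
    have sp: "s powr p = 1 / (2 * B * G)"
    proof -
      have "s powr p = (2 * B * G) powr - 1"
        using qp(3) by (simp add: s_def powr_powr)
      then show ?thesis
        using BG by (simp add: powr_minus_divide del: powr_mult)
    qed
    have "ball_weight \<phi> x r (s * (1 / c)) \<le> ennreal (B * s powr p) * ball_weight \<phi> x r (1 / c)"
      using \<open>0 < c\<close> \<open>0 < s\<close> \<open>s < 1\<close> by (intro B) auto
    also have "\<dots> \<le> ennreal (B * s powr p) * ennreal G"
      using that by (intro mult_left_mono) auto
    also have "\<dots> = ennreal (1 / 2)"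
      using \<open>1 \<le> B\<close> \<open>1 \<le> G\<close> unfolding sp by (subst ennreal_mult'[symmetric]) auto
    also have "\<dots> \<le> ennreal 1"
      by (rule ennreal_leI) simp
    finally have "ball_weight \<phi> x r (1 / (c / s)) \<le> 1"
      by simp
    then have "ball_norm \<phi> x r \<le> ennreal (c / s)"
      unfolding ball_norm_eq[OF \<phi>] using \<open>0 < c\<close> \<open>0 < s\<close> by (intro INF_lower) auto
    also have "c / s = c * (2 * B * G) powr (1 / p)"
      using BG by (simp add: s_def powr_minus_divide)
    finally show ?thesis .
  qed
  have finite: "ball_norm \<phi> x r < top" if "0 < r" for x r
  proof -
    have "ball_weight \<phi> x r (1 / 1) \<le> ennreal (max 1 (enn2real (ball_weight \<phi> x r 1)))"
    proof -
      have "ball_weight \<phi> x r (1 / 1) = ennreal (enn2real (ball_weight \<phi> x r 1))"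
        using fin[OF zero_less_one that, of x] by simp
      also have "\<dots> \<le> ennreal (max 1 (enn2real (ball_weight \<phi> x r 1)))"
        by (rule ennreal_leI) simp
      finally show ?thesis .
    qed
    from order.strict_trans1[OF rescale[OF zero_less_one _ this] ennreal_less_top] show ?thesis by simp
  qed
  define K a where "K = (2 * B * A) powr (1 / p)" and "a = ?n * q / p"
  have "1 * 1 \<le> B * A"
    using \<open>1 \<le> B\<close> \<open>1 \<le> A\<close> by (intro mult_mono) auto
  have "1 \<le> K"
    unfolding K_def using \<open>1 * 1 \<le> B * A\<close> qp(3) by (intro ge_one_powr_ge_zero) auto
  have doubling: "ball_norm \<phi> x R \<le> ennreal (K * (R / r) powr a) * ball_norm \<phi> x r" if "0 < r" "r \<le> R" for x r R
  proof -
    define L where "L = K * (R / r) powr a"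
    have "0 < L" using \<open>1 \<le> K\<close> that by (simp add: L_def)
    have "1 \<le> R / r" using that by simp
    have 1: "ball_norm \<phi> x R \<le> ennreal (c * L)" if c: "0 < c" "ball_weight \<phi> x r (1 / c) \<le> 1" for c
    proof -
      let ?G = "A * (R / r) powr (?n * q)"
      have "1 \<le> (R / r) powr (?n * q)"
        using \<open>1 \<le> R / r\<close> qp(1) by (intro ge_one_powr_ge_zero) auto
      then have "1 * 1 \<le> ?G"
        using \<open>1 \<le> A\<close> by (intro mult_mono) auto
      have "ball_weight \<phi> x R (1 / c) \<le> ennreal ?G * ball_weight \<phi> x r (1 / c)"
        using c \<open>0 < r\<close> \<open>r \<le> R\<close> by (intro A) auto
      also have "\<dots> \<le> ennreal ?G * 1"
        using c by (intro mult_left_mono) auto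
      finally have "ball_norm \<phi> x R \<le> ennreal (c * (2 * B * ?G) powr (1 / p))"
        using \<open>1 * 1 \<le> ?G\<close> c(1) by (intro rescale) auto
      also have "(2 * B * ?G) powr (1 / p) = ((2 * B * A) * (R / r) powr (?n * q)) powr (1 / p)"
        by (simp add: mult_ac)
      also have "\<dots> = L"
        using \<open>1 \<le> A\<close> \<open>1 \<le> B\<close> qp(3) by (simp add: powr_mult powr_powr K_def L_def a_def)
      finally show ?thesis .
    qed
    \<comment> \<open>Moving \<open>L\<close> to the left leaves a bare infimum on the right, so
      that it is enough to bound the left side by each admissible \<open>c\<close>.\<close>
    have "ball_norm \<phi> x R * ennreal (1 / L) \<le> ball_norm \<phi> x r"
      unfolding ball_norm_eq[OF \<phi>, of x r]
    proof (rule INF_greatest)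
      fix c assume "c \<in> {c. 0 < c \<and> ball_weight \<phi> x r (1 / c) \<le> 1}"
      then have c: "0 < c" "ball_norm \<phi> x R \<le> ennreal (c * L)"
        using 1 by auto
      then have "ball_norm \<phi> x R * ennreal (1 / L) \<le> ennreal (c * L) * ennreal (1 / L)"
        by (intro mult_right_mono) auto
      also have "\<dots> = ennreal c"
        using \<open>0 < L\<close> c(1) by (subst ennreal_mult'[symmetric]) auto
      finally show "ball_norm \<phi> x R * ennreal (1 / L) \<le> ennreal c" .
    qed
    then have "ennreal L * (ball_norm \<phi> x R * ennreal (1 / L)) \<le> ennreal L * ball_norm \<phi> x r"
      by (rule mult_left_mono) simp
    moreover have "ennreal L * (ball_norm \<phi> x R * ennreal (1 / L)) = ball_norm \<phi> x R"
    proof -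
      have "ennreal L * ennreal (1 / L) = 1"
        using \<open>0 < L\<close> by (simp add: ennreal_mult'[symmetric])
      then show ?thesis
        by (metis mult.commute mult.left_commute mult_1_right)
    qed
    ultimately show ?thesis by (simp add: L_def)
  qed
  show ?thesis
  proof (rule that)
    show "ball_gauge (\<lambda>x r. enn2real (ball_norm \<phi> x r)) K a"
    proof
      show "0 \<le> enn2real (ball_norm \<phi> x r)" for x r by simp
      show "enn2real (ball_norm \<phi> x r) \<le> enn2real (ball_norm \<phi> y s)"
        if "0 < r" "ball x r \<subseteq> ball y s" for x r y s
      proof (rule enn2real_mono)
        have "0 < s" using that by (metis ball_eq_empty ball_empty not_le subset_empty)
        then show "ball_norm \<phi> y s < top" by (rule finite)
      qed (rule ball_norm_mono[OF \<phi> that(2)])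
      show "enn2real (ball_norm \<phi> x R) \<le> K * (R / r) powr a * enn2real (ball_norm \<phi> x r)"
        if "0 < r" "r \<le> R" for x r R
      proof -
        have "enn2real (ball_norm \<phi> x R) \<le> enn2real (ennreal (K * (R / r) powr a) * ball_norm \<phi> x r)"
          using doubling[OF that] finite[OF that(1)] by (intro enn2real_mono) (auto simp: ennreal_mult_less_top)
        then show ?thesis
          using \<open>1 \<le> K\<close> by (simp add: enn2real_mult)
      qed
      show "1 \<le> K" by fact
      show "a < ?n + 1"
        using qp(3,5) by (simp add: a_def pos_divide_less_eq)
    qed
  qed (rule finite)
qed

text \<open>At \<open>B = 0\<close> the equivalence persists: \<open>X / 0\<close> is
  \<open>top\<close> unless \<open>X = 0\<close>, and \<open>0 / 0 = 0\<close>, in agreement with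
  \<open>X \<le> 0\<close>.\<close>

lemma ennreal_divide_le_iff:
  fixes X B :: ennreal
  assumes "B < top"
  shows "X / B \<le> ennreal N \<longleftrightarrow> X \<le> ennreal N * B"
proof (cases "B = 0")
  case True
  then show ?thesis
    by (cases "X = 0") (auto simp: divide_ennreal_def ennreal_mult_top top_unique)
next
  case False
  then have "X = X / B * B"
    using assms by (simp add: ennreal_divide_times ennreal_mult_divide_eq less_top)
  show ?thesis
  proof
    assume "X / B \<le> ennreal N"
    then have "X / B * B \<le> ennreal N * B" by (rule mult_right_mono) simp
    then show "X \<le> ennreal N * B" using \<open>X = X / B * B\<close> by simp
  next
    assume "X \<le> ennreal N * B"
    then show "X / B \<le> ennreal N"
      using False by (intro divide_le_posI_ennreal) (auto simp: zero_less_iff_neq_zero mult.commute)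
  qed
qed

text \<open>Links the suprema in \<open>ennreal\<close> with the real inequalities in
  \<open>heat_osc\<close> and \<open>mean_osc\<close>, on which the analytic part is built.\<close>

lemma ball_sup_le_iff:
  assumes "\<And>x r. 0 < r \<Longrightarrow> ball_norm \<phi> x r < top" "0 \<le> N"
  shows "(SUP x. SUP r\<in>{0<..}. X x r / ball_norm \<phi> x r) \<le> ennreal N \<longleftrightarrow>
    (\<forall>x. \<forall>r>0. X x r \<le> ennreal (N * enn2real (ball_norm \<phi> x r)))"
proof -
  have "X x r / ball_norm \<phi> x r \<le> ennreal N \<longleftrightarrow> X x r \<le> ennreal (N * enn2real (ball_norm \<phi> x r))"
    if "0 < r" for x r
    using assms(1)[OF that, of x] assms(2)
    by (simp add: ennreal_divide_le_iff ennreal_mult)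
  then show ?thesis
    by (auto simp: SUP_le_iff)
qed

text \<open>Identification modulo heat fixed functions is expressed through pairs \<open>f\<close>,
  \<open>g\<close> whose difference is heat fixed. The first two parts say that the inclusion maps
  onto the quotient space, and the third compares the norm of a class with that of any of its
  representatives in \<open>bmo_space\<close>.\<close>

theorem theorem5p7:
  fixes \<phi> :: "real^'n \<Rightarrow> real \<Rightarrow> real"
  assumes "growth_function \<phi>"
    and "ereal (real CARD('n)) * weight_index \<phi> < ereal (real CARD('n) + 1) * lower_type_index \<phi>"
    and "(\<exists>C>0. \<forall>x\<^sub>1 r\<^sub>1 x\<^sub>2 r\<^sub>2. 0 < r\<^sub>1 \<longrightarrow> 0 < r\<^sub>2 \<longrightarrow> ball x\<^sub>1 r\<^sub>1 \<subseteq> ball x\<^sub>2 r\<^sub>2 \<longrightarrow>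
            ball_norm \<phi> x\<^sub>1 r\<^sub>1 / emeasure lebesgue (ball x\<^sub>1 r\<^sub>1)
              \<le> ennreal C * (ball_norm \<phi> x\<^sub>2 r\<^sub>2 / emeasure lebesgue (ball x\<^sub>2 r\<^sub>2)))
         \<or> weight_index \<phi> * conjugate_index (reverse_hoelder_index \<phi>) \<in> {1<..<2}"
  shows "bmo_space \<phi> \<subseteq> heat_bmo_space \<phi>
    \<and> (\<forall>f\<in>heat_bmo_space \<phi>. \<exists>g\<in>bmo_space \<phi>. (\<lambda>x. f x - g x) \<in> heat_fixed)
    \<and> (\<exists>C>0. \<forall>f\<in>heat_bmo_space \<phi>. \<forall>g\<in>bmo_space \<phi>. (\<lambda>x. f x - g x) \<in> heat_fixed \<longrightarrow>
          heat_bmo_norm \<phi> f \<le> ennreal C * bmo_norm \<phi> g \<and>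
          bmo_norm \<phi> g \<le> ennreal C * heat_bmo_norm \<phi> f)"
proof -
  obtain K a where gauge: "ball_gauge (\<lambda>x r. enn2real (ball_norm \<phi> x r)) K a"
    and fin: "\<And>x r. 0 < r \<Longrightarrow> ball_norm \<phi> x r < top"
    using ball_norm_ball_gauge[OF assms(1,2)] by blast
  interpret ball_gauge "\<lambda>x r. enn2real (ball_norm \<phi> x r)" K a
    by (rule gauge)
  obtain C1 where "C1 > 0" and C1: "\<And>N g. mean_osc N g \<Longrightarrow> heat_osc (C1 * N) g"
    using heat_osc_if_mean_osc by blast
  obtain C2 where "C2 > 0" and C2: "\<And>N f h. heat_osc N f \<Longrightarrow> heat_limit f h \<Longrightarrow> mean_osc (C2 * N) (\<lambda>x. f x - h x)"
    using mean_osc_if_heat_osc by blast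
  have sup_le_iff: "(SUP x. SUP r\<in>{0<..}. X x r / ball_norm \<phi> x r) \<le> ennreal N \<longleftrightarrow>
      (\<forall>x. \<forall>r>0. X x r \<le> ennreal (N * enn2real (ball_norm \<phi> x r)))" if "0 \<le> N" for X N
    by (rule ball_sup_le_iff[OF fin that])
  have heat_iff: "heat_osc N f \<longleftrightarrow> exp_integrable f \<and> heat_bmo_norm \<phi> f \<le> ennreal N" if "0 \<le> N" for N f
    unfolding heat_osc_def heat_bmo_norm_def sup_le_iff[OF that] by (simp only: that simp_thms)
  have mean_iff: "mean_osc N g \<longleftrightarrow> (\<forall>x. \<forall>r>0. set_integrable lebesgue (ball x r) g) \<and> bmo_norm \<phi> g \<le> ennreal N"
    if "0 \<le> N" for N g
    unfolding mean_osc_def bmo_norm_def sup_le_iff[OF that] by (simp only: that simp_thms)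
  have heat_osc: "heat_osc (enn2real (heat_bmo_norm \<phi> f)) f" if "f \<in> heat_bmo_space \<phi>" for f
  proof -
    have "exp_integrable f" "heat_bmo_norm \<phi> f < top"
      using that unfolding heat_bmo_space_def by blast+
    then show ?thesis
      by (intro iffD2[OF heat_iff[OF enn2real_nonneg]] conjI) (simp only: ennreal_enn2real order_refl)+
  qed
  have mean_osc: "mean_osc (enn2real (bmo_norm \<phi> g)) g" if "g \<in> bmo_space \<phi>" for g
  proof -
    have "\<forall>S. compact S \<longrightarrow> g absolutely_integrable_on S"
      using that unfolding bmo_space_def by blast
    then have "set_integrable lebesgue (cball x r) g" for x r
      using compact_cball[of x r] by (elim allE impE)
    then have "set_integrable lebesgue (ball x r) g" for x r
      by (rule set_integrable_subset[of _ "cball x r"]) (simp_all add: ball_subset_cball)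
    moreover have "bmo_norm \<phi> g \<le> ennreal (enn2real (bmo_norm \<phi> g))"
      using that unfolding bmo_space_def by (intro eq_refl ennreal_enn2real[symmetric]) blast
    ultimately show ?thesis
      by (intro iffD2[OF mean_iff[OF enn2real_nonneg]] conjI) blast+
  qed
  have in_heat: "g \<in> heat_bmo_space \<phi>" and heat_le: "heat_bmo_norm \<phi> g \<le> ennreal C1 * bmo_norm \<phi> g"
    if "g \<in> bmo_space \<phi>" for g
  proof -
    have g: "exp_integrable g \<and> heat_bmo_norm \<phi> g \<le> ennreal (C1 * enn2real (bmo_norm \<phi> g))"
      using C1[OF mean_osc[OF that]] \<open>C1 > 0\<close> by (subst (asm) heat_iff) auto
    then show "g \<in> heat_bmo_space \<phi>"
      using order.strict_trans1[OF _ ennreal_less_top] by (auto simp: heat_bmo_space_def)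
    show "heat_bmo_norm \<phi> g \<le> ennreal C1 * bmo_norm \<phi> g"
      using g that \<open>C1 > 0\<close> by (simp add: bmo_space_def ennreal_mult)
  qed
  have bmo_le: "bmo_norm \<phi> g \<le> ennreal C2 * heat_bmo_norm \<phi> g" if "g \<in> bmo_space \<phi>" for g
  proof -
    \<comment> \<open>For \<open>g\<close> of bounded mean oscillation the zero function is a limit,
      so \<open>C2\<close> with \<open>h = 0\<close> bounds \<open>g\<close> itself and not just
      \<open>g - h\<close>.\<close>
    have "mean_osc (C2 * enn2real (heat_bmo_norm \<phi> g)) (\<lambda>x. g x - 0)"
      by (intro C2 heat_osc in_heat mean_osc_heat_limit_0[OF mean_osc] that)
    then have "bmo_norm \<phi> g \<le> ennreal (C2 * enn2real (heat_bmo_norm \<phi> g))"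
      using \<open>C2 > 0\<close> by (subst (asm) mean_iff) auto
    then show ?thesis
      using in_heat[OF that] \<open>C2 > 0\<close> by (simp add: heat_bmo_space_def ennreal_mult)
  qed
  have decomposition: "\<exists>g\<in>bmo_space \<phi>. (\<lambda>x. f x - g x) \<in> heat_fixed" if "f \<in> heat_bmo_space \<phi>" for f
  proof -
    note f = heat_osc[OF that]
    obtain h where h: "heat_limit f h"
      using heat_limit_exists[OF f] by blast
    let ?g = "\<lambda>x. f x - h x"
    have fi: "exp_integrable f" using that by (simp add: heat_bmo_space_def)
    have hi: "exp_integrable h" using f h by (rule heat_limit_exp_integrable)
    have "?g absolutely_integrable_on S" if "compact S" for S
      using that by (intro exp_integrable_locally exp_integrable_diff fi hi) (auto simp: compact_imp_bounded lmeasurable_compact fmeasurableD)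
    moreover have "bmo_norm \<phi> ?g \<le> ennreal (C2 * enn2real (heat_bmo_norm \<phi> f))"
      using C2[OF f h] \<open>C2 > 0\<close> by (subst (asm) mean_iff) auto
    ultimately have "?g \<in> bmo_space \<phi>"
      using order.strict_trans1[OF _ ennreal_less_top] by (auto simp: bmo_space_def)
    moreover have "(\<lambda>x. f x - ?g x) \<in> heat_fixed"
      using hi heat_limit_fixed[OF f h] by (simp add: heat_fixed_def)
    ultimately show ?thesis by (rule bexI[where x = ?g, rotated])
  qed
  \<comment> \<open>By linearity a heat fixed difference cancels from
    \<open>f - heat (r^2) f\<close>. It does so only almost everywhere, which the integrals in the
    norm do not see.\<close>
  have norm_eq: "heat_bmo_norm \<phi> f = heat_bmo_norm \<phi> g"
    if "f \<in> heat_bmo_space \<phi>" "g \<in> heat_bmo_space \<phi>" "(\<lambda>x. f x - g x) \<in> heat_fixed" for f g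
    unfolding heat_bmo_norm_def
  proof (intro SUP_cong refl)
    fix x and r :: real assume "r \<in> {0<..}"
    then have "0 < r\<^sup>2" by simp
    have fg: "exp_integrable f" "exp_integrable g"
      using that by (auto simp: heat_bmo_space_def)
    have "AE y in lebesgue. heat (r\<^sup>2) (\<lambda>x. f x - g x) y = f y - g y"
      using that(3) \<open>0 < r\<^sup>2\<close> by (simp add: heat_fixed_def)
    then have "AE y in lebesgue. f y - heat (r\<^sup>2) f y = g y - heat (r\<^sup>2) g y"
    proof eventually_elim
      case (elim y)
      then show ?case
        unfolding heat_diff[OF fg \<open>0 < r\<^sup>2\<close>] by (simp add: algebra_simps)
    qed
    then have "(\<integral>\<^sup>+y\<in>ball x r. ennreal (norm (f y - heat (r\<^sup>2) f y)) \<partial>lebesgue)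
        = (\<integral>\<^sup>+y\<in>ball x r. ennreal (norm (g y - heat (r\<^sup>2) g y)) \<partial>lebesgue)"
      by (intro nn_integral_cong_AE) (auto elim: eventually_mono)
    then show "(\<integral>\<^sup>+y\<in>ball x r. ennreal (norm (f y - heat (r\<^sup>2) f y)) \<partial>lebesgue) / ball_norm \<phi> x r
        = (\<integral>\<^sup>+y\<in>ball x r. ennreal (norm (g y - heat (r\<^sup>2) g y)) \<partial>lebesgue) / ball_norm \<phi> x r"
      by simp
  qed
  show ?thesis
  proof (intro conjI subsetI ballI exI[of _ "max C1 C2"] impI)
    show "0 < max C1 C2" using \<open>C1 > 0\<close> by simp
    fix f g assume fg: "f \<in> heat_bmo_space \<phi>" "g \<in> bmo_space \<phi>" "(\<lambda>x. f x - g x) \<in> heat_fixed"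
    have eq: "heat_bmo_norm \<phi> f = heat_bmo_norm \<phi> g"
      using fg in_heat by (intro norm_eq) auto
    show "heat_bmo_norm \<phi> f \<le> ennreal (max C1 C2) * bmo_norm \<phi> g"
      unfolding eq by (rule order.trans[OF heat_le[OF fg(2)]]) (intro mult_right_mono ennreal_leI, auto)
    show "bmo_norm \<phi> g \<le> ennreal (max C1 C2) * heat_bmo_norm \<phi> f"
      unfolding eq by (rule order.trans[OF bmo_le[OF fg(2)]]) (intro mult_right_mono ennreal_leI, auto)
  qed (use in_heat decomposition in auto)
qed

end
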